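(* Let $\sigma$ be a fixed relational signature containing only binary relations. Given a Boolean SAC2RPQ $Q$ over $\sigma$, one can compute in time $O(|Q|)$ an equivalent ICG-Datalog program $P$ of body size $4$.
   Context: A $\sigma$-instance $I$ is a finite set of ground facts; $\mathrm{dom}(I)$ is the set of elements occurring in $I$. Two Boolean queries are equivalent if they are satisfied by the same $\sigma$-instances. Path queries. Let $\Sigma$ be the set of relation symbols of $\sigma$ and $\Sigma^{\pm}=\Sigma\sqcup\{R^-\mid R\in\Sigma\}$. A two-way regular path query (2RPQ) $Q_L(x,y)$ is given by a regular language $L$ over $\Sigma^\pm$ (provided as a regular expression); $Q_L(a,b)$ holds on $I$ for $a,b\in\mathrm{dom}(I)$ iff there is a path from $a$ to $b$ whose label is in $L$, where $R$ means traversing an $R$-fact forward and $R^-$ means traversing an $R$-fact in the reverse direction. A C2RPQ is a conjunctive query whose atoms are 2RPQs. A SAC2RPQ (strongly acyclic C2RPQ) is a C2RPQ such that the undirected graph on its variables given by co-occurrence in an atom is acyclic, there are no loops (atoms $Q_L(x,x)$), and no multi-edges (each pair of variables occurs in at most one atom). It is Boolean if all variables are existentially quantified. Stratified Datalog. A Datalog program $P$ over the extensional signature $\sigma$ has an intensional signature $\sigma_{\mathrm{int}}$ disjoint from $\sigma$, a 0-ary goal predicate $\mathrm{Goal}\in\sigma_{\mathrm{int}}$, and rules $R(\mathbf x)\leftarrow\psi(\mathbf x,\mathbf y)$ with $R\in\sigma_{\mathrm{int}}$ and $\psi$ a conjunction of atoms over $\sigma\sqcup\sigma_{\mathrm{int}}$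 and negated intensional atoms, in which every variable of $\mathbf x$ occurs. The program must have a stratification: an ordered partition $P_1\sqcup\dots\sqcup P_n$ of the rules and a stratum $\zeta(R)\in\{1,\dots,n\}$ for each $R\in\sigma_{\mathrm{int}}$ such that all rules with head relation $R$ are in $P_{\zeta(R)}$, every intensional atom $R(\mathbf z)$ in a body of $P_i$ has $\zeta(R)\le i$, and every negated atom $\neg R(\mathbf z)$ in a body of $P_i$ has $\zeta(R)<i$. The semantics $P(I)$ is computed stratum by stratum as a least fixpoint, with variables ranging over $\mathrm{dom}(I)$: starting from $I$, derive $R(\mathbf a)$ whenever $\exists\mathbf y\,\psi(\mathbf a,\mathbf y)$ holds. $I\models P$ iff $\mathrm{Goal}()$ is derived. The arity of $P$ is the maximum of the arities of $\sigma$ and $\sigma_{\mathrm{int}}$. ICG-Datalog. An intensional literal $A(\mathbf x)$ or $\neg A(\mathbf x)$ in a rule body $\psi$ is clique-guarded if any two distinct variables of $\mathbf x$ co-occur in some extensional atom of $\psi$. $P$ is an ICG-Datalog program if in every rule all intensional body literals are clique-guarded in that body. The body size of $P$ is the maximal number of atoms in the body of a rule of $P$, multiplied by the arity of $P$. *)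

theory Defs
  imports Main
begin

section \<open>Relational instances\<close>

type_synonym relsym = nat
type_synonym var = nat
type_synonym signature = "relsym \<rightharpoonup> nat"  \<comment> \<open>relation symbols with their arities\<close>
type_synonym 'a fact = "relsym \<times> 'a list"

definition is_instance :: "signature \<Rightarrow> 'a fact set \<Rightarrow> bool" where
  "is_instance \<sigma> I \<longleftrightarrow> finite I \<and> (\<forall>(R, as) \<in> I. \<sigma> R = Some (length as))"

definition adom :: "'a fact set \<Rightarrow> 'a set" where
  "adom I = (\<Union>(R, as) \<in> I. set as)"


section \<open>Two-way regular path queries\<close>

datatype 'l rexp =
    Zero | One | Sym 'l
  | Plus "'l rexp" "'l rexp" | Times "'l rexp" "'l rexp" | Star "'l rexp"

primrec lang :: "'l rexp \<Rightarrow> 'l list set" where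
  "lang Zero = {}"
| "lang One = {[]}"
| "lang (Sym l) = {[l]}"
| "lang (Plus r s) = lang r \<union> lang s"
| "lang (Times r s) = {u @ v | u v. u \<in> lang r \<and> v \<in> lang s}"
| "lang (Star r) = {concat ws | ws. set ws \<subseteq> lang r}"

datatype letter = Fwd relsym | Bwd relsym

primrec letter_rel :: "letter \<Rightarrow> relsym" where
  "letter_rel (Fwd R) = R"
| "letter_rel (Bwd R) = R"

inductive path :: "'a fact set \<Rightarrow> 'a \<Rightarrow> letter list \<Rightarrow> 'a \<Rightarrow> bool" for I where
  "a \<in> adom I \<Longrightarrow> path I a [] a"
| "(R, [a, b]) \<in> I \<Longrightarrow> path I b w c \<Longrightarrow> path I a (Fwd R # w) c"
| "(R, [b, a]) \<in> I \<Longrightarrow> path I b w c \<Longrightarrow> path I a (Bwd R # w) c"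

definition rpq_holds :: "'a fact set \<Rightarrow> letter rexp \<Rightarrow> 'a \<Rightarrow> 'a \<Rightarrow> bool" where
  "rpq_holds I r a b \<longleftrightarrow>
     a \<in> adom I \<and> b \<in> adom I \<and> (\<exists>w \<in> lang r. path I a w b)"

text \<open>
  A Boolean C2RPQ is the list of its atoms; \<open>(x, r, y)\<close> is the atom with language
  \<open>lang r\<close> from \<open>x\<close> to \<open>y\<close>. All variables are existentially quantified.
\<close>

type_synonym c2rpq = "(var \<times> letter rexp \<times> var) list"

definition c2rpq_over :: "signature \<Rightarrow> c2rpq \<Rightarrow> bool" where
  "c2rpq_over \<sigma> Q \<longleftrightarrow> (\<forall>(x, r, y) \<in> set Q. \<forall>l \<in> set_rexp r. letter_rel l \<in> dom \<sigma>)"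

definition sat_c2rpq :: "'a fact set \<Rightarrow> c2rpq \<Rightarrow> bool" where
  "sat_c2rpq I Q \<longleftrightarrow> (\<exists>\<nu>. \<forall>(x, r, y) \<in> set Q. rpq_holds I r (\<nu> x) (\<nu> y))"

definition adjacent :: "c2rpq \<Rightarrow> var \<Rightarrow> var \<Rightarrow> bool" where
  "adjacent Q x y \<longleftrightarrow> (\<exists>r. (x, r, y) \<in> set Q \<or> (y, r, x) \<in> set Q)"

definition acyclic_c2rpq :: "c2rpq \<Rightarrow> bool" where
  "acyclic_c2rpq Q \<longleftrightarrow>
     \<not> (\<exists>xs. length xs \<ge> 3 \<and> distinct xs \<and>
          (\<forall>i < length xs. adjacent Q (xs ! i) (xs ! (Suc i mod length xs))))"

definition no_loops :: "c2rpq \<Rightarrow> bool" where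
  "no_loops Q \<longleftrightarrow> (\<forall>(x, r, y) \<in> set Q. x \<noteq> y)"

definition no_multi_edges :: "c2rpq \<Rightarrow> bool" where
  "no_multi_edges Q \<longleftrightarrow> distinct (map (\<lambda>(x, r, y). {x, y}) Q)"

definition sac2rpq :: "signature \<Rightarrow> c2rpq \<Rightarrow> bool" where
  "sac2rpq \<sigma> Q \<longleftrightarrow>
     c2rpq_over \<sigma> Q \<and> acyclic_c2rpq Q \<and> no_loops Q \<and> no_multi_edges Q"


section \<open>Stratified Datalog\<close>

datatype atom = Atom (pred: relsym) (args: "var list")

datatype literal = Pos (atom_of: atom) | Neg (atom_of: atom)

datatype rule = Rule (head: atom) (body: "literal list")

datatype program =
  Program (goal: relsym) (decls: "(relsym \<times> nat) list") (rules: "rule list")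

abbreviation isig :: "program \<Rightarrow> signature" where
  "isig P \<equiv> map_of (decls P)"

definition rule_vars :: "rule \<Rightarrow> var set" where
  "rule_vars r = set (args (head r)) \<union> (\<Union>l \<in> set (body r). set (args (atom_of l)))"

definition wf_literal :: "signature \<Rightarrow> signature \<Rightarrow> literal \<Rightarrow> bool" where
  "wf_literal \<sigma> \<tau> l \<longleftrightarrow>
     (case l of
        Pos A \<Rightarrow> (\<sigma> ++ \<tau>) (pred A) = Some (length (args A))
      | Neg A \<Rightarrow> \<tau> (pred A) = Some (length (args A)))"

definition wf_rule :: "signature \<Rightarrow> signature \<Rightarrow> rule \<Rightarrow> bool" where
  "wf_rule \<sigma> \<tau> r \<longleftrightarrow>
     \<tau> (pred (head r)) = Some (length (args (head r))) \<and>
     (\<forall>l \<in> set (body r). wf_literal \<sigma> \<tau> l) \<and>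
     set (args (head r)) \<subseteq> (\<Union>l \<in> set (body r). set (args (atom_of l)))"

text \<open>
  The class \<open>P\<^sub>i\<close> of the partition of the rules consists of the rules whose
  head relation has stratum \<open>i\<close>, so a stratification is determined by \<open>n\<close> and \<open>\<zeta>\<close>.
\<close>

definition stratification :: "program \<Rightarrow> nat \<Rightarrow> (relsym \<Rightarrow> nat) \<Rightarrow> bool" where
  "stratification P n \<zeta> \<longleftrightarrow>
     (\<forall>R \<in> dom (isig P). \<zeta> R \<in> {1..n}) \<and>
     (\<forall>r \<in> set (rules P). \<forall>l \<in> set (body r).
        case l of
          Pos A \<Rightarrow> pred A \<in> dom (isig P) \<longrightarrow> \<zeta> (pred A) \<le> \<zeta> (pred (head r))
        | Neg A \<Rightarrow> \<zeta> (pred A) < \<zeta> (pred (head r)))"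

definition datalog_program :: "signature \<Rightarrow> program \<Rightarrow> bool" where
  "datalog_program \<sigma> P \<longleftrightarrow>
     distinct (map fst (decls P)) \<and> dom \<sigma> \<inter> dom (isig P) = {} \<and>
     isig P (goal P) = Some 0 \<and>
     (\<forall>r \<in> set (rules P). wf_rule \<sigma> (isig P) r) \<and>
     (\<exists>n \<zeta>. stratification P n \<zeta>)"

text \<open>
  Least fixpoint of one stratum with rules \<open>rs\<close>, starting from the result \<open>J\<close> of the
  previous strata. Negated relations belong to strictly lower strata, so negated
  atoms are evaluated on \<open>J\<close>.
\<close>

inductive_set lfp_stratum :: "'a set \<Rightarrow> rule set \<Rightarrow> 'a fact set \<Rightarrow> 'a fact set"
  for D rs J where
  start: "f \<in> J \<Longrightarrow> f \<in> lfp_stratum D rs J"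
| derive_head: "\<lbrakk> r \<in> rs; \<forall>x \<in> rule_vars r. \<nu> x \<in> D;
     \<forall>A. Pos A \<in> set (body r) \<longrightarrow> (pred A, map \<nu> (args A)) \<in> lfp_stratum D rs J;
     \<forall>A. Neg A \<in> set (body r) \<longrightarrow> (pred A, map \<nu> (args A)) \<notin> J \<rbrakk>
   \<Longrightarrow> (pred (head r), map \<nu> (args (head r))) \<in> lfp_stratum D rs J"

primrec strata :: "program \<Rightarrow> (relsym \<Rightarrow> nat) \<Rightarrow> 'a fact set \<Rightarrow> nat \<Rightarrow> 'a fact set" where
  "strata P \<zeta> I 0 = I"
| "strata P \<zeta> I (Suc i) =
     lfp_stratum (adom I) {r \<in> set (rules P). \<zeta> (pred (head r)) = Suc i} (strata P \<zeta> I i)"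

text \<open>
  The result does not depend on the stratification (Apt, Blair and Walker), so any
  of them may be used.
\<close>

definition sat_program :: "'a fact set \<Rightarrow> program \<Rightarrow> bool" where
  "sat_program I P \<longleftrightarrow>
     (\<exists>n \<zeta>. stratification P n \<zeta> \<and> (goal P, []) \<in> strata P \<zeta> I n)"

definition arity :: "signature \<Rightarrow> program \<Rightarrow> nat" where
  "arity \<sigma> P = Max (ran \<sigma> \<union> ran (isig P))"

definition body_size :: "signature \<Rightarrow> program \<Rightarrow> nat" where
  "body_size \<sigma> P = Max (insert 0 ((\<lambda>r. length (body r)) ` set (rules P))) * arity \<sigma> P"

definition clique_guarded :: "signature \<Rightarrow> literal list \<Rightarrow> atom \<Rightarrow> bool" where
  "clique_guarded \<sigma> \<psi> A \<longleftrightarrow>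
     (\<forall>x \<in> set (args A). \<forall>y \<in> set (args A). x \<noteq> y \<longrightarrow>
        (\<exists>B. Pos B \<in> set \<psi> \<and> pred B \<in> dom \<sigma> \<and> x \<in> set (args B) \<and> y \<in> set (args B)))"

definition icg_datalog :: "signature \<Rightarrow> program \<Rightarrow> bool" where
  "icg_datalog \<sigma> P \<longleftrightarrow>
     datalog_program \<sigma> P \<and>
     (\<forall>r \<in> set (rules P). \<forall>l \<in> set (body r).
        pred (atom_of l) \<in> dom (isig P) \<longrightarrow> clique_guarded \<sigma> (body r) (atom_of l))"


section \<open>Encodings as sequences of words\<close>

text \<open>
  One word per symbol: names of relations and variables are single words, and regular
  expressions are written in prefix notation.
\<close>

primrec enc_list :: "('b \<Rightarrow> nat list) \<Rightarrow> 'b list \<Rightarrow> nat list" where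
  "enc_list f [] = [0]"
| "enc_list f (x # xs) = 1 # f x @ enc_list f xs"

primrec enc_letter :: "letter \<Rightarrow> nat list" where
  "enc_letter (Fwd R) = [0, R]"
| "enc_letter (Bwd R) = [1, R]"

primrec enc_rexp :: "letter rexp \<Rightarrow> nat list" where
  "enc_rexp Zero = [0]"
| "enc_rexp One = [1]"
| "enc_rexp (Sym l) = 2 # enc_letter l"
| "enc_rexp (Plus r s) = 3 # enc_rexp r @ enc_rexp s"
| "enc_rexp (Times r s) = 4 # enc_rexp r @ enc_rexp s"
| "enc_rexp (Star r) = 5 # enc_rexp r"

definition enc_query :: "c2rpq \<Rightarrow> nat list" where
  "enc_query Q = enc_list (\<lambda>(x, r, y). x # y # enc_rexp r) Q"

definition query_size :: "c2rpq \<Rightarrow> nat" where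
  "query_size Q = length (enc_query Q)"

primrec enc_atom :: "atom \<Rightarrow> nat list" where
  "enc_atom (Atom R xs) = R # enc_list (\<lambda>x. [x]) xs"

primrec enc_literal :: "literal \<Rightarrow> nat list" where
  "enc_literal (Pos A) = 0 # enc_atom A"
| "enc_literal (Neg A) = 1 # enc_atom A"

primrec enc_rule :: "rule \<Rightarrow> nat list" where
  "enc_rule (Rule A ls) = enc_atom A @ enc_list enc_literal ls"

primrec enc_program :: "program \<Rightarrow> nat list" where
  "enc_program (Program g ds rs) =
     g # enc_list (\<lambda>(R, k). [R, k]) ds @ enc_list enc_rule rs"

lemma enc_list_uniquely_readable:
  assumes "\<And>x y u v. f x @ u = f y @ v \<Longrightarrow> x = y \<and> u = v"
    and "enc_list f xs @ u = enc_list f ys @ v"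
  shows "xs = ys \<and> u = v"
  using assms(2)
proof (induction xs arbitrary: ys)
  case Nil
  then show ?case by (cases ys) auto
next
  case (Cons x xs)
  then obtain y ys' where ys: "ys = y # ys'" by (cases ys) auto
  with Cons.prems have "f x @ (enc_list f xs @ u) = f y @ (enc_list f ys' @ v)" by simp
  then have "x = y" "enc_list f xs @ u = enc_list f ys' @ v" using assms(1) by blast+
  then show ?case using Cons.IH ys by blast
qed

lemma enc_rexp_uniquely_readable:
  "enc_rexp r @ u = enc_rexp s @ v \<Longrightarrow> r = s \<and> u = v"
proof (induction r arbitrary: s u v)
  case Zero
  then show ?case by (cases s) auto
next
  case One
  then show ?case by (cases s) auto
next
  case (Sym l)
  then obtain k where s: "s = Sym k" by (cases s) auto
  show ?case using Sym.prems s by (cases k; cases l) auto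
next
  case (Plus r1 r2)
  from Plus.prems obtain s1 s2 where s: "s = Plus s1 s2" by (cases s) auto
  have "enc_rexp r1 @ (enc_rexp r2 @ u) = enc_rexp s1 @ (enc_rexp s2 @ v)"
    using Plus.prems s by simp
  from Plus.IH(1)[OF this] Plus.IH(2)[of u s2 v] s show ?case by simp
next
  case (Times r1 r2)
  from Times.prems obtain s1 s2 where s: "s = Times s1 s2" by (cases s) auto
  have "enc_rexp r1 @ (enc_rexp r2 @ u) = enc_rexp s1 @ (enc_rexp s2 @ v)"
    using Times.prems s by simp
  from Times.IH(1)[OF this] Times.IH(2)[of u s2 v] s show ?case by simp
next
  case (Star r)
  from Star.prems obtain s' where s: "s = Star s'" by (cases s) auto
  then show ?case using Star.IH[of u s' v] Star.prems by simp
qed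

lemma inj_enc_query: "inj enc_query"
proof (rule injI)
  let ?f = "\<lambda>(x, r, y). x # y # enc_rexp r"
  fix Q Q' assume "enc_query Q = enc_query Q'"
  then have eq: "enc_list ?f Q @ [] = enc_list ?f Q' @ []"
    by (simp add: enc_query_def)
  have "a = b \<and> u = v" if "?f a @ u = ?f b @ v" for a b u v
    using that enc_rexp_uniquely_readable[of "fst (snd a)" u "fst (snd b)" v]
    by (simp add: case_prod_unfold prod_eq_iff)
  then show "Q = Q'" using enc_list_uniquely_readable[OF _ eq] by metis
qed

lemma enc_atom_uniquely_readable:
  assumes "enc_atom A @ u = enc_atom B @ v"
  shows "A = B \<and> u = v"
proof -
  obtain R xs S ys where AB: "A = Atom R xs" "B = Atom S ys" by (cases A, cases B)
  with assms have "R = S" and eq: "enc_list (\<lambda>x. [x]) xs @ u = enc_list (\<lambda>x. [x]) ys @ v"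
    by simp_all
  moreover have "xs = ys \<and> u = v" by (rule enc_list_uniquely_readable[OF _ eq]) simp
  ultimately show ?thesis using AB by simp
qed

lemma enc_literal_uniquely_readable:
  "enc_literal k @ u = enc_literal l @ v \<Longrightarrow> k = l \<and> u = v"
  by (cases k; cases l) (simp_all add: enc_atom_uniquely_readable)

lemma enc_rule_uniquely_readable:
  assumes "enc_rule r @ u = enc_rule s @ v"
  shows "r = s \<and> u = v"
proof -
  obtain A ks B ls where rs: "r = Rule A ks" "s = Rule B ls" by (cases r, cases s)
  with assms have
    "enc_atom A @ (enc_list enc_literal ks @ u) = enc_atom B @ (enc_list enc_literal ls @ v)"
    by simp
  from enc_atom_uniquely_readable[OF this]
  have "A = B" and eq: "enc_list enc_literal ks @ u = enc_list enc_literal ls @ v" by simp_all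
  moreover have "ks = ls \<and> u = v"
    by (rule enc_list_uniquely_readable[OF enc_literal_uniquely_readable eq])
  ultimately show ?thesis using rs by simp
qed

lemma inj_enc_program: "inj enc_program"
proof (rule injI)
  fix P P' assume eq: "enc_program P = enc_program P'"
  obtain g ds rs where P: "P = Program g ds rs" by (cases P)
  obtain g' ds' rs' where P': "P' = Program g' ds' rs'" by (cases P')
  have eq1: "enc_list (\<lambda>(R, k). [R, k]) ds @ enc_list enc_rule rs =
      enc_list (\<lambda>(R, k). [R, k]) ds' @ enc_list enc_rule rs'"
    using eq P P' by simp
  have "ds = ds' \<and> enc_list enc_rule rs = enc_list enc_rule rs'"
    by (rule enc_list_uniquely_readable[OF _ eq1]) (simp add: case_prod_unfold prod_eq_iff)
  then have "ds = ds'" and eq2: "enc_list enc_rule rs @ [] = enc_list enc_rule rs' @ []"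
    by simp_all
  moreover have "rs = rs' \<and> [] = ([] :: nat list)"
    by (rule enc_list_uniquely_readable[OF enc_rule_uniquely_readable eq2])
  ultimately show "P = P'" using eq P P' by simp
qed


section \<open>Random access machines\<close>

text \<open>
  A unit-cost random access machine with structured control flow. A machine uses
  finitely many registers and finitely many arrays; array cells are addressed by the
  value of an operand. The only arithmetic operations are successor and predecessor,
  hence words grow by at most one per step and unit cost is adequate.
\<close>

datatype operand = Lit nat | Reg nat

datatype test = Equal operand operand | Less operand operand

datatype cmd =
    Skip
  | Assign nat operand         \<comment> \<open>register := operand\<close>
  | Inc nat
  | Dec nat
  | Load nat nat operand       \<comment> \<open>register := array[operand]\<close>
  | Store nat operand operand  \<comment> \<open>array[operand] := operand\<close>
  | Write operand              \<comment> \<open>append a word to the output\<close>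
  | Seq cmd cmd
  | Cond test cmd cmd
  | While test cmd

record state =
  regs :: "nat \<Rightarrow> nat"
  arrs :: "nat \<Rightarrow> nat \<Rightarrow> nat"
  outp :: "nat list"

primrec val :: "state \<Rightarrow> operand \<Rightarrow> nat" where
  "val s (Lit k) = k"
| "val s (Reg r) = regs s r"

primrec passes :: "state \<Rightarrow> test \<Rightarrow> bool" where
  "passes s (Equal u v) \<longleftrightarrow> val s u = val s v"
| "passes s (Less u v) \<longleftrightarrow> val s u < val s v"

definition set_reg :: "nat \<Rightarrow> nat \<Rightarrow> state \<Rightarrow> state" where
  "set_reg r k s = s\<lparr>regs := (regs s)(r := k)\<rparr>"

text \<open>\<open>exec c s t s'\<close>: started in \<open>s\<close>, the command \<open>c\<close> halts in \<open>s'\<close> after \<open>t\<close> steps.\<close>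

inductive exec :: "cmd \<Rightarrow> state \<Rightarrow> nat \<Rightarrow> state \<Rightarrow> bool" where
  Skip: "exec Skip s 1 s"
| Assign: "exec (Assign r u) s 1 (set_reg r (val s u) s)"
| Inc: "exec (Inc r) s 1 (set_reg r (regs s r + 1) s)"
| Dec: "exec (Dec r) s 1 (set_reg r (regs s r - 1) s)"
| Load: "exec (Load r a u) s 1 (set_reg r (arrs s a (val s u)) s)"
| Store: "exec (Store a u v) s 1
     (s\<lparr>arrs := (arrs s)(a := (arrs s a)(val s u := val s v))\<rparr>)"
| Write: "exec (Write u) s 1 (s\<lparr>outp := outp s @ [val s u]\<rparr>)"
| Seq: "exec c s t s' \<Longrightarrow> exec d s' t' s'' \<Longrightarrow> exec (Seq c d) s (t + t') s''"
| CondTrue: "passes s b \<Longrightarrow> exec c s t s' \<Longrightarrow> exec (Cond b c d) s (1 + t) s'"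
| CondFalse: "\<not> passes s b \<Longrightarrow> exec d s t s' \<Longrightarrow> exec (Cond b c d) s (1 + t) s'"
| WhileTrue: "passes s b \<Longrightarrow> exec c s t s' \<Longrightarrow> exec (While b c) s' t' s''
     \<Longrightarrow> exec (While b c) s (1 + t + t') s''"
| WhileFalse: "\<not> passes s b \<Longrightarrow> exec (While b c) s 1 s"

text \<open>Initially array 0 holds the input, register 0 its length, and all else is zero.\<close>

definition init_state :: "nat list \<Rightarrow> state" where
  "init_state ws =
     \<lparr>regs = (\<lambda>_. 0)(0 := length ws),
      arrs = (\<lambda>_ _. 0)(0 := (\<lambda>i. if i < length ws then ws ! i else 0)),
      outp = []\<rparr>"

definition computes_within :: "cmd \<Rightarrow> nat list \<Rightarrow> nat list \<Rightarrow> nat \<Rightarrow> bool" where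
  "computes_within M ws ws' T \<longleftrightarrow>
     (\<exists>t s. exec M (init_state ws) t s \<and> outp s = ws' \<and> t \<le> T)"

inductive_cases exec_SkipE: "exec Skip s t s'"
inductive_cases exec_AssignE: "exec (Assign r u) s t s'"
inductive_cases exec_IncE: "exec (Inc r) s t s'"
inductive_cases exec_DecE: "exec (Dec r) s t s'"
inductive_cases exec_LoadE: "exec (Load r a u) s t s'"
inductive_cases exec_StoreE: "exec (Store a u v) s t s'"
inductive_cases exec_WriteE: "exec (Write u) s t s'"
inductive_cases exec_SeqE: "exec (Seq c d) s t s'"
inductive_cases exec_CondE: "exec (Cond b c d) s t s'"
inductive_cases exec_WhileE: "exec (While b c) s t s'"

lemma exec_deterministic:
  "exec c s t s' \<Longrightarrow> exec c s u s'' \<Longrightarrow> t = u \<and> s' = s''"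
proof (induction arbitrary: u s'' rule: exec.induct)
  case Seq
  from Seq.prems show ?case by (rule exec_SeqE) (metis Seq.IH)
next
  case CondTrue
  from CondTrue.prems show ?case
    by (rule exec_CondE) (use CondTrue.hyps in \<open>auto dest: CondTrue.IH\<close>)
next
  case CondFalse
  from CondFalse.prems show ?case
    by (rule exec_CondE) (use CondFalse.hyps in \<open>auto dest: CondFalse.IH\<close>)
next
  case WhileTrue
  from WhileTrue.prems show ?case
    by (rule exec_WhileE) (use WhileTrue.hyps in \<open>auto dest: WhileTrue.IH(1) WhileTrue.IH(2)\<close>)
next
  case WhileFalse
  from WhileFalse.prems show ?case
    by (rule exec_WhileE) (use WhileFalse.hyps in auto)
qed (erule exec_SkipE exec_AssignE exec_IncE exec_DecE exec_LoadE exec_StoreE exec_WriteE, simp)+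

end

theory Submission
  imports Defs
begin

text \<open>
  Message passing on the query forest. Every atom is an automaton whose states carry two unary
  predicates: \<open>F\<close> holds of an element from which, in this state, the right end of the atom can be
  reached at an element that has received the message sent into the atom there; \<open>B\<close> is its mirror
  image at the left end. At each end of an atom (a \<^emph>\<open>port\<close>), the message sent into the atom is the
  conjunction of the messages received at the other ports of the same variable. These mutually
  recursive rules form a positive program, and its least fixpoint is arc consistent for every query.
  Acyclicity enters twice: it turns arc consistency into a solution, and it makes the messages
  well-founded, so that those supported by a solution are derivable.

  No traversal of the forest is needed. All predicates are named after positions of words in the input,
  and the ports of a variable are chained in input order, with prefix and suffix conjunctions of
  their messages; hence a machine can write the program while reading the query once.
\<close>

section \<open>Paths\<close>

text \<open>Body size 4 leaves two atoms per body at arity two. So all rules define unary or nullary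
  predicates, which makes guardedness automatic but forces every longer conjunction into a chain.
  Linear size forbids writing, at a variable with d ports, d separate conjunctions of d - 1
  messages; prefixes and suffixes together cost O(d). A suffix mentions ports that are not read yet:
  the rule for a port is therefore written when its successor is met, and the rule starting the
  suffix chain at the last port in a final pass.

  Rooting the forest would need a traversal, so every atom carries a message in both directions. Arc
  consistency is usually a greatest fixpoint, reached by deletion; for a least fixpoint the question
  is why nothing unsupported is derived. The answer is local: any family of sets closed under the
  transitions of an atom bounds what is derived inside it, and such a family can be interpolated
  from its values at the two ends.\<close>

definition rel :: "'a fact set \<Rightarrow> letter rexp \<Rightarrow> 'a rel" where
  "rel I r = {(a, b). \<exists>w \<in> lang r. path I a w b}"

text \<open>\<open>None\<close> is a silent move; \<open>Some (d, R)\<close> traverses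
  \<open>R\<close> forward if \<open>d\<close> holds and backward otherwise. The type of names stays
  open because the machine writes the same labels with a register in place of a relation
  symbol.\<close>

type_synonym 'p label = "(bool \<times> 'p) option"

fun label :: "letter \<Rightarrow> nat label" where
  "label (Fwd R) = Some (True, R)"
| "label (Bwd R) = Some (False, R)"

definition flip :: "'p label \<Rightarrow> 'p label" where
  "flip = map_option (map_prod Not id)"

fun lrel :: "'a fact set \<Rightarrow> nat label \<Rightarrow> 'a rel" where
  "lrel I None = Id_on (adom I)"
| "lrel I (Some (d, R)) = {(a, b). (R, if d then [a, b] else [b, a]) \<in> I}"

lemma lrel_flip: "lrel I (flip l) = (lrel I l)\<inverse>"
  by (cases l) (auto simp: flip_def)

lemma fact_adom: "(R, [a, b]) \<in> I \<Longrightarrow> a \<in> adom I \<and> b \<in> adom I"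
  by (force simp: adom_def)

lemma lrel_adom: "(a, b) \<in> lrel I l \<Longrightarrow> a \<in> adom I \<and> b \<in> adom I"
  by (cases "(I, l)" rule: lrel.cases) (auto split: if_splits dest: fact_adom)

lemma path_adom: "path I a w b \<Longrightarrow> a \<in> adom I \<and> b \<in> adom I"
  by (induction rule: path.induct) (auto dest: fact_adom)

inductive_simps path_Nil: "path I a [] b"
inductive_simps path_Cons: "path I a (l # w) b"

lemma path_append: "path I a (u @ v) c \<longleftrightarrow> (\<exists>b. path I a u b \<and> path I b v c)"
proof (induction u arbitrary: a)
  case Nil
  then show ?case by (auto simp: path_Nil dest: path_adom)
next
  case (Cons l u)
  then show ?case unfolding append_Cons path_Cons by blast
qed

lemma rpq_holds_rel: "rpq_holds I r a b \<longleftrightarrow> (a, b) \<in> rel I r"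
  by (auto simp: rpq_holds_def rel_def dest: path_adom)

lemma rel_adom: "(a, b) \<in> rel I r \<Longrightarrow> a \<in> adom I \<and> b \<in> adom I"
  by (auto simp: rel_def dest: path_adom)

lemma rel_Zero: "rel I Zero = {}"
  by (auto simp: rel_def)

lemma rel_One: "rel I One = lrel I None"
  by (auto simp: rel_def path_Nil)

lemma rel_Sym: "rel I (Sym l) = lrel I (label l)"
  by (cases l) (auto simp: rel_def path_Nil path_Cons dest: fact_adom)

lemma rel_Plus: "rel I (Plus r s) = rel I r \<union> rel I s"
  by (auto simp: rel_def)

lemma rel_Times: "rel I (Times r s) = rel I r O rel I s"
  by (fastforce simp: rel_def path_append)

text \<open>Reflexive closure relates every element of the type to itself, but empty paths exist
  only within the active domain. Restricting the first component suffices, as \<open>rel I r\<close>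
  never leaves the domain.\<close>

lemma rel_Star: "rel I (Star r) = Id_on (adom I) O (rel I r)\<^sup>*"
proof (intro set_eqI iffI; clarify)
  fix a b assume "(a, b) \<in> rel I (Star r)"
  then obtain ws where "set ws \<subseteq> lang r" "path I a (concat ws) b" by (auto simp: rel_def)
  then have "(a, b) \<in> (rel I r)\<^sup>*"
  proof (induction ws arbitrary: a)
    case Nil
    then show ?case by (simp add: path_Nil)
  next
    case (Cons w ws)
    then show ?case
      by (fastforce simp: path_append rel_def intro: converse_rtrancl_into_rtrancl)
  qed
  with \<open>path I a (concat ws) b\<close> show "(a, b) \<in> Id_on (adom I) O (rel I r)\<^sup>*"
    by (blast dest: path_adom)
next
  fix a b assume "(a, b) \<in> (rel I r)\<^sup>*" "a \<in> adom I"
  then have "\<exists>ws. set ws \<subseteq> lang r \<and> path I a (concat ws) b"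
  proof (induction rule: rtrancl_induct)
    case base
    then show ?case by (intro exI[of _ "[]"]) (simp add: path_Nil)
  next
    case (step b c)
    then obtain ws w where "set ws \<subseteq> lang r" "path I a (concat ws) b" "w \<in> lang r" "path I b w c"
      by (auto simp: rel_def)
    then show ?case by (intro exI[of _ "ws @ [w]"]) (auto simp: path_append)
  qed
  then show "(a, b) \<in> rel I (Star r)" by (auto simp: rel_def)
qed

section \<open>Leaf elimination in forests\<close>

text \<open>
  A dart \<open>(e, b)\<close> is the end of the edge \<open>e\<close> at its source (\<open>b\<close>) or at its target (\<open>\<not> b\<close>).
\<close>

definition endpoint :: "('e \<Rightarrow> 'v) \<Rightarrow> ('e \<Rightarrow> 'v) \<Rightarrow> 'e \<times> bool \<Rightarrow> 'v" where
  "endpoint f g d = (if snd d then f (fst d) else g (fst d))"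

text \<open>A leaf elimination order read backwards: \<open>(e, b)\<close> is the leaf end, while
  the other end may be old or new, so that further components can start.\<close>

inductive forest :: "('e \<Rightarrow> 'v) \<Rightarrow> ('e \<Rightarrow> 'v) \<Rightarrow> 'e set \<Rightarrow> bool" for f g where
  empty: "forest f g {}"
| add: "\<lbrakk> forest f g A; e \<notin> A; endpoint f g (e, b) \<noteq> endpoint f g (e, \<not> b);
     endpoint f g (e, b) \<notin> endpoint f g ` (A \<times> UNIV) \<rbrakk> \<Longrightarrow> forest f g (insert e A)"

text \<open>Greedy choice along the order: the value at the new leaf is picked last, as a partner of
  the value at the other end. Either end of an edge may be the leaf, hence consistency in both
  directions.\<close>

lemma forest_solution:
  assumes "forest f g A"
    and "\<And>v. W v \<noteq> {}"
    and "\<And>e a. e \<in> A \<Longrightarrow> a \<in> W (f e) \<Longrightarrow> \<exists>b \<in> W (g e). (a, b) \<in> S e"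
    and "\<And>e b. e \<in> A \<Longrightarrow> b \<in> W (g e) \<Longrightarrow> \<exists>a \<in> W (f e). (a, b) \<in> S e"
  shows "\<exists>\<nu>. (\<forall>v. \<nu> v \<in> W v) \<and> (\<forall>e \<in> A. (\<nu> (f e), \<nu> (g e)) \<in> S e)"
  using assms(1,3,4)
proof induction
  case empty
  have "\<exists>\<nu>. \<forall>v. \<nu> v \<in> W v" using assms(2) by (intro choice) blast
  then show ?case by simp
next
  case (add A e b)
  then obtain \<nu> where \<nu>: "\<And>v. \<nu> v \<in> W v" "\<And>e. e \<in> A \<Longrightarrow> (\<nu> (f e), \<nu> (g e)) \<in> S e"
    by (metis insertCI)
  obtain c where c: "c \<in> W (endpoint f g (e, b))"
    "(if b then (c, \<nu> (g e)) else (\<nu> (f e), c)) \<in> S e"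
    using add.prems(1)[of e "\<nu> (f e)"] add.prems(2)[of e "\<nu> (g e)"] \<nu>(1)
    by (cases b) (auto simp: endpoint_def)
  \<comment> \<open>No older edge touches the leaf, so overwriting its value disturbs none of
    them.\<close>
  let ?\<nu> = "\<nu>(endpoint f g (e, b) := c)"
  have "(?\<nu> (f e'), ?\<nu> (g e')) \<in> S e'" if "e' \<in> insert e A" for e'
  proof (cases "e' = e")
    case True
    then show ?thesis using c(2) add.hyps(3) by (cases b) (auto simp: endpoint_def)
  next
    case False
    then have "e' \<in> A" using that by simp
    then have "f e' \<noteq> endpoint f g (e, b)" "g e' \<noteq> endpoint f g (e, b)"
      using add.hyps(4) by (force simp: endpoint_def image_iff)+
    then show ?thesis using \<nu>(2) \<open>e' \<in> A\<close> by simp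
  qed
  moreover have "\<forall>v. ?\<nu> v \<in> W v" using \<nu>(1) c(1) by simp
  ultimately show ?case by blast
qed

text \<open>Read \<open>m d\<close> as: the dart \<open>d\<close> has received its message. A new
  leaf has no other darts, so it sends at once; this provides the one extra premise that older edges
  now have, and the induction hypothesis applies. Only then can the message towards the leaf be
  sent.\<close>

lemma forest_messages:
  assumes "forest f g A"
    and "\<And>e b. e \<in> A \<Longrightarrow>
      (\<And>d. fst d \<in> A \<Longrightarrow> d \<noteq> (e, b) \<Longrightarrow> endpoint f g d = endpoint f g (e, b) \<Longrightarrow> m d) \<Longrightarrow> m (e, \<not> b)"
  shows "\<forall>e \<in> A. \<forall>b. m (e, b)"
  using assms
proof induction
  case empty
  then show ?case by simp
next
  case (add A e b)
  have leaf: "m (e, \<not> b)"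
  proof (rule add.prems(1))
    fix d assume "fst d \<in> insert e A" "d \<noteq> (e, b)" "endpoint f g d = endpoint f g (e, b)"
    have "fst d \<notin> A"
    proof
      assume "fst d \<in> A"
      then have "endpoint f g d \<in> endpoint f g ` (A \<times> UNIV)" by (cases d) auto
      then show False using add.hyps(4) \<open>endpoint f g d = endpoint f g (e, b)\<close> by simp
    qed
    \<comment> \<open>The only candidate left is the other end of \<open>e\<close>, which lies at a
      different vertex; the premise is vacuous.\<close>
    then have "d = (e, \<not> b)"
      using \<open>fst d \<in> insert e A\<close> \<open>d \<noteq> (e, b)\<close> by (cases d; cases "snd d = b") auto
    then show "m d" using add.hyps(3) \<open>endpoint f g d = endpoint f g (e, b)\<close> by simp
  qed simp
  have rest: "m (e', b')" if "e' \<in> A" for e' b'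
  proof -
    have "\<forall>e \<in> A. \<forall>b. m (e, b)"
    proof (rule add.IH)
      fix e' b'
      assume e': "e' \<in> A"
        and m: "\<And>d. fst d \<in> A \<Longrightarrow> d \<noteq> (e', b') \<Longrightarrow> endpoint f g d = endpoint f g (e', b') \<Longrightarrow> m d"
      show "m (e', \<not> b')"
      proof (rule add.prems(1))
        fix d assume d: "fst d \<in> insert e A" "d \<noteq> (e', b')" "endpoint f g d = endpoint f g (e', b')"
        show "m d"
        proof (cases "fst d = e")
          case True
          have "endpoint f g (e, b) \<noteq> endpoint f g d" using add.hyps(4) e' d(3) by force
          then have "d = (e, \<not> b)" using True by (cases d; cases "snd d = b") auto
          then show ?thesis using leaf by simp
        next
          case False
          then show ?thesis using m d by blast
        qed
      qed (use e' in simp)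
    qed
    then show ?thesis using that by blast
  qed
  have "m (e, \<not> \<not> b)"
  proof (rule add.prems(1))
    fix d assume d: "fst d \<in> insert e A" "d \<noteq> (e, \<not> b)" "endpoint f g d = endpoint f g (e, \<not> b)"
    then have "fst d \<noteq> e" using add.hyps(3) by (cases d; cases "snd d = b") auto
    then show "m d" using d(1) rest by (cases d) auto
  qed simp
  with leaf have "m (e, c)" for c by (cases "c = b") auto
  with rest show ?case by auto
qed


text \<open>The first vertex of a longest simple path is a leaf: a second edge there would lead back
  into the path by maximality, beyond its second vertex as there are no multi-edges, and so close a
  cycle.\<close>

lemma leaf_exists:
  assumes "finite A" and "A \<noteq> {}"
    and loops: "\<And>e. e \<in> A \<Longrightarrow> f e \<noteq> g e"
    and multi: "\<And>e e'. e \<in> A \<Longrightarrow> e' \<in> A \<Longrightarrow> {f e, g e} = {f e', g e'} \<Longrightarrow> e = e'"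
    and cycles: "\<And>xs. length xs \<ge> 3 \<Longrightarrow> distinct xs \<Longrightarrow>
      \<exists>i < length xs. \<forall>e \<in> A. {f e, g e} \<noteq> {xs ! i, xs ! (Suc i mod length xs)}"
  obtains e b where "e \<in> A" "endpoint f g (e, b) \<notin> endpoint f g ` ((A - {e}) \<times> UNIV)"
proof -
  define adj where "adj u v \<longleftrightarrow> (\<exists>e \<in> A. {f e, g e} = {u, v})" for u v
  define P where "P xs \<longleftrightarrow> distinct xs \<and> successively adj xs \<and> set xs \<subseteq> f ` A \<union> g ` A" for xs
  have adj_sym: "adj u v \<longleftrightarrow> adj v u" for u v by (simp add: adj_def insert_commute)
  obtain e0 where "e0 \<in> A" using \<open>A \<noteq> {}\<close> by blast
  then have P0: "P [f e0, g e0]" using loops by (auto simp: P_def adj_def)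
  have "length xs \<le> card (f ` A \<union> g ` A)" if "P xs" for xs
    using that \<open>finite A\<close> by (metis P_def card_mono distinct_card finite_UnI finite_imageI)
  then obtain xs where xs: "P xs" and longest: "\<And>ys. P ys \<Longrightarrow> length ys \<le> length xs"
    using ex_has_greatest_nat[of P "[f e0, g e0]" length] P0 by (metis less_Suc_eq_le)
  have "length xs \<ge> 2" using longest[OF P0] by simp
  then obtain l v rest where eq: "xs = l # v # rest"
    by (metis Suc_le_length_iff numeral_2_eq_2)
  then have "adj l v" using xs by (simp add: P_def)
  then obtain e where e: "e \<in> A" "{f e, g e} = {l, v}" by (auto simp: adj_def)
  then have "f e = l \<or> g e = l" by (auto simp: doubleton_eq_iff)
  then have "endpoint f g (e, f e = l) = l" by (auto simp: endpoint_def)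
  then obtain b where b: "endpoint f g (e, b) = l" by blast
  have "l \<notin> endpoint f g ` ((A - {e}) \<times> UNIV)"
  proof
    assume "l \<in> endpoint f g ` ((A - {e}) \<times> UNIV)"
    then obtain e' w where e': "e' \<in> A" "e' \<noteq> e" "{f e', g e'} = {l, w}"
    proof -
      from \<open>l \<in> _\<close> obtain e' c where "e' \<in> A" "e' \<noteq> e" "l = endpoint f g (e', c)" by auto
      then have "{f e', g e'} = {l, endpoint f g (e', \<not> c)}" by (auto simp: endpoint_def)
      with \<open>e' \<in> A\<close> \<open>e' \<noteq> e\<close> show ?thesis using that by blast
    qed
    then have "adj l w" by (auto simp: adj_def)
    have "w \<noteq> l" using e' loops by fastforce
    have "w \<noteq> v" using e e' multi by metis
    have "w \<in> f ` A \<union> g ` A" using e'(1,3) by blast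
    then have "w \<in> set xs"
      using longest[of "w # xs"] xs \<open>adj l w\<close> eq adj_sym by (auto simp: P_def)
    then obtain j where j: "j < length xs" "xs ! j = w" by (auto simp: in_set_conv_nth)
    have "j \<ge> 2"
    proof (rule ccontr)
      assume "\<not> j \<ge> 2"
      then have "j = 0 \<or> j = 1" by linarith
      then show False using j(2) eq \<open>w \<noteq> l\<close> \<open>w \<noteq> v\<close> by auto
    qed
    \<comment> \<open>The initial segment up to \<open>w\<close>, closed by the second edge at
      \<open>l\<close>; \<open>j \<ge> 2\<close> gives the three vertices of a cycle.\<close>
    let ?ys = "take (Suc j) xs"
    have "adj (?ys ! i) (?ys ! (Suc i mod length ?ys))" if "i < length ?ys" for i
    proof (cases "i = j")
      case True
      then have "?ys ! i = w" using j by simp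
      moreover have "?ys ! (Suc i mod length ?ys) = l" using True j(1) eq by (simp add: min_absorb2)
      ultimately show ?thesis using \<open>adj l w\<close> adj_sym by metis
    next
      case False
      then have "Suc i < length xs" "Suc i < Suc j" using that j(1) by auto
      then show ?thesis using xs j(1) by (simp add: P_def successively_conv_nth min_absorb2)
    qed
    moreover have "length ?ys \<ge> 3" "distinct ?ys" using \<open>j \<ge> 2\<close> j(1) xs by (auto simp: P_def)
    ultimately show False using cycles[of ?ys] unfolding adj_def by blast
  qed
  then show ?thesis using that e(1) b by blast
qed

lemma acyclic_forest:
  assumes "finite A"
    and "\<And>e. e \<in> A \<Longrightarrow> f e \<noteq> g e"
    and "\<And>e e'. e \<in> A \<Longrightarrow> e' \<in> A \<Longrightarrow> {f e, g e} = {f e', g e'} \<Longrightarrow> e = e'"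
    and "\<And>xs. length xs \<ge> 3 \<Longrightarrow> distinct xs \<Longrightarrow>
      \<exists>i < length xs. \<forall>e \<in> A. {f e, g e} \<noteq> {xs ! i, xs ! (Suc i mod length xs)}"
  shows "forest f g A"
  using assms
proof (induction "card A" arbitrary: A)
  case 0
  then show ?case by (simp add: forest.empty)
next
  case (Suc n)
  then have "A \<noteq> {}" by auto
  then obtain e b
    where e: "e \<in> A" "endpoint f g (e, b) \<notin> endpoint f g ` ((A - {e}) \<times> UNIV)"
  proof (rule leaf_exists[OF Suc.prems(1)])
    show "\<exists>i < length xs. \<forall>e \<in> A. {f e, g e} \<noteq> {xs ! i, xs ! (Suc i mod length xs)}"
      if "length xs \<ge> 3" "distinct xs" for xs
      using Suc.prems(4)[OF that] .
  qed (use Suc.prems(2,3) in auto)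
  have "forest f g (A - {e})"
  proof (rule Suc.hyps(1))
    show "n = card (A - {e})" using Suc.hyps(2) Suc.prems(1) e(1) by simp
    show "\<exists>i < length xs. \<forall>e' \<in> A - {e}. {f e', g e'} \<noteq> {xs ! i, xs ! (Suc i mod length xs)}"
      if "length xs \<ge> 3" "distinct xs" for xs
      using Suc.prems(4)[OF that] by blast
  qed (use Suc.prems in auto)
  moreover have "endpoint f g (e, b) \<noteq> endpoint f g (e, \<not> b)"
    using Suc.prems(2)[OF e(1)] by (auto simp: endpoint_def)
  ultimately have "forest f g (insert e (A - {e}))" using e(2) by (intro forest.add) auto
  then show ?case using e(1) by (simp add: insert_absorb)
qed

text \<open>Atoms are tagged with a key, later their input position. Distinctness of the list of
  variable pairs makes each pair determine its tagged atom.\<close>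

lemma sac2rpq_forest:
  assumes Q: "sac2rpq \<sigma> (map snd es)" and "distinct es"
  shows "forest (\<lambda>(k, x, r, y). x) (\<lambda>(k, x, r, y). y) (set es)"
proof (rule acyclic_forest)
  let ?f = "\<lambda>(k :: 'b, x :: var, r :: letter rexp, y :: var). x"
  let ?g = "\<lambda>(k :: 'b, x :: var, r :: letter rexp, y :: var). y"
  show "?f e \<noteq> ?g e" if "e \<in> set es" for e
    using Q that by (cases e) (force simp: sac2rpq_def no_loops_def)
  have "distinct (map (\<lambda>e. {?f e, ?g e}) es)"
    using Q by (simp add: sac2rpq_def no_multi_edges_def case_prod_unfold comp_def)
  then show "e = e'" if "e \<in> set es" "e' \<in> set es" "{?f e, ?g e} = {?f e', ?g e'}" for e e'
    using that by (auto simp: distinct_map dest: inj_onD)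
  show "\<exists>i < length xs. \<forall>e \<in> set es. {?f e, ?g e} \<noteq> {xs ! i, xs ! (Suc i mod length xs)}"
    if xs: "length xs \<ge> 3" "distinct xs" for xs
  proof -
    obtain i where i: "i < length xs"
      "\<not> adjacent (map snd es) (xs ! i) (xs ! (Suc i mod length xs))"
      using Q xs by (auto simp: sac2rpq_def acyclic_c2rpq_def)
    have "\<forall>e \<in> set es. {?f e, ?g e} \<noteq> {xs ! i, xs ! (Suc i mod length xs)}"
      using i(2) by (fastforce simp: adjacent_def doubleton_eq_iff image_iff)
    then show ?thesis using i(1) by blast
  qed
qed simp

section \<open>Programs with unary and nullary intensional predicates\<close>

text \<open>One constructor per rule shape. The parameter is instantiated by relation symbols for
  the actual rules and by output templates for the machine, so both stem from the same
  definitions.\<close>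

datatype 'p prule =
    Step 'p "'p label" 'p | Conj 'p 'p 'p | Dom 'p "bool \<times> 'p"
  | Start 'p | Chain 'p 'p 'p | End 'p 'p

abbreviation orient :: "bool \<Rightarrow> var list" where
  "orient d \<equiv> if d then [0, 1] else [1, 0]"

fun rule_of :: "relsym prule \<Rightarrow> rule" where
  "rule_of (Step h None b) = Rule (Atom h [0]) [Pos (Atom b [0])]"
| "rule_of (Step h (Some (d, R)) b) =
     Rule (Atom h [0]) [Pos (Atom R (orient d)), Pos (Atom b [1])]"
| "rule_of (Conj h b c) = Rule (Atom h [0]) [Pos (Atom b [0]), Pos (Atom c [0])]"
| "rule_of (Dom h (d, R)) = Rule (Atom h [0]) [Pos (Atom R (orient d))]"
| "rule_of (Start h) = Rule (Atom h []) []"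
| "rule_of (Chain h c b) = Rule (Atom h []) [Pos (Atom c []), Pos (Atom b [0])]"
| "rule_of (End h c) = Rule (Atom h []) [Pos (Atom c []), Pos (Atom c [])]"

lemma body_rule_of_positive: "Neg A \<notin> set (body (rule_of p))"
  by (cases p rule: rule_of.cases) auto

text \<open>Unary predicates never depend on nullary ones, so the least fixpoint splits into two
  inductions that mention elements instead of valuations.\<close>

inductive der :: "relsym prule set \<Rightarrow> 'a fact set \<Rightarrow> relsym \<Rightarrow> 'a \<Rightarrow> bool" for S I where
  Step: "Step h l b \<in> S \<Longrightarrow> (a, c) \<in> lrel I l \<Longrightarrow> der S I b c \<Longrightarrow> der S I h a"
| Conj: "Conj h b c \<in> S \<Longrightarrow> der S I b a \<Longrightarrow> der S I c a \<Longrightarrow> der S I h a"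
| Dom: "Dom h l \<in> S \<Longrightarrow> (a, c) \<in> lrel I (Some l) \<Longrightarrow> der S I h a"

inductive der0 :: "relsym prule set \<Rightarrow> 'a fact set \<Rightarrow> relsym \<Rightarrow> bool" for S I where
  Start: "Start h \<in> S \<Longrightarrow> der0 S I h"
| Chain: "Chain h c b \<in> S \<Longrightarrow> der0 S I c \<Longrightarrow> der S I b a \<Longrightarrow> der0 S I h"
| End: "End h c \<in> S \<Longrightarrow> der0 S I c \<Longrightarrow> der0 S I h"

lemma der_adom: "der S I h a \<Longrightarrow> a \<in> adom I"
  by (induction rule: der.induct) (auto dest: lrel_adom)

definition model :: "relsym prule set \<Rightarrow> 'a fact set \<Rightarrow> 'a fact set" where
  "model S I = I \<union> {(h, [a]) | h a. der S I h a} \<union> {(h, []) | h. der0 S I h}"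

text \<open>The three parts of \<open>model\<close> are told apart by arity alone, since every fact
  of the instance is binary.\<close>

lemma model_simps:
  assumes "is_instance \<sigma> I" "ran \<sigma> \<subseteq> {2}"
  shows "(h, []) \<in> model S I \<longleftrightarrow> der0 S I h"
    and "(h, [a]) \<in> model S I \<longleftrightarrow> der S I h a"
    and "(h, [a, b]) \<in> model S I \<longleftrightarrow> (h, [a, b]) \<in> I"
proof -
  have "length as = 2" if "(R, as) \<in> I" for R as
    using assms that by (fastforce simp: is_instance_def intro: ranI)
  then show "(h, []) \<in> model S I \<longleftrightarrow> der0 S I h" "(h, [a]) \<in> model S I \<longleftrightarrow> der S I h a"
    "(h, [a, b]) \<in> model S I \<longleftrightarrow> (h, [a, b]) \<in> I"
    by (fastforce simp: model_def)+
qed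

text \<open>\<open>sat_program\<close> admits any stratification, which may spread the rules over
  many strata; hence an arbitrary subset of the rules and an arbitrary start below the
  model.\<close>

lemma lfp_stratum_subset_model:
  assumes "is_instance \<sigma> I" "ran \<sigma> \<subseteq> {2}" "J \<subseteq> model S I" "rs \<subseteq> rule_of ` S"
  shows "lfp_stratum D rs J \<subseteq> model S I"
proof
  fix f assume "f \<in> lfp_stratum D rs J"
  then show "f \<in> model S I"
  proof induction
    case (start f)
    then show ?case using assms(3) by blast
  next
    case (derive_head r \<nu>)
    then obtain p where p: "p \<in> S" "r = rule_of p" using assms(4) by blast
    have body: "(pred A, map \<nu> (args A)) \<in> model S I" if "Pos A \<in> set (body r)" for A
      using derive_head that by blast
    note simps = model_simps[OF assms(1,2)]
    show ?case
    proof (cases p rule: rule_of.cases)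
      case (1 h b)
      have "\<nu> 0 \<in> adom I" using body 1 p by (auto simp: simps dest: der_adom)
      then show ?thesis using body 1 p
        by (auto simp: simps intro!: der.Step[of h None b _ _ "\<nu> 0"])
    next
      case (2 h d R b)
      then show ?thesis using body[of "Atom R (orient d)"] body[of "Atom b [1]"] p
        by (auto simp: simps intro!: der.Step[of h "Some (d, R)" b _ _ "\<nu> 1"])
    next
      case (3 h b c)
      then show ?thesis using body[of "Atom b [0]"] body[of "Atom c [0]"] p
        by (auto simp: simps intro: der.Conj)
    next
      case (4 h d R)
      then show ?thesis using body[of "Atom R (orient d)"] p
        by (auto simp: simps intro!: der.Dom[of h "(d, R)" _ _ "\<nu> 1"])
    next
      case (5 h)
      then show ?thesis using p by (auto simp: simps intro: der0.Start)
    next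
      case (6 h c b)
      then show ?thesis using body[of "Atom c []"] body[of "Atom b [0]"] p
        by (auto simp: simps intro: der0.Chain)
    next
      case (7 h c)
      then show ?thesis using body[of "Atom c []"] p by (auto simp: simps intro: der0.End)
    qed
  qed
qed

lemma model_subset_lfp_stratum: "model S I \<subseteq> lfp_stratum (adom I) (rule_of ` S) I"
proof -
  let ?L = "lfp_stratum (adom I) (rule_of ` S) I"
  have fire: "(pred (head (rule_of p)), map \<nu> (args (head (rule_of p)))) \<in> ?L"
    if "p \<in> S" "\<forall>x \<in> rule_vars (rule_of p). \<nu> x \<in> adom I"
      "\<forall>A. Pos A \<in> set (body (rule_of p)) \<longrightarrow> (pred A, map \<nu> (args A)) \<in> ?L" for p \<nu>
    using that body_rule_of_positive by (intro lfp_stratum.derive_head) blast+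
  have unary: "(h, [a]) \<in> ?L" if "der S I h a" for h a
    using that
  proof induction
    case (Step h l b a c)
    show ?case
    proof (cases l)
      case None
      then show ?thesis
        using fire[OF Step.hyps(1), of "\<lambda>_. a"] Step by (auto simp: rule_vars_def)
    next
      case (Some q)
      obtain d R where "q = (d, R)" by (cases q)
      moreover have "a \<in> adom I" "c \<in> adom I" using lrel_adom[OF Step.hyps(2)] by auto
      ultimately show ?thesis
        using fire[OF Step.hyps(1), of "\<lambda>x. if x = 0 then a else c"] Some Step
        by (auto simp: rule_vars_def intro: lfp_stratum.start split: if_splits)
    qed
  next
    case (Conj h b c a)
    then show ?case
      using fire[OF Conj.hyps(1), of "\<lambda>_. a"] by (auto simp: rule_vars_def dest: der_adom)
  next
    case (Dom h l a c)
    obtain d R where "l = (d, R)" by (cases l)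
    moreover have "a \<in> adom I" "c \<in> adom I" using lrel_adom[OF Dom.hyps(2)] by auto
    ultimately show ?case
      using fire[OF Dom.hyps(1), of "\<lambda>x. if x = 0 then a else c"] Dom
      by (auto simp: rule_vars_def intro: lfp_stratum.start split: if_splits)
  qed
  have "(h, []) \<in> ?L" if "der0 S I h" for h
    using that
  proof induction
    case (Start h)
    then show ?case using fire[OF Start.hyps(1), of undefined] by (simp add: rule_vars_def)
  next
    case (Chain h c b a)
    then show ?case
      using fire[OF Chain.hyps(1), of "\<lambda>_. a"] unary by (auto simp: rule_vars_def dest: der_adom)
  next
    case (End h c)
    then show ?case using fire[OF End.hyps(1), of undefined] by (simp add: rule_vars_def)
  qed
  with unary show ?thesis by (auto simp: model_def intro: lfp_stratum.start)
qed

lemma stratification_positive: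
  assumes "rules P = map rule_of ps"
  shows "stratification P 1 (\<lambda>_. 1)"
proof -
  have "case l of
      Pos A \<Rightarrow> pred A \<in> dom (isig P) \<longrightarrow> (1 :: nat) \<le> 1 | Neg A \<Rightarrow> (1 :: nat) < 1"
    if "r \<in> set (rules P)" "l \<in> set (body r)" for l r
    using that assms body_rule_of_positive by (cases l) auto
  then show ?thesis unfolding stratification_def by fastforce
qed

text \<open>Every stratification stays within the model, and the one with a single stratum already
  reaches all of it.\<close>

lemma sat_program_iff_der0:
  assumes "is_instance \<sigma> I" "ran \<sigma> \<subseteq> {2}" "rules P = map rule_of ps"
  shows "sat_program I P \<longleftrightarrow> der0 (set ps) I (goal P)"
proof
  assume "sat_program I P"
  then obtain n \<zeta> where goal: "(goal P, []) \<in> strata P \<zeta> I n" by (auto simp: sat_program_def)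
  have "strata P \<zeta> I i \<subseteq> model (set ps) I" for i
  proof (induction i)
    case 0
    then show ?case by (auto simp: model_def)
  next
    case (Suc i)
    have "{r \<in> set (rules P). \<zeta> (pred (head r)) = Suc i} \<subseteq> rule_of ` set ps"
      using assms(3) by auto
    from lfp_stratum_subset_model[OF assms(1,2) Suc this] show ?case by simp
  qed
  with goal show "der0 (set ps) I (goal P)" using model_simps(1)[OF assms(1,2)] by blast
next
  assume "der0 (set ps) I (goal P)"
  then have "(goal P, []) \<in> lfp_stratum (adom I) (rule_of ` set ps) I"
    using model_subset_lfp_stratum model_simps(1)[OF assms(1,2)] by blast
  then have "(goal P, []) \<in> strata P (\<lambda>_. 1) I 1" using assms(3) by simp
  then show "sat_program I P"
    using stratification_positive[OF assms(3)] unfolding sat_program_def by blast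
qed

section \<open>Well-formedness and clique guards\<close>

fun wf_prule :: "signature \<Rightarrow> signature \<Rightarrow> relsym prule \<Rightarrow> bool" where
  "wf_prule \<sigma> \<tau> (Step h l b) \<longleftrightarrow> \<tau> h = Some 1 \<and> \<tau> b = Some 1 \<and> snd ` set_option l \<subseteq> dom \<sigma>"
| "wf_prule \<sigma> \<tau> (Conj h b c) \<longleftrightarrow> \<tau> h = Some 1 \<and> \<tau> b = Some 1 \<and> \<tau> c = Some 1"
| "wf_prule \<sigma> \<tau> (Dom h l) \<longleftrightarrow> \<tau> h = Some 1 \<and> snd l \<in> dom \<sigma>"
| "wf_prule \<sigma> \<tau> (Start h) \<longleftrightarrow> \<tau> h = Some 0"
| "wf_prule \<sigma> \<tau> (Chain h c b) \<longleftrightarrow> \<tau> h = Some 0 \<and> \<tau> c = Some 0 \<and> \<tau> b = Some 1"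
| "wf_prule \<sigma> \<tau> (End h c) \<longleftrightarrow> \<tau> h = Some 0 \<and> \<tau> c = Some 0"

lemma wf_prule_rule_of:
  assumes "ran \<sigma> \<subseteq> {2}" "dom \<sigma> \<inter> dom \<tau> = {}" "wf_prule \<sigma> \<tau> p"
  shows "wf_rule \<sigma> \<tau> (rule_of p)"
    and "l \<in> set (body (rule_of p)) \<Longrightarrow> pred (atom_of l) \<in> dom \<tau> \<Longrightarrow>
      clique_guarded \<sigma> (body (rule_of p)) (atom_of l)"
proof -
  have edb: "\<sigma> R = Some 2 \<and> \<tau> R = None" if "R \<in> dom \<sigma>" for R
    using assms(1,2) that by (fastforce intro: ranI)
  show "wf_rule \<sigma> \<tau> (rule_of p)"
    using assms(3) edb
    by (cases p rule: rule_of.cases) (auto simp: wf_rule_def wf_literal_def map_add_def)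
  show "clique_guarded \<sigma> (body (rule_of p)) (atom_of l)"
    if "l \<in> set (body (rule_of p))" "pred (atom_of l) \<in> dom \<tau>"
    using that assms(3) edb
    by (cases p rule: rule_of.cases) (auto simp: clique_guarded_def)
qed

lemma length_body_rule_of: "length (body (rule_of p)) \<le> 2"
  by (cases p rule: rule_of.cases) auto

section \<open>The program of a query\<close>

abbreviation rlen :: "letter rexp \<Rightarrow> nat" where
  "rlen r \<equiv> length (enc_rexp r)"

text \<open>Thompson's construction between given end states. The only new states, for
  \<open>Times\<close> and \<open>Star\<close>, are named by the input position \<open>k\<close> of
  the operator word: subexpressions get disjoint names, and a reader of the input knows each name
  when it needs it.\<close>

primrec edges :: "letter rexp \<Rightarrow> nat \<Rightarrow> nat \<Rightarrow> nat \<Rightarrow> (nat \<times> relsym label \<times> nat) list" where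
  "edges Zero k u v = []"
| "edges One k u v = [(u, None, v)]"
| "edges (Sym l) k u v = [(u, label l, v)]"
| "edges (Plus r s) k u v = edges r (k + 1) u v @ edges s (k + 1 + rlen r) u v"
| "edges (Times r s) k u v = edges r (k + 1) u k @ edges s (k + 1 + rlen r) k v"
| "edges (Star r) k u v = (u, None, k) # (k, None, v) # edges r (k + 1) k k"

lemma edges_range:
  "(u', l, v') \<in> set (edges r k u v) \<Longrightarrow>
     u' \<in> insert u {k..<k + rlen r} \<and> v' \<in> insert v {k..<k + rlen r}"
proof (induction r arbitrary: k u v)
  case (Plus r s)
  then show ?case by fastforce
next
  case (Times r s)
  then show ?case by fastforce
next
  case (Star r)
  then show ?case by fastforce
qed auto

text \<open>\<open>g u\<close> holds the extensions of the \<open>F\<close> and of the \<open>B\<close> predicate of the state \<open>u\<close>.\<close>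

definition transports :: "'a rel \<Rightarrow> (nat \<Rightarrow> 'a set \<times> 'a set) \<Rightarrow> nat \<Rightarrow> nat \<Rightarrow> bool" where
  "transports R g u v \<longleftrightarrow>
     (\<forall>(a, b) \<in> R. (b \<in> fst (g v) \<longrightarrow> a \<in> fst (g u)) \<and> (a \<in> snd (g u) \<longrightarrow> b \<in> snd (g v)))"

lemma transports_cong:
  "g u = g' u \<Longrightarrow> g v = g' v \<Longrightarrow> transports R g u v \<longleftrightarrow> transports R g' u v"
  by (simp add: transports_def)

text \<open>Closure under single transitions composes along paths. This yields completeness: the
  derived predicates themselves are closed under transitions.\<close>

lemma transports_rel:
  assumes "\<And>u' l v'. (u', l, v') \<in> set (edges r k u v) \<Longrightarrow> transports (lrel I l) g u' v'"
  shows "transports (rel I r) g u v"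
  using assms
proof (induction r arbitrary: k u v)
  case (Plus r s)
  have "transports (rel I r) g u v" by (rule Plus.IH(1)[of "k + 1"], rule Plus.prems) simp
  moreover have "transports (rel I s) g u v"
    by (rule Plus.IH(2)[of "k + 1 + rlen r"], rule Plus.prems) simp
  ultimately show ?case by (auto simp: rel_Plus transports_def)
next
  case (Times r s)
  have "transports (rel I r) g u k" by (rule Times.IH(1)[of "k + 1"], rule Times.prems) simp
  moreover have "transports (rel I s) g k v"
    by (rule Times.IH(2)[of "k + 1 + rlen r"], rule Times.prems) simp
  ultimately show ?case unfolding rel_Times transports_def by blast
next
  case (Star r)
  have r: "transports (rel I r) g k k" by (rule Star.IH[of "k + 1"], rule Star.prems) simp
  have ends: "transports (lrel I None) g u k" "transports (lrel I None) g k v"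
    by (rule Star.prems, simp)+
  have star: "(b \<in> fst (g k) \<longrightarrow> a \<in> fst (g k)) \<and> (a \<in> snd (g k) \<longrightarrow> b \<in> snd (g k))"
    if "(a, b) \<in> (rel I r)\<^sup>*" for a b
    using that by induction (use r in \<open>auto simp: transports_def\<close>)
  have "(b \<in> fst (g v) \<longrightarrow> a \<in> fst (g u)) \<and> (a \<in> snd (g u) \<longrightarrow> b \<in> snd (g v))"
    if ab: "(a, b) \<in> rel I (Star r)" for a b
  proof -
    have "(a, b) \<in> (rel I r)\<^sup>*" using ab by (auto simp: rel_Star)
    moreover have "a \<in> adom I" "b \<in> adom I" using rel_adom[OF ab] by auto
    ultimately show ?thesis using star ends by (fastforce simp: transports_def Id_on_def)
  qed
  then show ?case by (auto simp: transports_def)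
qed (auto simp: rel_Zero rel_One rel_Sym transports_def)

text \<open>The converse, an interpolation: values at the ends that respect the whole language
  extend to the inner states. Changes stay inside the position interval of the expression, so the
  extensions for two operands do not interfere. It supplies the upper bounds for soundness.\<close>

lemma transports_edges:
  assumes "transports (rel I r) g u v" "u \<notin> {k..<k + rlen r}" "v \<notin> {k..<k + rlen r}"
  shows "\<exists>g'. (\<forall>m. m \<notin> {k..<k + rlen r} \<longrightarrow> g' m = g m) \<and>
    (\<forall>u' l v'. (u', l, v') \<in> set (edges r k u v) \<longrightarrow> transports (lrel I l) g' u' v')"
  using assms
proof (induction r arbitrary: k u v g)
  case Zero
  then show ?case by auto
next
  case One
  then show ?case by (intro exI[of _ g]) (simp add: rel_One)
next
  case (Sym l)
  then show ?case by (intro exI[of _ g]) (simp add: rel_Sym)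
next
  case (Plus r s)
  have outside: "u \<notin> {k + 1..<k + 1 + rlen r}" "v \<notin> {k + 1..<k + 1 + rlen r}"
    "u \<notin> {k + 1 + rlen r..<k + 1 + rlen r + rlen s}"
    "v \<notin> {k + 1 + rlen r..<k + 1 + rlen r + rlen s}"
    using Plus.prems(2,3) by auto
  have "transports (rel I r) g u v" using Plus.prems(1) by (simp add: rel_Plus transports_def)
  then obtain g1 where g1: "\<And>m. m \<notin> {k + 1..<k + 1 + rlen r} \<Longrightarrow> g1 m = g m"
    "\<And>u' l v'. (u', l, v') \<in> set (edges r (k + 1) u v) \<Longrightarrow> transports (lrel I l) g1 u' v'"
    using Plus.IH(1)[of g u v "k + 1"] outside by blast
  have "g1 u = g u" "g1 v = g v" using g1(1) Plus.prems(2,3) by auto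
  then have "transports (rel I s) g1 u v"
    using Plus.prems(1) by (simp add: rel_Plus transports_def)
  then obtain g2 where g2:
    "\<And>m. m \<notin> {k + 1 + rlen r..<k + 1 + rlen r + rlen s} \<Longrightarrow> g2 m = g1 m"
    "\<And>u' l v'. (u', l, v') \<in> set (edges s (k + 1 + rlen r) u v) \<Longrightarrow> transports (lrel I l) g2 u' v'"
    using Plus.IH(2)[of g1 u v "k + 1 + rlen r"] outside by blast
  have "transports (lrel I l) g2 u' v'" if "(u', l, v') \<in> set (edges r (k + 1) u v)" for u' l v'
  proof -
    have "g2 u' = g1 u'" "g2 v' = g1 v'"
      using edges_range[OF that] Plus.prems(2,3) by (auto intro!: g2(1))
    then show ?thesis using g1(2)[OF that] transports_cong by metis
  qed
  then show ?case using g1(1) g2 by (intro exI[of _ g2]) auto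
next
  case (Times r s)
  have outside: "u \<notin> {k + 1..<k + 1 + rlen r}" "k \<notin> {k + 1..<k + 1 + rlen r}"
    "k \<notin> {k + 1 + rlen r..<k + 1 + rlen r + rlen s}"
    "v \<notin> {k + 1 + rlen r..<k + 1 + rlen r + rlen s}"
    using Times.prems(2,3) by auto
  \<comment> \<open>The least choice at the middle state: what reaches the \<open>F\<close> set of
    \<open>v\<close> through \<open>s\<close>, and what the \<open>B\<close> set of \<open>u\<close>
    reaches through \<open>r\<close>.\<close>
  define h where "h = g(k := ((rel I s)\<inverse> `` fst (g v), rel I r `` snd (g u)))"
  have "u \<noteq> k" "v \<noteq> k" using Times.prems(2,3) by auto
  then have h: "transports (rel I r) h u k" "transports (rel I s) h k v"
    using Times.prems(1) unfolding transports_def rel_Times h_def by auto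
  obtain g1 where g1: "\<And>m. m \<notin> {k + 1..<k + 1 + rlen r} \<Longrightarrow> g1 m = h m"
    "\<And>u' l v'. (u', l, v') \<in> set (edges r (k + 1) u k) \<Longrightarrow> transports (lrel I l) g1 u' v'"
    using Times.IH(1)[OF h(1), of "k + 1"] outside by blast
  have "g1 k = h k" "g1 v = h v" using g1(1) Times.prems(2,3) by auto
  then have "transports (rel I s) g1 k v" using h(2) transports_cong by metis
  then obtain g2 where g2:
    "\<And>m. m \<notin> {k + 1 + rlen r..<k + 1 + rlen r + rlen s} \<Longrightarrow> g2 m = g1 m"
    "\<And>u' l v'. (u', l, v') \<in> set (edges s (k + 1 + rlen r) k v) \<Longrightarrow> transports (lrel I l) g2 u' v'"
    using Times.IH(2)[of g1 k v "k + 1 + rlen r"] outside by blast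
  have "transports (lrel I l) g2 u' v'" if "(u', l, v') \<in> set (edges r (k + 1) u k)" for u' l v'
  proof -
    have "g2 u' = g1 u'" "g2 v' = g1 v'"
      using edges_range[OF that] Times.prems(2,3) by (auto intro!: g2(1))
    then show ?thesis using g1(2)[OF that] transports_cong by metis
  qed
  then show ?case using g1(1) g2 by (intro exI[of _ g2]) (auto simp: h_def)
next
  case (Star r)
  \<comment> \<open>Taking preimage and image under the whole iteration makes both sets closed under
    one more round of \<open>r\<close>.\<close>
  define h where "h = g(k := ((rel I (Star r))\<inverse> `` fst (g v), rel I (Star r) `` snd (g u)))"
  have neq: "u \<noteq> k" "v \<noteq> k" using Star.prems(2,3) by auto
  have left: "(a, c) \<in> rel I (Star r)" if "(a, b) \<in> rel I r" "(b, c) \<in> rel I (Star r)" for a b c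
    using that rel_adom[OF that(1)] by (auto simp: rel_Star)
  have right: "(a, c) \<in> rel I (Star r)" if "(a, b) \<in> rel I (Star r)" "(b, c) \<in> rel I r" for a b c
    using that by (auto simp: rel_Star)
  have ends: "transports (lrel I None) h u k" "transports (lrel I None) h k v"
    using Star.prems(1) neq unfolding transports_def h_def by (auto simp: rel_Star)
  have "transports (rel I r) h k k"
    unfolding transports_def h_def using left right by simp blast
  then obtain g1 where g1: "\<And>m. m \<notin> {k + 1..<k + 1 + rlen r} \<Longrightarrow> g1 m = h m"
    "\<And>u' l v'. (u', l, v') \<in> set (edges r (k + 1) k k) \<Longrightarrow> transports (lrel I l) g1 u' v'"
    using Star.IH[of h k k "k + 1"] by force
  have "g1 u = h u" "g1 k = h k" "g1 v = h v" using g1(1) Star.prems(2,3) by auto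
  then have "transports (lrel I None) g1 u k" "transports (lrel I None) g1 k v"
    using ends transports_cong by metis+
  then show ?case using g1 by (intro exI[of _ g1]) (auto simp: h_def)
qed

text \<open>
  The predicates of an index \<open>k\<close>. If \<open>k\<close> is a state, \<open>pd k 0\<close> and \<open>pd k 1\<close> are its \<open>F\<close> and
  \<open>B\<close> predicates. At a port \<open>k\<close>, one of these two is the incoming message and the other one the
  outgoing message; 2 and 3 are the conjunctions of the incoming messages at the earlier and at the
  later ports of the same variable, 4 and 5 these conjunctions extended by the message at \<open>k\<close>, 6 the
  conjunction at all ports of the variable, and 7 says that 6 is nonempty here and at all earlier
  ports. At the initial index \<open>z + 1\<close>, 4 is the active domain and 7 is true.
\<close>

definition pd :: "nat \<Rightarrow> nat \<Rightarrow> relsym" where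
  "pd k j = 8 * k + j"

lemma pd_inject: "i < 8 \<Longrightarrow> j < 8 \<Longrightarrow> pd k i = pd m j \<longleftrightarrow> k = m \<and> i = j"
  unfolding pd_def by presburger

text \<open>An atom occupies a list marker, two variables and its expression, hence the stride of 3
  plus the length of the expression.\<close>

primrec positions :: "nat \<Rightarrow> c2rpq \<Rightarrow> (nat \<times> var \<times> letter rexp \<times> var) list" where
  "positions k [] = []"
| "positions k (q # Q) = (k, q) # positions (k + 3 + rlen (fst (snd q))) Q"

lemma map_snd_positions: "map snd (positions k Q) = Q"
  by (induction Q arbitrary: k) auto

text \<open>The second bound is strict because of the word that closes the list.\<close>

lemma positions_range:
  "(m, x, r, y) \<in> set (positions k Q) \<Longrightarrow> k \<le> m \<and> m + 3 + rlen r < k + length (enc_query Q)"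
proof (induction Q arbitrary: k)
  case (Cons q Q)
  obtain x' r' y' where q: "q = (x', r', y')" by (cases q)
  show ?case
  proof (cases "(m, x, r, y) = (k, q)")
    case True
    then show ?thesis using q by (cases Q) (auto simp: enc_query_def)
  next
    case False
    then show ?thesis using Cons.IH[of "k + 3 + rlen r'"] Cons.prems q by (auto simp: enc_query_def)
  qed
qed simp

lemma positions_unique:
  assumes "(k, x, r, y) \<in> set (positions n Q)" "(k', x', r', y') \<in> set (positions n Q)"
    and "m \<in> {k..<k + 3 + rlen r}" "m \<in> {k'..<k' + 3 + rlen r'}"
  shows "(k, x, r, y) = (k', x', r', y')"
  using assms(1,2)
proof (induction Q arbitrary: n)
  case Nil
  then show ?case by simp
next
  case (Cons q Q)
  obtain x0 r0 y0 where "q = (x0, r0, y0)" by (cases q)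
  with Cons assms(3,4) show ?case
    using positions_range[of _ _ _ _ "n + 3 + rlen r0" Q] by fastforce
qed

lemma distinct_positions: "distinct (positions k Q)"
proof (induction Q arbitrary: k)
  case (Cons q Q)
  then show ?case by (cases q) (fastforce dest: positions_range)
qed simp

text \<open>
  Ports \<open>(p, x, i)\<close>: the words of the two variables of an atom at position \<open>k\<close> are at \<open>k + 1\<close> and
  \<open>k + 2\<close>. The incoming message is \<open>pd p i\<close>, that is, \<open>F\<close> at the left end and \<open>B\<close> at the right end.
\<close>

definition ports :: "(nat \<times> var \<times> letter rexp \<times> var) set \<Rightarrow> (nat \<times> var \<times> nat) set" where
  "ports A = (\<Union>(k, x, r, y) \<in> A. {(k + 1, x, 0), (k + 2, y, 1)})"

definition ports_at :: "(nat \<times> var \<times> nat) set \<Rightarrow> var \<Rightarrow> nat set" where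
  "ports_at H x = {p. \<exists>i. (p, x, i) \<in> H}"

text \<open>The initial index lies below every port, so the maximum falls back on it exactly when
  there is no earlier port, and a chain starts at its predicates.\<close>

definition previous :: "nat \<Rightarrow> nat set \<Rightarrow> nat \<Rightarrow> nat" where
  "previous z A p = Max (insert (z + 1) {q \<in> A. q < p})"

lemma previous_cases:
  assumes "\<And>q. q \<in> A \<Longrightarrow> z + 1 < q"
  obtains "previous z A p = z + 1" "\<And>q. q \<in> A \<Longrightarrow> p \<le> q"
  | "previous z A p \<in> A" "previous z A p < p" "\<And>q. q \<in> A \<Longrightarrow> q < p \<Longrightarrow> q \<le> previous z A p"
proof (cases "{q \<in> A. q < p} = {}")
  case True
  then have "previous z A p = z + 1" unfolding previous_def by (simp only: Max_singleton)
  moreover have "p \<le> q" if "q \<in> A" for q using True that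
    by (metis (lifting) empty_iff mem_Collect_eq not_less)
  ultimately have "previous z A p = z + 1" "\<And>q. q \<in> A \<Longrightarrow> p \<le> q" by blast+
  then show ?thesis using that by blast
next
  case False
  let ?B = "{q \<in> A. q < p}"
  have "finite ?B" by simp
  then have "previous z A p = max (z + 1) (Max ?B)"
    unfolding previous_def using False by (rule Max_insert)
  moreover have "Max ?B \<in> ?B" using False by (intro Max_in) auto
  ultimately have "previous z A p = Max ?B" using assms
    by (metis (no_types, lifting) max.absorb2 mem_Collect_eq order.strict_implies_order)
  then show ?thesis using that(2) \<open>Max ?B \<in> ?B\<close> Max_ge[OF \<open>finite ?B\<close>] by auto
qed

lemma ball_less_split:
  fixes m p :: nat
  assumes "m \<in> A" "m < p" "\<And>q. q \<in> A \<Longrightarrow> q < p \<Longrightarrow> q \<le> m"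
  shows "(\<forall>q \<in> A. q < p \<longrightarrow> P q) \<longleftrightarrow> P m \<and> (\<forall>q \<in> A. q < m \<longrightarrow> P q)"
proof -
  have "q < p \<longleftrightarrow> q = m \<or> q < m" if "q \<in> A" for q
    using assms(2) assms(3)[OF that] by auto
  then show ?thesis using assms(1) by blast
qed

lemma ball_greater_split:
  fixes m p :: nat
  assumes "m \<in> A" "p < m" "\<And>q. q \<in> A \<Longrightarrow> p < q \<Longrightarrow> m \<le> q"
  shows "(\<forall>q \<in> A. p < q \<longrightarrow> P q) \<longleftrightarrow> P m \<and> (\<forall>q \<in> A. m < q \<longrightarrow> P q)"
proof -
  have "p < q \<longleftrightarrow> q = m \<or> m < q" if "q \<in> A" for q
    using assms(2) assms(3)[OF that] by auto
  then show ?thesis using assms(1) by blast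
qed

text \<open>\<open>q\<close> precedes \<open>p\<close> among the ports of its variable,
  \<open>c\<close> among all ports. The suffix rule for \<open>q\<close> is attached to
  \<open>p\<close>, because the successor of \<open>q\<close> is unknown while \<open>q\<close> is
  read.\<close>

definition port_prules :: "('b \<Rightarrow> nat \<Rightarrow> 'p) \<Rightarrow> 'b \<Rightarrow> 'b \<Rightarrow> 'b \<Rightarrow> nat \<Rightarrow> 'p prule list" where
  "port_prules f q c p i =
     [Step (f p 2) None (f q 4), Step (f q 3) None (f p 5),
      Conj (f p 4) (f p 2) (f p i), Conj (f p 5) (f p 3) (f p i),
      Conj (f p (1 - i)) (f p 2) (f p 3), Conj (f p 6) (f p 4) (f p 3),
      Chain (f p 7) (f c 7) (f p 6)]"

fun edge_prules :: "('b \<Rightarrow> nat \<Rightarrow> 'p) \<Rightarrow> 'b \<times> 'p label \<times> 'b \<Rightarrow> 'p prule list" where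
  "edge_prules f (u, l, v) = [Step (f u 0) l (f v 0), Step (f v 1) (flip l) (f u 1)]"

fun atom_prules :: "nat \<Rightarrow> (nat \<times> var \<times> nat) set \<Rightarrow> nat \<times> var \<times> letter rexp \<times> var \<Rightarrow>
    relsym prule list" where
  "atom_prules z H (k, x, r, y) =
     port_prules pd (previous z (ports_at H x) (k + 1)) (previous z (fst ` H) (k + 1)) (k + 1) 0 @
     port_prules pd (previous z (ports_at H y) (k + 2)) (previous z (fst ` H) (k + 2)) (k + 2) 1 @
     concat (map (edge_prules pd) (edges r (k + 3) (k + 1) (k + 2)))"

definition is_last :: "(nat \<times> var \<times> nat) set \<Rightarrow> nat \<Rightarrow> bool" where
  "is_last H p \<longleftrightarrow> (\<exists>x. p \<in> ports_at H x \<and> (\<forall>q \<in> ports_at H x. q \<le> p))"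

text \<open>Base case of the suffix chains. Which ports are last is settled only by the end of the
  input.\<close>

definition last_prules :: "nat \<Rightarrow> (nat \<times> var \<times> nat) set \<Rightarrow> nat \<Rightarrow> relsym prule list" where
  "last_prules z H p = (if is_last H p then [Step (pd p 3) None (pd (z + 1) 4)] else [])"

definition dom_prules :: "nat \<Rightarrow> relsym list \<Rightarrow> relsym prule list" where
  "dom_prules z Rs = concat (map (\<lambda>R. [Dom (pd (z + 1) 4) (True, R), Dom (pd (z + 1) 4) (False, R)]) Rs)"

text \<open>
  The rule \<open>End\<close> repeats its body atom so that some rule has two body atoms, even for the empty query.
\<close>

definition query_prules :: "nat \<Rightarrow> relsym list \<Rightarrow> c2rpq \<Rightarrow> relsym prule list" where
  "query_prules z Rs Q =
     (let es = positions (z + 2) Q; H = ports (set es); n = length (enc_query Q)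
      in dom_prules z Rs @ [Start (pd (z + 1) 7)] @ concat (map (atom_prules z H) es) @
         [End (pd z 1) (pd (previous z (fst ` H) (z + 2 + n)) 7)] @
         concat (map (last_prules z H) [z + 2..<z + 2 + n]))"

section \<open>Correctness of the program\<close>

locale query_ports =
  fixes z :: nat and Q :: c2rpq
begin

definition es :: "(nat \<times> var \<times> letter rexp \<times> var) list" where
  "es = positions (z + 2) Q"

definition H :: "(nat \<times> var \<times> nat) set" where
  "H = ports (set es)"

definition N :: nat where
  "N = z + 2 + length (enc_query Q)"

abbreviation "prev_at x p \<equiv> previous z (ports_at H x) p"
abbreviation "prev_port p \<equiv> previous z (fst ` H) p"

lemma ports_iff:
  "(p, v, i) \<in> H \<longleftrightarrow> (\<exists>k x r y. (k, x, r, y) \<in> set es \<and>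
     (p = k + 1 \<and> v = x \<and> i = 0 \<or> p = k + 2 \<and> v = y \<and> i = 1))"
  unfolding H_def ports_def by fastforce

lemma port_intros:
  assumes "(k, x, r, y) \<in> set es"
  shows "(k + 1, x, 0) \<in> H" "(k + 2, y, 1) \<in> H"
  using assms unfolding ports_iff by blast+

lemma es_unique:
  assumes "(k, x, r, y) \<in> set es" "(k', x', r', y') \<in> set es"
    and "m \<in> {k..<k + 3 + rlen r}" "m \<in> {k'..<k' + 3 + rlen r'}"
  shows "(k, x, r, y) = (k', x', r', y')"
  using positions_unique assms unfolding es_def by metis

lemma es_range: "(k, x, r, y) \<in> set es \<Longrightarrow> z + 2 \<le> k \<and> k + 3 + rlen r < N"
  using positions_range unfolding es_def N_def by fastforce

lemma port_owner:
  assumes "(k, x, r, y) \<in> set es" "(p, v, i) \<in> H" "p \<in> {k..<k + 3 + rlen r}"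
  shows "p = k + 1 \<and> v = x \<and> i = 0 \<or> p = k + 2 \<and> v = y \<and> i = 1"
proof -
  obtain k' x' r' y' where e: "(k', x', r', y') \<in> set es"
    "p = k' + 1 \<and> v = x' \<and> i = 0 \<or> p = k' + 2 \<and> v = y' \<and> i = 1"
    using assms(2) by (auto simp: ports_iff)
  moreover have "(k, x, r, y) = (k', x', r', y')"
    by (rule es_unique[OF assms(1) e(1) assms(3)]) (use e(2) in auto)
  ultimately show ?thesis by auto
qed

lemma ports_unique: "(p, x, i) \<in> H \<Longrightarrow> (p, x', i') \<in> H \<Longrightarrow> x' = x \<and> i' = i"
proof -
  assume p: "(p, x, i) \<in> H" "(p, x', i') \<in> H"
  then obtain k v r w where e: "(k, v, r, w) \<in> set es" "p = k + 1 \<or> p = k + 2"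
    by (auto simp: ports_iff)
  then have "p \<in> {k..<k + 3 + rlen r}" by auto
  from port_owner[OF e(1) p(1) this] port_owner[OF e(1) p(2) this] show ?thesis by auto
qed

lemma port_bounds: "(p, x, i) \<in> H \<Longrightarrow> z + 1 < p \<and> p < N \<and> i \<le> 1"
  by (auto simp: ports_iff dest!: es_range)

lemma ports_at_bounds: "p \<in> ports_at H x \<Longrightarrow> z + 1 < p" "p \<in> fst ` H \<Longrightarrow> z + 1 < p"
  by (auto simp: ports_at_def dest!: port_bounds)

lemma ports_same: "(p, x, i) \<in> H \<Longrightarrow> (p, y, j) \<in> H \<longleftrightarrow> y = x \<and> j = i"
  using ports_unique by blast

lemma ports_at_iff: "p \<in> ports_at H x \<longleftrightarrow> (\<exists>i. (p, x, i) \<in> H)"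
  by (simp add: ports_at_def)

end

locale query_program = query_ports z Q
  for z :: nat and Q :: c2rpq +
  fixes \<sigma> :: signature and Rs :: "relsym list" and I :: "'a fact set"
  assumes inst: "is_instance \<sigma> I" and ran: "ran \<sigma> \<subseteq> {2}" and Rs: "set Rs = dom \<sigma>"
begin

definition S :: "relsym prule set" where
  "S = set (query_prules z Rs Q)"

abbreviation "D p j a \<equiv> der S I (pd p j) a"

section \<open>The rules sorted by head\<close>

lemma last_iff:
  "(\<exists>p \<in> set [z + 2..<N]. q \<in> set (last_prules z H p)) \<longleftrightarrow>
   (\<exists>p. is_last H p \<and> q = Step (pd p 3) None (pd (z + 1) 4))"
proof -
  have "p \<in> set [z + 2..<N]" if "is_last H p" for p
    using that by (auto simp: is_last_def ports_at_def dest!: port_bounds)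
  then show ?thesis by (auto simp: last_prules_def)
qed

lemma prules_iff:
  "q \<in> S \<longleftrightarrow>
     (\<exists>R \<in> dom \<sigma>. q = Dom (pd (z + 1) 4) (True, R) \<or> q = Dom (pd (z + 1) 4) (False, R)) \<or>
     q = Start (pd (z + 1) 7) \<or> q = End (pd z 1) (pd (prev_port N) 7) \<or>
     (\<exists>p x i. (p, x, i) \<in> H \<and>
        q \<in> set (port_prules pd (prev_at x p) (prev_port p) p i)) \<or>
     (\<exists>k x r y e. (k, x, r, y) \<in> set es \<and> e \<in> set (edges r (k + 3) (k + 1) (k + 2)) \<and>
        q \<in> set (edge_prules pd e)) \<or>
     (\<exists>p. is_last H p \<and> q = Step (pd p 3) None (pd (z + 1) 4))"
proof -
  have "(\<exists>e \<in> set es. q \<in> set (atom_prules z H e)) \<longleftrightarrow>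
     (\<exists>p x i. (p, x, i) \<in> H \<and>
        q \<in> set (port_prules pd (prev_at x p) (prev_port p) p i)) \<or>
     (\<exists>k x r y e. (k, x, r, y) \<in> set es \<and> e \<in> set (edges r (k + 3) (k + 1) (k + 2)) \<and>
        q \<in> set (edge_prules pd e))" (is "?l \<longleftrightarrow> ?r1 \<or> ?r2")
  proof (intro iffI; (elim disjE)?)
    assume ?l
    then obtain k x r y where e: "(k, x, r, y) \<in> set es" "q \<in> set (atom_prules z H (k, x, r, y))"
      by auto
    moreover have "(k + 1, x, 0) \<in> H" "(k + 2, y, 1) \<in> H" using e(1) unfolding ports_iff by blast+
    moreover have
      "q \<in> set (port_prules pd (prev_at x (k + 1)) (prev_port (k + 1)) (k + 1) 0) \<or>
       q \<in> set (port_prules pd (prev_at y (k + 2)) (prev_port (k + 2)) (k + 2) 1) \<or>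
       (\<exists>e \<in> set (edges r (k + 3) (k + 1) (k + 2)). q \<in> set (edge_prules pd e))"
      using e(2) unfolding atom_prules.simps set_append set_concat set_map Un_iff by blast
    ultimately show "?r1 \<or> ?r2" using e(1) by blast
  next
    assume ?r1
    then show ?l unfolding ports_iff by (elim exE conjE disjE) force+
  next
    assume ?r2
    then show ?l by force
  qed
  then show ?thesis
    unfolding S_def query_prules_def Let_def es_def[symmetric] H_def[symmetric]
      N_def[symmetric] set_append set_concat Un_iff
    using last_iff[of q] Rs by (auto simp: dom_prules_def)
qed


definition E :: "(nat \<times> relsym label \<times> nat) set" where
  "E = (\<Union>(k, x, r, y) \<in> set es. set (edges r (k + 3) (k + 1) (k + 2)))"

lemma Step_iff: "Step h l b \<in> S \<longleftrightarrow>
    (\<exists>p x i. (p, x, i) \<in> H \<and> l = None \<and>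
       (h = pd p 2 \<and> b = pd (prev_at x p) 4 \<or> h = pd (prev_at x p) 3 \<and> b = pd p 5)) \<or>
    (\<exists>u v l'. (u, l', v) \<in> E \<and>
       (h = pd u 0 \<and> l = l' \<and> b = pd v 0 \<or> h = pd v 1 \<and> l = flip l' \<and> b = pd u 1)) \<or>
    (\<exists>p. is_last H p \<and> h = pd p 3 \<and> l = None \<and> b = pd (z + 1) 4)"
proof -
  have "(\<exists>k x r y e. (k, x, r, y) \<in> set es \<and> e \<in> set (edges r (k + 3) (k + 1) (k + 2)) \<and>
        Step h l b \<in> set (edge_prules pd e)) \<longleftrightarrow>
    (\<exists>e \<in> E. Step h l b \<in> set (edge_prules pd e))"
    unfolding E_def by blast
  also have "\<dots> \<longleftrightarrow> (\<exists>u v l'. (u, l', v) \<in> E \<and>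
       (h = pd u 0 \<and> l = l' \<and> b = pd v 0 \<or> h = pd v 1 \<and> l = flip l' \<and> b = pd u 1))"
    by (auto simp: Bex_def)
  finally show ?thesis by (simp add: prules_iff port_prules_def) blast
qed

lemma no_edge_prule:
  "\<not> (\<exists>k x r y e. P k x r y \<and> e \<in> A k r \<and> Conj h b c \<in> set (edge_prules pd e))"
  "\<not> (\<exists>k x r y e. P k x r y \<and> e \<in> A k r \<and> Dom h q \<in> set (edge_prules pd e))"
  "\<not> (\<exists>k x r y e. P k x r y \<and> e \<in> A k r \<and> Start h \<in> set (edge_prules pd e))"
  "\<not> (\<exists>k x r y e. P k x r y \<and> e \<in> A k r \<and> Chain h b c \<in> set (edge_prules pd e))"
  "\<not> (\<exists>k x r y e. P k x r y \<and> e \<in> A k r \<and> End h c \<in> set (edge_prules pd e))"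
  by auto

lemma Conj_iff: "Conj h b c \<in> S \<longleftrightarrow>
    (\<exists>p x i. (p, x, i) \<in> H \<and>
       (h = pd p 4 \<and> b = pd p 2 \<and> c = pd p i \<or> h = pd p 5 \<and> b = pd p 3 \<and> c = pd p i \<or>
        h = pd p (1 - i) \<and> b = pd p 2 \<and> c = pd p 3 \<or> h = pd p 6 \<and> b = pd p 4 \<and> c = pd p 3))"
  unfolding prules_iff using no_edge_prule(1) by (simp add: port_prules_def)

lemma Dom_iff: "Dom h q \<in> S \<longleftrightarrow> h = pd (z + 1) 4 \<and> snd q \<in> dom \<sigma>"
  unfolding prules_iff using no_edge_prule(2) by (cases q) (auto simp: port_prules_def)

lemma Start_iff: "Start h \<in> S \<longleftrightarrow> h = pd (z + 1) 7"
  unfolding prules_iff using no_edge_prule(3) by (simp add: port_prules_def)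

lemma End_iff: "End h c \<in> S \<longleftrightarrow> h = pd z 1 \<and> c = pd (prev_port N) 7"
  unfolding prules_iff using no_edge_prule(5) by (simp add: port_prules_def)

lemma Chain_iff: "Chain h c b \<in> S \<longleftrightarrow>
    (\<exists>p x i. (p, x, i) \<in> H \<and> h = pd p 7 \<and> c = pd (prev_port p) 7 \<and> b = pd p 6)"
  unfolding prules_iff using no_edge_prule(4) by (simp add: port_prules_def)

lemma D_iff: "D m j a \<longleftrightarrow>
    (\<exists>l b c. Step (pd m j) l b \<in> S \<and> (a, c) \<in> lrel I l \<and> der S I b c) \<or>
    (\<exists>b c. Conj (pd m j) b c \<in> S \<and> der S I b a \<and> der S I c a) \<or>
    (\<exists>l c. Dom (pd m j) l \<in> S \<and> (a, c) \<in> lrel I (Some l))"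
  by (subst der.simps) blast

lemma der_None: "(\<exists>c. (a, c) \<in> lrel I None \<and> der S I b c) \<longleftrightarrow> der S I b a"
  by (auto dest: der_adom)

section \<open>Conjunctions along the ports of a variable\<close>

lemma D_before:
  assumes "(p, x, i) \<in> H"
  shows "D p 2 a \<longleftrightarrow> D (prev_at x p) 4 a"
proof -
  have i: "j \<le> 1" if "(q, v, j) \<in> H" for q v j using port_bounds[OF that] by simp
  have "Step (pd p 2) l b \<in> S \<longleftrightarrow> l = None \<and> b = pd (prev_at x p) 4" for l b
    by (auto simp: Step_iff pd_inject ports_same[OF assms])
  moreover have "Conj (pd p 2) b c \<notin> S" for b c
    by (auto simp: Conj_iff pd_inject dest!: i)
  moreover have "Dom (pd p 2) q \<notin> S" for q by (simp add: Dom_iff pd_inject)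
  ultimately show ?thesis unfolding D_iff[of p 2] using der_None by (simp del: lrel.simps)
qed

lemma D_conj:
  assumes "(p, x, i) \<in> H"
  shows "D p 4 a \<longleftrightarrow> D p 2 a \<and> D p i a"
    and "D p 5 a \<longleftrightarrow> D p 3 a \<and> D p i a"
    and "D p (1 - i) a \<longleftrightarrow> D p 2 a \<and> D p 3 a"
    and "D p 6 a \<longleftrightarrow> D p 4 a \<and> D p 3 a"
proof -
  have i: "j \<le> 1" if "(q, v, j) \<in> H" for q v j using port_bounds[OF that] by simp
  have p: "p \<noteq> z + 1" using port_bounds[OF assms] by simp
  have noS: "Step (pd p j) l b \<notin> S" if "j \<in> {4, 5, 6}" for j l b
    using that by (auto simp: Step_iff pd_inject)
  have noD: "Dom (pd p j) q \<notin> S" if "j < 8" for j q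
    using p that by (simp add: Dom_iff pd_inject)
  \<comment> \<open>Transitions derive \<open>F\<close> at their source and \<open>B\<close> at
    their target. The left end is never a target and the right end never a source, so only the
    conjunction rule defines the message sent at a port.\<close>
  have noE: "Step (pd p (1 - i)) l b \<notin> S" for l b
  proof -
    have "p \<noteq> u" if j: "i = 1" and uv: "(u, l', v) \<in> E" for u l' v
    proof
      assume "p = u"
      obtain k y r w where e: "(k, y, r, w) \<in> set es" "(u, l', v) \<in> set (edges r (k + 3) (k + 1) (k + 2))"
        using uv by (auto simp: E_def)
      with edges_range[OF e(2)] port_owner[OF e(1) assms] j \<open>p = u\<close> show False by auto
    qed
    moreover have "p \<noteq> v" if j: "i = 0" and uv: "(u, l', v) \<in> E" for u l' v
    proof
      assume "p = v"
      obtain k y r w where e: "(k, y, r, w) \<in> set es" "(u, l', v) \<in> set (edges r (k + 3) (k + 1) (k + 2))"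
        using uv by (auto simp: E_def)
      with edges_range[OF e(2)] port_owner[OF e(1) assms] j \<open>p = v\<close> show False by auto
    qed
    ultimately show ?thesis using i[OF assms] by (auto simp: Step_iff pd_inject le_Suc_eq)
  qed
  have conj: "Conj (pd p j) b c \<in> S \<longleftrightarrow>
      j = 4 \<and> b = pd p 2 \<and> c = pd p i \<or> j = 5 \<and> b = pd p 3 \<and> c = pd p i \<or>
      j = 1 - i \<and> b = pd p 2 \<and> c = pd p 3 \<or> j = 6 \<and> b = pd p 4 \<and> c = pd p 3"
    (is "_ \<longleftrightarrow> ?rhs") if "j < 8" for j b c
  proof
    assume "Conj (pd p j) b c \<in> S"
    then show ?rhs using that by (auto simp: Conj_iff pd_inject ports_same[OF assms])
  next
    assume ?rhs
    then show "Conj (pd p j) b c \<in> S" unfolding Conj_iff using assms by blast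
  qed
  have "1 - i \<noteq> 4" "1 - i \<noteq> 5" "1 - i \<noteq> 6" by linarith+
  note facts = this noS noD i[OF assms] conj
  show "D p 4 a \<longleftrightarrow> D p 2 a \<and> D p i a" using facts unfolding D_iff[of p 4] by auto
  show "D p 5 a \<longleftrightarrow> D p 3 a \<and> D p i a" using facts unfolding D_iff[of p 5] by auto
  show "D p 6 a \<longleftrightarrow> D p 4 a \<and> D p 3 a" using facts unfolding D_iff[of p 6] by auto
  show "D p (1 - i) a \<longleftrightarrow> D p 2 a \<and> D p 3 a"
    using noE noD i[OF assms] unfolding D_iff[of p "1 - i"] by (auto simp: conj)
qed

lemma D_dom: "D (z + 1) 4 a \<longleftrightarrow> a \<in> adom I"
proof
  assume "a \<in> adom I"
  then obtain R as where f: "(R, as) \<in> I" "a \<in> set as" by (auto simp: adom_def)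
  then have R: "\<sigma> R = Some (length as)" using inst by (auto simp: is_instance_def)
  then have "length as = 2" using ran by (auto intro: ranI)
  then obtain b c where "as = [b, c]" by (auto simp: length_Suc_conv numeral_2_eq_2)
  with f(2) consider "a = b" | "a = c" by auto
  then show "D (z + 1) 4 a"
  proof cases
    case 1
    then show ?thesis using f R \<open>as = [b, c]\<close>
      by (intro der.Dom[of _ "(True, R)" _ a c]) (auto simp: Dom_iff)
  next
    case 2
    then show ?thesis using f R \<open>as = [b, c]\<close>
      by (intro der.Dom[of _ "(False, R)" _ a b]) (auto simp: Dom_iff)
  qed
qed (rule der_adom)

lemma D_after:
  assumes "(p, x, i) \<in> H"
  shows "D p 3 a \<longleftrightarrow> (\<exists>q \<in> ports_at H x. prev_at x q = p \<and> D q 5 a) \<or> is_last H p \<and> a \<in> adom I"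
proof -
  have i: "j \<le> 1" if "(q, v, j) \<in> H" for q v j using port_bounds[OF that] by simp
  \<comment> \<open>A predecessor other than the initial index belongs to the same variable, and a
    port has only one variable.\<close>
  have same: "v = x" if "(q, v, j) \<in> H" "prev_at v q = p" for q v j
  proof -
    have "p \<noteq> z + 1" using port_bounds[OF assms] by simp
    then have "p \<in> ports_at H v"
      using previous_cases[of "ports_at H v" z q] ports_at_bounds(1) that(2) by metis
    then show ?thesis using assms ports_unique by (auto simp: ports_at_def)
  qed
  have "(\<exists>q v j. (q, v, j) \<in> H \<and> prev_at v q = p \<and> b = pd q 5) \<longleftrightarrow>
      (\<exists>q \<in> ports_at H x. prev_at x q = p \<and> b = pd q 5)" for b
    using same unfolding Bex_def ports_at_iff by blast
  moreover have "Step (pd p 3) l b \<in> S \<longleftrightarrow> l = None \<and>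
      ((\<exists>q v j. (q, v, j) \<in> H \<and> prev_at v q = p \<and> b = pd q 5) \<or>
       is_last H p \<and> b = pd (z + 1) 4)" for l b
    by (simp add: Step_iff pd_inject) blast
  moreover define P where "P b \<longleftrightarrow>
      (\<exists>q \<in> ports_at H x. prev_at x q = p \<and> b = pd q 5) \<or> is_last H p \<and> b = pd (z + 1) 4" for b
  ultimately have step: "Step (pd p 3) l b \<in> S \<longleftrightarrow> l = None \<and> P b" for l b
    by simp
  have "Conj (pd p 3) b c \<notin> S" for b c
    by (auto simp: Conj_iff pd_inject dest!: i)
  moreover have "Dom (pd p 3) q \<notin> S" for q by (simp add: Dom_iff pd_inject)
  ultimately have "D p 3 a \<longleftrightarrow> (\<exists>b. P b \<and> (\<exists>c. (a, c) \<in> lrel I None \<and> der S I b c))"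
    unfolding D_iff[of p 3] step by (simp del: lrel.simps)
  then show ?thesis unfolding der_None P_def using D_dom by blast
qed

definition incoming :: "nat \<Rightarrow> 'a \<Rightarrow> bool" where
  "incoming p a \<longleftrightarrow> (\<exists>x i. (p, x, i) \<in> H \<and> D p i a)"

lemma incoming_iff: "(p, x, i) \<in> H \<Longrightarrow> incoming p a \<longleftrightarrow> D p i a"
  unfolding incoming_def using ports_unique by blast

lemma D_before_iff:
  "(p, x, i) \<in> H \<Longrightarrow> D p 2 a \<longleftrightarrow> a \<in> adom I \<and> (\<forall>q \<in> ports_at H x. q < p \<longrightarrow> incoming q a)"
proof (induction p arbitrary: i rule: less_induct)
  case (less p)
  show ?case
  proof (rule previous_cases[of "ports_at H x" z p, OF ports_at_bounds(1)])
    assume "prev_at x p = z + 1" "\<And>q. q \<in> ports_at H x \<Longrightarrow> p \<le> q"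
    then show ?thesis using D_before[OF less.prems] D_dom by force
  next
    assume prev: "prev_at x p \<in> ports_at H x" "prev_at x p < p"
      "\<And>q. q \<in> ports_at H x \<Longrightarrow> q < p \<Longrightarrow> q \<le> prev_at x p"
    then obtain j where j: "(prev_at x p, x, j) \<in> H" by (auto simp: ports_at_def)
    have "D p 2 a \<longleftrightarrow> D (prev_at x p) 2 a \<and> incoming (prev_at x p) a"
      using D_before[OF less.prems] D_conj(1)[OF j] incoming_iff[OF j] by simp
    then show ?thesis using less.IH[OF prev(2) j] ball_less_split[OF prev] by auto
  qed
qed

text \<open>The suffix chain runs towards the last port, so the induction goes downwards from the
  bound \<open>N\<close> of all ports.\<close>

lemma D_after_iff:
  "(p, x, i) \<in> H \<Longrightarrow> D p 3 a \<longleftrightarrow> a \<in> adom I \<and> (\<forall>q \<in> ports_at H x. p < q \<longrightarrow> incoming q a)"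
proof (induction "N - p" arbitrary: p i rule: less_induct)
  case less
  note bounds = port_bounds[OF less.prems]
  have p: "p \<in> ports_at H x" using less.prems by (auto simp: ports_at_def)
  have last: "is_last H p \<longleftrightarrow> (\<forall>q \<in> ports_at H x. q \<le> p)"
    by (auto simp: is_last_def ports_at_iff ports_same[OF less.prems])
  show ?case
  proof (cases "is_last H p")
    case True
    have "prev_at x q \<noteq> p" if "q \<in> ports_at H x" for q
    proof (rule previous_cases[of "ports_at H x" z q, OF ports_at_bounds(1)])
      assume "prev_at x q = z + 1"
      then show ?thesis using bounds by simp
    next
      assume "prev_at x q < q"
      then show ?thesis using True last that by force
    qed
    then show ?thesis using D_after[OF less.prems] True last by (auto simp: not_less)
  next
    case False
    \<comment> \<open>Rules name predecessors only; the successor of \<open>p\<close> is recovered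
      as the least later port, the unique one whose predecessor is \<open>p\<close>.\<close>
    let ?B = "{q \<in> ports_at H x. p < q}"
    have "?B \<noteq> {}" using False last by (auto simp: not_le)
    moreover have "?B \<subseteq> {..<N}" using port_bounds by (fastforce simp: ports_at_def)
    then have fin: "finite ?B" by (rule finite_subset) simp
    ultimately have "Min ?B \<in> ?B" by (rule Min_in[rotated])
    then obtain q j where q: "q \<in> ports_at H x" "p < q" "(q, x, j) \<in> H" "q = Min ?B"
      by (auto simp: ports_at_def)
    have least: "q \<le> q'" if "q' \<in> ports_at H x" "p < q'" for q'
      using Min_le[OF fin, of q'] that q(4) by simp
    have "prev_at x q' = p \<longleftrightarrow> q' = q" if "q' \<in> ports_at H x" for q'
    proof (rule previous_cases[of "ports_at H x" z q', OF ports_at_bounds(1)])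
      assume "prev_at x q' = z + 1" "\<And>q. q \<in> ports_at H x \<Longrightarrow> q' \<le> q"
      then show ?thesis using p q(2) bounds by force
    next
      assume "prev_at x q' \<in> ports_at H x" "prev_at x q' < q'"
        "\<And>q. q \<in> ports_at H x \<Longrightarrow> q < q' \<Longrightarrow> q \<le> prev_at x q'"
      then show ?thesis using p q(1,2) least that by (metis leD le_less_linear order_antisym)
    qed
    then have "D p 3 a \<longleftrightarrow> D q 5 a" using D_after[OF less.prems] False q(1) by blast
    also have "\<dots> \<longleftrightarrow> D q 3 a \<and> incoming q a"
      using D_conj(2)[OF q(3)] incoming_iff[OF q(3)] by simp
    also have "D q 3 a \<longleftrightarrow> a \<in> adom I \<and> (\<forall>q' \<in> ports_at H x. q < q' \<longrightarrow> incoming q' a)"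
      by (rule less.hyps[OF _ q(3)]) (use q(2) port_bounds[OF q(3)] in linarith)
    finally show ?thesis
      using ball_greater_split[OF q(1,2) least, of "\<lambda>q. incoming q a"] by blast
  qed
qed

lemma outgoing_iff:
  assumes "(p, x, i) \<in> H"
  shows "D p (1 - i) a \<longleftrightarrow> a \<in> adom I \<and> (\<forall>q \<in> ports_at H x. q \<noteq> p \<longrightarrow> incoming q a)"
  using D_conj(3)[OF assms] D_before_iff[OF assms] D_after_iff[OF assms]
  by (auto simp: neq_iff)

lemma full_iff:
  assumes "(p, x, i) \<in> H"
  shows "D p 6 a \<longleftrightarrow> a \<in> adom I \<and> (\<forall>q \<in> ports_at H x. incoming q a)"
proof -
  have "p \<in> ports_at H x" using assms by (auto simp: ports_at_def)
  then show ?thesis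
    using D_conj(1,4)[OF assms] D_before_iff[OF assms] D_after_iff[OF assms] incoming_iff[OF assms]
    by (metis linorder_neqE_nat)
qed

text \<open>Expresses membership at a variable by the two messages of a single atom, the form in
  which it can be carried across that atom.\<close>

lemma full_iff_both:
  assumes "(p, x, i) \<in> H"
  shows "D p 6 a \<longleftrightarrow> D p i a \<and> D p (1 - i) a"
proof -
  have "p \<in> ports_at H x" using assms by (auto simp: ports_at_def)
  then show ?thesis
    unfolding full_iff[OF assms] outgoing_iff[OF assms] incoming_iff[OF assms, symmetric] by auto
qed

section \<open>Messages through an atom\<close>

lemma message_sound:
  assumes e: "(k, x, r, y) \<in> set es"
  shows "D (k + 1) 0 a \<Longrightarrow> \<exists>b. (a, b) \<in> rel I r \<and> D (k + 2) 0 b"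
    and "D (k + 2) 1 b \<Longrightarrow> \<exists>a. (a, b) \<in> rel I r \<and> D (k + 1) 1 a"
proof -
  \<comment> \<open>The messages sent into the atom are taken as derived, the received ones are
    replaced by what the language allows. After interpolation the family is closed under all
    transitions of the atom and bounds the derived predicates. How the sent messages arise does not
    matter.\<close>
  define f where "f = (\<lambda>_. ({}, {}))(
    k + 1 := ((rel I r)\<inverse> `` {b. D (k + 2) 0 b}, {a. D (k + 1) 1 a}),
    k + 2 := ({b. D (k + 2) 0 b}, rel I r `` {a. D (k + 1) 1 a}))"
  have "transports (rel I r) f (k + 1) (k + 2)" by (auto simp: transports_def f_def)
  then obtain g where g: "\<And>m. m \<notin> {k + 3..<k + 3 + rlen r} \<Longrightarrow> g m = f m"
    "\<And>u l v. (u, l, v) \<in> set (edges r (k + 3) (k + 1) (k + 2)) \<Longrightarrow> transports (lrel I l) g u v"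
    using transports_edges[of I r f "k + 1" "k + 2" "k + 3"] by auto
  have ends: "g (k + 1) = f (k + 1)" "g (k + 2) = f (k + 2)" using g(1) by auto
  have i: "j \<le> 1" if "(q, v, j) \<in> H" for q v j using port_bounds[OF that] by simp
  have own: "(u, l, v) \<in> set (edges r (k + 3) (k + 1) (k + 2))"
    if uv: "(u, l, v) \<in> E" and m: "u \<in> {k..<k + 3 + rlen r} \<or> v \<in> {k..<k + 3 + rlen r}" for u l v
  proof -
    obtain k' x' r' y' where e': "(k', x', r', y') \<in> set es"
      "(u, l, v) \<in> set (edges r' (k' + 3) (k' + 1) (k' + 2))"
      using uv by (auto simp: E_def)
    then have "u \<in> {k'..<k' + 3 + rlen r'}" "v \<in> {k'..<k' + 3 + rlen r'}"
      using edges_range[OF e'(2)] by auto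
    then show ?thesis using es_unique[OF e e'(1)] m e'(2) by blast
  qed
  \<comment> \<open>Generalized to inner states for the rule induction. The two sent predicates are
    left out: there \<open>g\<close> agrees with the derived ones by definition.\<close>
  have inv: "(h = pd m 0 \<and> m \<in> insert (k + 1) {k + 3..<k + 3 + rlen r} \<longrightarrow> c \<in> fst (g m)) \<and>
      (h = pd m 1 \<and> m \<in> insert (k + 2) {k + 3..<k + 3 + rlen r} \<longrightarrow> c \<in> snd (g m))"
    if "der S I h c" for h c m
    using that
  proof (induction arbitrary: m)
    case (Step h l b a c)
    show ?case
    proof (intro conjI impI; elim conjE)
      assume h: "h = pd m 0" "m \<in> insert (k + 1) {k + 3..<k + 3 + rlen r}"
      then obtain v where v: "(m, l, v) \<in> E" "b = pd v 0"
        using Step.hyps(1) by (auto simp: Step_iff pd_inject)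
      then have edge: "(m, l, v) \<in> set (edges r (k + 3) (k + 1) (k + 2))" using own h(2) by auto
      have "c \<in> fst (g v)"
        using edges_range[OF edge] Step.IH[of v] Step.hyps(3) v(2) ends by (auto simp: f_def)
      then show "a \<in> fst (g m)" using g(2)[OF edge] Step.hyps(2) by (auto simp: transports_def)
    next
      assume h: "h = pd m 1" "m \<in> insert (k + 2) {k + 3..<k + 3 + rlen r}"
      then obtain u l' where u: "(u, l', m) \<in> E" "b = pd u 1" "l = flip l'"
        using Step.hyps(1) by (auto simp: Step_iff pd_inject)
      then have edge: "(u, l', m) \<in> set (edges r (k + 3) (k + 1) (k + 2))" using own h(2) by auto
      have "c \<in> snd (g u)"
        using edges_range[OF edge] Step.IH[of u] Step.hyps(3) u(2) ends by (auto simp: f_def)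
      then show "a \<in> snd (g m)"
        using g(2)[OF edge] Step.hyps(2) u(3) by (auto simp: transports_def lrel_flip)
    qed
  next
    case (Conj h b c a)
    then obtain p v j where p: "(p, v, j) \<in> H"
      "h = pd p 4 \<or> h = pd p 5 \<or> h = pd p (1 - j) \<or> h = pd p 6" unfolding Conj_iff by blast
    \<comment> \<open>A conjunction rule defines an auxiliary predicate or a message sent at a port,
      and none of these is covered by the invariant.\<close>
    then have "\<not> (h = pd m 0 \<and> m \<in> insert (k + 1) {k + 3..<k + 3 + rlen r})"
      using i[OF p(1)] port_owner[OF e p(1)] by (auto simp: pd_inject)
    moreover have "\<not> (h = pd m 1 \<and> m \<in> insert (k + 2) {k + 3..<k + 3 + rlen r})"
      using p(2) i[OF p(1)] port_owner[OF e p(1)] by (auto simp: pd_inject)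
    ultimately show ?case by blast
  next
    case (Dom h l a c)
    then show ?case by (auto simp: Dom_iff pd_inject)
  qed
  show "D (k + 1) 0 a \<Longrightarrow> \<exists>b. (a, b) \<in> rel I r \<and> D (k + 2) 0 b"
    using inv[of "pd (k + 1) 0" a "k + 1"] ends by (auto simp: f_def)
  show "D (k + 2) 1 b \<Longrightarrow> \<exists>a. (a, b) \<in> rel I r \<and> D (k + 1) 1 a"
    using inv[of "pd (k + 2) 1" b "k + 2"] ends by (auto simp: f_def)
qed

lemma message_complete:
  assumes e: "(k, x, r, y) \<in> set es" and ab: "(a, b) \<in> rel I r"
  shows "D (k + 2) 0 b \<Longrightarrow> D (k + 1) 0 a"
    and "D (k + 1) 1 a \<Longrightarrow> D (k + 2) 1 b"
proof -
  let ?g = "\<lambda>p. ({a. D p 0 a}, {a. D p 1 a})"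
  have "transports (lrel I l) ?g u v"
    if "(u, l, v) \<in> set (edges r (k + 3) (k + 1) (k + 2))" for u l v
  proof -
    have "(u, l, v) \<in> E" using e that by (auto simp: E_def)
    then have "Step (pd u 0) l (pd v 0) \<in> S" "Step (pd v 1) (flip l) (pd u 1) \<in> S"
      unfolding Step_iff by blast+
    then show ?thesis by (auto simp: transports_def lrel_flip intro: der.Step)
  qed
  then have "transports (rel I r) ?g (k + 1) (k + 2)" by (rule transports_rel)
  then show "D (k + 2) 0 b \<Longrightarrow> D (k + 1) 0 a" "D (k + 1) 1 a \<Longrightarrow> D (k + 2) 1 b"
    using ab by (auto simp: transports_def)
qed

section \<open>The goal, and equivalence with the query\<close>

lemma der0_iff: "der0 S I (pd z 1) \<longleftrightarrow> (\<forall>p \<in> fst ` H. \<exists>a. D p 6 a)"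
proof -
  have start: "der0 S I (pd (z + 1) 7)" by (rule der0.Start) (simp add: Start_iff)
  have link: "der0 S I (pd p 7) \<longleftrightarrow> der0 S I (pd (prev_port p) 7) \<and> (\<exists>a. D p 6 a)"
    if p: "p \<in> fst ` H" for p
  proof -
    have "p \<noteq> z + 1" using ports_at_bounds(2)[OF p] by simp
    then show ?thesis
      using p by (subst der0.simps) (force simp: Start_iff Chain_iff End_iff pd_inject)
  qed
  have chain: "der0 S I (pd (prev_port m) 7) \<longleftrightarrow> (\<forall>p \<in> fst ` H. p < m \<longrightarrow> (\<exists>a. D p 6 a))" for m
  proof (induction m rule: less_induct)
    case (less m)
    show ?case
    proof (rule previous_cases[of "fst ` H" z m, OF ports_at_bounds(2)])
      assume "prev_port m = z + 1" "\<And>q. q \<in> fst ` H \<Longrightarrow> m \<le> q"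
      then show ?thesis using start by (metis leD)
    next
      assume prev: "prev_port m \<in> fst ` H" "prev_port m < m"
        "\<And>q. q \<in> fst ` H \<Longrightarrow> q < m \<Longrightarrow> q \<le> prev_port m"
      then show ?thesis
        using link[OF prev(1)] less.IH[OF prev(2)] ball_less_split[OF prev, of "\<lambda>p. \<exists>a. D p 6 a"] by blast
    qed
  qed
  have "der0 S I (pd z 1) \<longleftrightarrow> der0 S I (pd (prev_port N) 7)"
    by (subst der0.simps) (auto simp: Start_iff Chain_iff End_iff pd_inject)
  also have "\<dots> \<longleftrightarrow> (\<forall>p \<in> fst ` H. \<exists>a. D p 6 a)" using chain port_bounds by fastforce
  finally show ?thesis .
qed

lemma sat_iff: "sat_c2rpq I Q \<longleftrightarrow> (\<exists>\<nu>. \<forall>(k, x, r, y) \<in> set es. (\<nu> x, \<nu> y) \<in> rel I r)"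
proof -
  have "set Q = snd ` set es" by (metis es_def map_snd_positions set_map)
  then show ?thesis by (simp add: sat_c2rpq_def rpq_holds_rel case_prod_unfold)
qed

text \<open>Soundness of one message produces the partner, together with the message sent at its
  end; completeness of the opposite message, applied to the same pair, provides the other
  half.\<close>

lemma edge_consistent:
  assumes e: "(k, x, r, y) \<in> set es"
  shows "D (k + 1) 6 a \<Longrightarrow> \<exists>b. (a, b) \<in> rel I r \<and> D (k + 2) 6 b"
    and "D (k + 2) 6 b \<Longrightarrow> \<exists>a. (a, b) \<in> rel I r \<and> D (k + 1) 6 a"
proof -
  have full: "D (k + 1) 6 a \<longleftrightarrow> D (k + 1) 0 a \<and> D (k + 1) 1 a"
    "D (k + 2) 6 a \<longleftrightarrow> D (k + 2) 0 a \<and> D (k + 2) 1 a" for a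
    using full_iff_both[OF port_intros(1)[OF e], of a] full_iff_both[OF port_intros(2)[OF e], of a]
    by auto
  show "\<exists>b. (a, b) \<in> rel I r \<and> D (k + 2) 6 b" if "D (k + 1) 6 a"
  proof -
    have "D (k + 1) 0 a" "D (k + 1) 1 a" using that full(1) by blast+
    then obtain b where b: "(a, b) \<in> rel I r" "D (k + 2) 0 b" using message_sound(1)[OF e] by blast
    then have "D (k + 2) 1 b" using message_complete(2)[OF e] \<open>D (k + 1) 1 a\<close> by blast
    then show ?thesis using b full(2) by blast
  qed
  show "\<exists>a. (a, b) \<in> rel I r \<and> D (k + 1) 6 a" if "D (k + 2) 6 b"
  proof -
    have "D (k + 2) 0 b" "D (k + 2) 1 b" using that full(2) by blast+
    then obtain a where a: "(a, b) \<in> rel I r" "D (k + 1) 1 a" using message_sound(2)[OF e] by blast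
    then have "D (k + 1) 0 a" using message_complete(1)[OF e] \<open>D (k + 2) 0 b\<close> by blast
    then show ?thesis using a full(1) by blast
  qed
qed

lemma sat_iff_der0:
  assumes "sac2rpq \<sigma>' Q"
  shows "sat_c2rpq I Q \<longleftrightarrow> der0 S I (pd z 1)"
proof -
  let ?f = "\<lambda>(k :: nat, x :: var, r :: letter rexp, y :: var). x"
  let ?g = "\<lambda>(k :: nat, x :: var, r :: letter rexp, y :: var). y"
  have forest: "forest ?f ?g (set es)"
    by (rule sac2rpq_forest) (use assms in \<open>simp_all add: es_def map_snd_positions distinct_positions\<close>)
  show ?thesis
  proof
    assume "sat_c2rpq I Q"
    then obtain \<nu> where \<nu>: "\<And>k x r y. (k, x, r, y) \<in> set es \<Longrightarrow> (\<nu> x, \<nu> y) \<in> rel I r"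
      unfolding sat_iff by blast
    define port where "port d = fst (fst d) + (if snd d then 1 else 2)"
      for d :: "(nat \<times> var \<times> letter rexp \<times> var) \<times> bool"
    \<comment> \<open>The value that the solution gives to the variable at \<open>d\<close> lies in
      the message received there.\<close>
    define m where "m d \<longleftrightarrow> incoming (port d) (\<nu> (endpoint ?f ?g d))" for d
    have in_dom: "\<nu> (endpoint ?f ?g d) \<in> adom I" if "fst d \<in> set es" for d
      using that rel_adom[OF \<nu>] by (cases d) (auto simp: endpoint_def)
    have ports: "\<exists>d. fst d \<in> set es \<and> endpoint ?f ?g d = x \<and> port d = p"
      if p: "p \<in> ports_at H x" for p x
    proof -
      obtain k v r w where e: "(k, v, r, w) \<in> set es" "p = k + 1 \<and> x = v \<or> p = k + 2 \<and> x = w"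
        using p unfolding ports_at_iff ports_iff by blast
      then show ?thesis
        by (intro exI[of _ "((k, v, r, w), p = k + 1)"]) (auto simp: endpoint_def port_def)
    qed
    have "\<forall>e \<in> set es. \<forall>b. m (e, b)"
    \<comment> \<open>If all other ports of the variable have received their messages, the outgoing
      one is derived; since the solution satisfies the atom, completeness delivers it at the far
      end.\<close>
    proof (rule forest_messages[OF forest])
      fix e b
      assume e: "e \<in> set es"
        and others: "\<And>d. fst d \<in> set es \<Longrightarrow> d \<noteq> (e, b) \<Longrightarrow>
          endpoint ?f ?g d = endpoint ?f ?g (e, b) \<Longrightarrow> m d"
      obtain k x r y where eq: "e = (k, x, r, y)" by (cases e)
      note p = port_intros[OF e[unfolded eq]]
      have all: "incoming q (\<nu> (endpoint ?f ?g (e, b)))"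
        if "q \<in> ports_at H (endpoint ?f ?g (e, b))" "q \<noteq> port (e, b)" for q
        using ports[OF that(1)] others that(2) unfolding m_def by metis
      show "m (e, \<not> b)"
      proof (cases b)
        case True
        then have "D (k + 1) 1 (\<nu> x)"
          using outgoing_iff[OF p(1), of "\<nu> x"] all in_dom[of "(e, b)"] e eq
          by (simp add: endpoint_def port_def)
        then have "D (k + 2) 1 (\<nu> y)" using message_complete(2) \<nu> e eq by blast
        then show ?thesis using incoming_iff[OF p(2)] True eq by (simp add: m_def endpoint_def port_def)
      next
        case False
        then have "D (k + 2) 0 (\<nu> y)"
          using outgoing_iff[OF p(2), of "\<nu> y"] all in_dom[of "(e, b)"] e eq
          by (simp add: endpoint_def port_def)
        then have "D (k + 1) 0 (\<nu> x)" using message_complete(1) \<nu> e eq by blast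
        then show ?thesis using incoming_iff[OF p(1)] False eq by (simp add: m_def endpoint_def port_def)
      qed
    qed
    then have all: "incoming p (\<nu> x)" if "p \<in> ports_at H x" for p x
      using ports[OF that] unfolding m_def by (metis prod.collapse)
    have "\<exists>a. D p 6 a" if "(p, x, i) \<in> H" for p x i
    proof -
      have "p \<in> ports_at H x" using that by (auto simp: ports_at_def)
      then have "\<nu> x \<in> adom I" using ports in_dom by metis
      then show ?thesis using full_iff[OF that] all by blast
    qed
    then show "der0 S I (pd z 1)" unfolding der0_iff by force
  next
    assume "der0 S I (pd z 1)"
    then have full: "\<exists>a. D p 6 a" if "(p, x, i) \<in> H" for p x i
      unfolding der0_iff using that by force
    \<comment> \<open>The intersection form gives the whole type, and so a nonempty set, to
      variables that occur in no atom; elsewhere all its members coincide.\<close>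
    define W where "W x = {a. \<forall>p \<in> ports_at H x. D p 6 a}" for x
    have W: "W x = {a. D p 6 a}" if p: "(p, x, i) \<in> H" for p x i
    proof -
      have "D q 6 a \<longleftrightarrow> D p 6 a" if "q \<in> ports_at H x" for q a
        using that full_iff[OF p] full_iff unfolding ports_at_iff by blast
      moreover have "p \<in> ports_at H x" using p unfolding ports_at_iff by blast
      ultimately show ?thesis unfolding W_def by blast
    qed
    have "W x \<noteq> {}" for x
    proof (cases "ports_at H x = {}")
      case True
      then show ?thesis by (simp add: W_def)
    next
      case False
      then obtain p i where "(p, x, i) \<in> H" by (auto simp: ports_at_def)
      then show ?thesis using W full by blast
    qed
    moreover have "\<exists>b \<in> W (?g e). (a, b) \<in> rel I (fst (snd (snd e)))" if "e \<in> set es" "a \<in> W (?f e)" for e a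
    proof -
      obtain k x r y where e: "e = (k, x, r, y)" by (cases e)
      note es = that(1)[unfolded e]
      show ?thesis
        using edge_consistent(1)[OF es, of a] that(2) W[OF port_intros(1)[OF es]]
          W[OF port_intros(2)[OF es]] e by auto
    qed
    moreover have "\<exists>a \<in> W (?f e). (a, b) \<in> rel I (fst (snd (snd e)))" if "e \<in> set es" "b \<in> W (?g e)" for e b
    proof -
      obtain k x r y where e: "e = (k, x, r, y)" by (cases e)
      note es = that(1)[unfolded e]
      show ?thesis
        using edge_consistent(2)[OF es, of b] that(2) W[OF port_intros(1)[OF es]]
          W[OF port_intros(2)[OF es]] e by auto
    qed
    ultimately have "\<exists>\<nu>. (\<forall>v. \<nu> v \<in> W v) \<and>
        (\<forall>e \<in> set es. (\<nu> (?f e), \<nu> (?g e)) \<in> rel I (fst (snd (snd e))))"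
      by (rule forest_solution[OF forest])
    then show "sat_c2rpq I Q" unfolding sat_iff by fastforce
  qed
qed

end

section \<open>Well-formedness of the program\<close>

lemma edges_labels:
  "(u', Some (d, R), v') \<in> set (edges r k u v) \<Longrightarrow> \<exists>l \<in> set_rexp r. letter_rel l = R"
proof (induction r arbitrary: k u v)
  case (Sym l)
  then show ?case by (cases l) auto
qed (auto, (meson UnCI)+)

context query_ports
begin

lemma previous_range:
  assumes "A \<subseteq> fst ` H" "p \<le> N"
  shows "z + 1 \<le> previous z A p \<and> previous z A p < N"
proof -
  have bounds: "z + 1 < q \<and> q < N" if "q \<in> A" for q using assms(1) that port_bounds by fastforce
  show ?thesis
  proof (rule previous_cases[of A z p])
    show "z + 1 < q" if "q \<in> A" for q using bounds[OF that] by blast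
    show ?thesis if "previous z A p = z + 1" using that by (simp add: N_def)
    show ?thesis if "previous z A p \<in> A" using bounds[OF that] by simp
  qed
qed

end

context query_program
begin

lemma wf_prules:
  assumes over: "c2rpq_over \<sigma> Q"
    and unary: "\<And>p j. z + 1 \<le> p \<Longrightarrow> p < N \<Longrightarrow> j < 7 \<Longrightarrow> \<tau> (pd p j) = Some 1"
    and nullary: "\<And>p. z + 1 \<le> p \<Longrightarrow> p < N \<Longrightarrow> \<tau> (pd p 7) = Some 0"
    and goal: "\<tau> (pd z 1) = Some 0"
    and "q \<in> S"
  shows "wf_prule \<sigma> \<tau> q"
proof -
  have N: "z + 1 < N" by (simp add: N_def)
  have prev: "z + 1 \<le> prev_at x p \<and> prev_at x p < N" "z + 1 \<le> prev_port p \<and> prev_port p < N"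
    if "p \<le> N" for x p
  proof -
    have "ports_at H x \<subseteq> fst ` H" by (force simp: ports_at_def)
    then show "z + 1 \<le> prev_at x p \<and> prev_at x p < N" by (rule previous_range[OF _ that])
  qed (rule previous_range[OF subset_refl that])
  have port: "wf_prule \<sigma> \<tau> q'"
    if p: "(p, x, i) \<in> H" and q': "q' \<in> set (port_prules pd (prev_at x p) (prev_port p) p i)"
    for p x i q'
  proof -
    have b: "z + 1 < p" "p < N" "i \<le> 1" using port_bounds[OF p] by auto
    then show ?thesis using q' prev[of p] by (auto simp: port_prules_def unary nullary)
  qed
  have edge: "wf_prule \<sigma> \<tau> q'"
    if k: "(k, x, r, y) \<in> set es" and e: "e \<in> set (edges r (k + 3) (k + 1) (k + 2))"
      and q': "q' \<in> set (edge_prules pd e)" for k x r y e q'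
  proof -
    obtain u l v where eq: "e = (u, l, v)" by (cases e)
    have "(x, r, y) \<in> set Q"
      using k map_snd_positions[of "z + 2" Q] unfolding es_def
      by (metis image_eqI set_map snd_conv)
    then have "snd ` set_option l \<subseteq> dom \<sigma>"
      using over edges_labels[of u _ _ v r] e eq by (cases l) (fastforce simp: c2rpq_over_def)+
    moreover have "snd ` set_option (flip l) = snd ` set_option l"
      by (cases l) (auto simp: flip_def)
    moreover have "z + 1 \<le> u" "u < N" "z + 1 \<le> v" "v < N"
      using edges_range[OF e[unfolded eq]] es_range[OF k] by auto
    ultimately show ?thesis using q' eq by (auto simp: unary)
  qed
  have last_bounds: "z + 1 < p \<and> p < N" if "is_last H p" for p
    using that port_bounds by (auto simp: is_last_def ports_at_def)
  from \<open>q \<in> S\<close> consider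
      (dom_rule) R where "R \<in> dom \<sigma>" "q = Dom (pd (z + 1) 4) (True, R) \<or> q = Dom (pd (z + 1) 4) (False, R)"
    | (start_rule) "q = Start (pd (z + 1) 7)"
    | (goal_rule) "q = End (pd z 1) (pd (prev_port N) 7)"
    | (port_rule) p x i where "(p, x, i) \<in> H"
        "q \<in> set (port_prules pd (prev_at x p) (prev_port p) p i)"
    | (edge_rule) k x r y e where "(k, x, r, y) \<in> set es"
        "e \<in> set (edges r (k + 3) (k + 1) (k + 2))" "q \<in> set (edge_prules pd e)"
    | (last_rule) p where "is_last H p" "q = Step (pd p 3) None (pd (z + 1) 4)"
    unfolding prules_iff by blast
  then show ?thesis
  proof cases
    case port_rule
    then show ?thesis by (rule port)
  next
    case edge_rule
    then show ?thesis by (rule edge)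
  next
    case last_rule
    then show ?thesis using last_bounds[of p] N by (simp add: unary)
  qed (use N prev(2)[of N] goal in \<open>auto simp: unary nullary\<close>)
qed

end

text \<open>
  No rule uses the binary symbol \<open>pd z 0\<close>; it makes the arity 2 if the signature is empty.
\<close>

definition query_decls :: "nat \<Rightarrow> nat \<Rightarrow> (relsym \<times> nat) list" where
  "query_decls z n = (pd z 0, 2) # (pd z 1, 0) #
     map (\<lambda>p. (p, if p mod 8 = 7 then 0 else 1)) [8 * (z + 1)..<8 * (z + 2 + n)]"

definition program_of :: "nat \<Rightarrow> relsym list \<Rightarrow> c2rpq \<Rightarrow> program" where
  "program_of z Rs Q = Program (pd z 1) (query_decls z (length (enc_query Q)))
     (map rule_of (query_prules z Rs Q))"

lemma isig_program_of:
  fixes z Rs Q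
  defines "\<tau> \<equiv> isig (program_of z Rs Q)" and "n \<equiv> length (enc_query Q)"
  shows "\<tau> (pd z 0) = Some 2" and "\<tau> (pd z 1) = Some 0"
    and "z + 1 \<le> p \<Longrightarrow> p < z + 2 + n \<Longrightarrow> j < 7 \<Longrightarrow> \<tau> (pd p j) = Some 1"
    and "z + 1 \<le> p \<Longrightarrow> p < z + 2 + n \<Longrightarrow> \<tau> (pd p 7) = Some 0"
    and "ran \<tau> \<subseteq> {0, 1, 2}"
    and "dom \<tau> \<subseteq> {8 * z..}"
    and "distinct (map fst (decls (program_of z Rs Q)))"
proof -
  have \<tau>: "\<tau> = (map_of (map (\<lambda>p. (p, if p mod 8 = 7 then 0 else 1)) [8 * (z + 1)..<8 * (z + 2 + n)]))
      (pd z 1 \<mapsto> 0, pd z 0 \<mapsto> 2)"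
    by (simp add: \<tau>_def n_def program_of_def query_decls_def)
  have \<tau>2: "\<tau> = ((Some \<circ> (\<lambda>p. if p mod 8 = 7 then 0 else 1)) |` {8 * (z + 1)..<8 * (z + 2 + n)})
      (pd z 1 \<mapsto> 0, pd z 0 \<mapsto> 2)"
    unfolding \<tau> map_of_map_restrict set_upt ..
  show "\<tau> (pd z 0) = Some 2" "\<tau> (pd z 1) = Some 0" by (simp_all add: \<tau> pd_def)
  show "\<tau> (pd p j) = Some 1" if "z + 1 \<le> p" "p < z + 2 + n" "j < 7"
    using that by (simp add: \<tau>2 pd_def restrict_map_def)
  show "\<tau> (pd p 7) = Some 0" if "z + 1 \<le> p" "p < z + 2 + n"
    using that by (simp add: \<tau>2 pd_def restrict_map_def)
  show "ran \<tau> \<subseteq> {0, 1, 2}"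
    by (auto simp: \<tau>2 ran_def restrict_map_def split: if_splits)
  show "dom \<tau> \<subseteq> {8 * z..}"
    by (auto simp: \<tau>2 pd_def restrict_map_def split: if_splits)
  show "distinct (map fst (decls (program_of z Rs Q)))"
    by (auto simp: program_of_def query_decls_def pd_def comp_def)
qed

lemma program_of_icg:
  fixes z Q
  assumes ran: "ran \<sigma> \<subseteq> {2}" and Rs: "set Rs = dom \<sigma>" and z: "\<And>R. R \<in> dom \<sigma> \<Longrightarrow> R < 8 * z"
    and over: "c2rpq_over \<sigma> Q"
  shows "icg_datalog \<sigma> (program_of z Rs Q)" and "body_size \<sigma> (program_of z Rs Q) = 4"
proof -
  let ?P = "program_of z Rs Q"
  \<comment> \<open>The syntax of the program is independent of the instance that the locale fixes,
    so the empty one serves.\<close>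
  interpret query_program z Q \<sigma> Rs "{} :: nat fact set"
    by unfold_locales (use ran Rs in \<open>auto simp: is_instance_def\<close>)
  have disj: "dom \<sigma> \<inter> dom (isig ?P) = {}" using z isig_program_of(6)[where z = z and Rs = Rs and Q = Q] by fastforce
  have wf: "wf_prule \<sigma> (isig ?P) q" if "q \<in> S" for q
    by (rule wf_prules[OF over _ _ _ that])
      (use isig_program_of(2-4)[where z = z and Rs = Rs and Q = Q] in \<open>simp_all add: N_def\<close>)
  have rules: "set (rules ?P) = rule_of ` S" by (simp add: program_of_def S_def)
  have "datalog_program \<sigma> ?P"
    unfolding datalog_program_def
  proof (intro conjI exI ballI)
    show "distinct (map fst (decls ?P))" by (rule isig_program_of)
    show "isig ?P (goal ?P) = Some 0" using isig_program_of(2) by (simp add: program_of_def)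
    show "stratification ?P 1 (\<lambda>_. 1)"
      by (rule stratification_positive) (simp add: program_of_def)
    show "wf_rule \<sigma> (isig ?P) r" if "r \<in> set (rules ?P)" for r
      using that rules wf wf_prule_rule_of(1)[OF ran disj] by auto
  qed (rule disj)
  then show "icg_datalog \<sigma> ?P"
    unfolding icg_datalog_def using rules wf wf_prule_rule_of(2)[OF ran disj] by auto
  have "Max (insert 0 ((\<lambda>r. length (body r)) ` set (rules ?P))) = 2"
  proof (rule Max_eqI)
    have "End (pd z 1) (pd (prev_port N) 7) \<in> S" by (simp add: End_iff)
    then show "2 \<in> insert 0 ((\<lambda>r. length (body r)) ` set (rules ?P))"
      unfolding rules by force
  qed (use length_body_rule_of in \<open>auto simp: rules S_def\<close>)
  moreover have "arity \<sigma> ?P = 2"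
    unfolding arity_def
  proof (rule Max_eqI)
    show "finite (ran \<sigma> \<union> ran (isig ?P))"
      by (rule finite_subset[of _ "{0, 1, 2}"]) (use ran isig_program_of(5)[where z = z and Rs = Rs and Q = Q] in auto)
    show "2 \<in> ran \<sigma> \<union> ran (isig ?P)" using isig_program_of(1)[where z = z and Rs = Rs and Q = Q] by (auto intro: ranI)
    show "m \<le> 2" if "m \<in> ran \<sigma> \<union> ran (isig ?P)" for m
      using that ran isig_program_of(5)[where z = z and Rs = Rs and Q = Q] by auto
  qed
  ultimately show "body_size \<sigma> ?P = 4" by (simp add: body_size_def)
qed

section \<open>Running machines\<close>

primrec loop_free :: "cmd \<Rightarrow> bool" where
  "loop_free Skip \<longleftrightarrow> True"
| "loop_free (Assign r u) \<longleftrightarrow> True"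
| "loop_free (Inc r) \<longleftrightarrow> True"
| "loop_free (Dec r) \<longleftrightarrow> True"
| "loop_free (Load r a u) \<longleftrightarrow> True"
| "loop_free (Store a u v) \<longleftrightarrow> True"
| "loop_free (Write u) \<longleftrightarrow> True"
| "loop_free (Seq c d) \<longleftrightarrow> loop_free c \<and> loop_free d"
| "loop_free (Cond b c d) \<longleftrightarrow> loop_free c \<and> loop_free d"
| "loop_free (While b c) \<longleftrightarrow> False"

text \<open>An executable semantics that the simplifier can unfold. It is meant for loop-free
  commands; the value at \<open>While\<close> is a dummy.\<close>

primrec run :: "cmd \<Rightarrow> state \<Rightarrow> state" where
  "run Skip s = s"
| "run (Assign r u) s = set_reg r (val s u) s"
| "run (Inc r) s = set_reg r (regs s r + 1) s"
| "run (Dec r) s = set_reg r (regs s r - 1) s"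
| "run (Load r a u) s = set_reg r (arrs s a (val s u)) s"
| "run (Store a u v) s = s\<lparr>arrs := (arrs s)(a := (arrs s a)(val s u := val s v))\<rparr>"
| "run (Write u) s = s\<lparr>outp := outp s @ [val s u]\<rparr>"
| "run (Seq c d) s = run d (run c s)"
| "run (Cond b c d) s = (if passes s b then run c s else run d s)"
| "run (While b c) s = s"

definition halts :: "cmd \<Rightarrow> state \<Rightarrow> nat \<Rightarrow> state \<Rightarrow> bool" where
  "halts c s T s' \<longleftrightarrow> (\<exists>t \<le> T. exec c s t s')"

lemma halts_mono: "halts c s T s' \<Longrightarrow> T \<le> T' \<Longrightarrow> halts c s T' s'"
  by (meson halts_def order.trans)

lemma halts_Seq:
  assumes "halts c s T s'" "halts d s' T' s''"
  shows "halts (Seq c d) s (T + T') s''"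
proof -
  obtain t t' where "t \<le> T" "exec c s t s'" "t' \<le> T'" "exec d s' t' s''"
    using assms by (auto simp: halts_def)
  then show ?thesis unfolding halts_def by (intro exI[of _ "t + t'"]) (auto intro: exec.Seq)
qed

lemma halts_While:
  assumes "passes s b" "halts c s T s'" "halts (While b c) s' T' s''"
  shows "halts (While b c) s (1 + T + T') s''"
proof -
  obtain t t' where "t \<le> T" "exec c s t s'" "t' \<le> T'" "exec (While b c) s' t' s''"
    using assms by (auto simp: halts_def)
  then show ?thesis
    unfolding halts_def using exec.WhileTrue[OF assms(1)] by (intro exI[of _ "1 + t + t'"]) auto
qed

lemma halts_While_end: "\<not> passes s b \<Longrightarrow> halts (While b c) s 1 s"
  unfolding halts_def using exec.WhileFalse by blast

text \<open>Without loops each command of the text runs at most once, so the size of the text bounds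
  the time. For fixed code this is a constant.\<close>

lemma halts_run: "loop_free c \<Longrightarrow> halts c s (size c + 1) (run c s)"
proof (induction c arbitrary: s)
  case (Seq c d)
  then have "halts (Seq c d) s (size c + 1 + (size d + 1)) (run d (run c s))"
    by (intro halts_Seq) auto
  then show ?case by (auto intro: halts_mono)
next
  case (Cond b c d)
  show ?case
  proof (cases "passes s b")
    case True
    obtain t where "t \<le> size c + 1" "exec c s t (run c s)"
      using Cond by (auto simp: halts_def)
    with exec.CondTrue[OF True, of c t "run c s" d] show ?thesis
      unfolding halts_def using True by (intro exI[of _ "1 + t"]) simp
  next
    case False
    obtain t where "t \<le> size d + 1" "exec d s t (run d s)"
      using Cond by (auto simp: halts_def)
    with exec.CondFalse[OF False, of d t "run d s" c] show ?thesis
      unfolding halts_def using False by (intro exI[of _ "1 + t"]) simp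
  qed
next
  case (Inc r)
  then show ?case unfolding halts_def using exec.Inc by force
next
  case (Dec r)
  then show ?case unfolding halts_def using exec.Dec by force
qed (auto simp: halts_def intro!: exI[of _ 1] exec.intros)

definition seqs :: "cmd list \<Rightarrow> cmd" where
  "seqs cs = foldr Seq cs Skip"

lemma seqs_simps [simp]:
  "loop_free (seqs cs) \<longleftrightarrow> (\<forall>c \<in> set cs. loop_free c)"
  "run (seqs []) s = s"
  "run (seqs (c # cs)) s = run (seqs cs) (run c s)"
  by (induction cs) (auto simp: seqs_def)

definition incs :: "nat \<Rightarrow> nat \<Rightarrow> cmd" where
  "incs r n = seqs (replicate n (Inc r))"

lemma loop_free_incs [simp]: "loop_free (incs r n)"
  by (simp add: incs_def)

lemma run_incs [simp]: "run (incs r n) s = s\<lparr>regs := (regs s)(r := regs s r + n)\<rparr>"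
  by (induction n arbitrary: s) (auto simp: incs_def set_reg_def)

text \<open>
  Templates for output words: a literal, or the content of a register plus an offset.
  Register 9 is scratch space for the sum and is zero in between.
\<close>

datatype item = Word nat | Offset nat nat

fun item_val :: "state \<Rightarrow> item \<Rightarrow> nat" where
  "item_val s (Word k) = k"
| "item_val s (Offset r j) = regs s r + j"

fun write_item :: "item \<Rightarrow> cmd" where
  "write_item (Word k) = Write (Lit k)"
| "write_item (Offset r j) =
     seqs [Assign 9 (Reg r), incs 9 j, Write (Reg 9), Assign 9 (Lit 0)]"

definition emit :: "item list \<Rightarrow> cmd" where
  "emit its = seqs (map write_item its)"

lemma loop_free_emit [simp]: "loop_free (emit its)"
proof -
  have "loop_free (write_item it)" for it by (cases it) auto
  then show ?thesis by (auto simp: emit_def)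
qed

lemma run_write_item:
  "regs s 9 = 0 \<Longrightarrow> \<forall>j. it \<noteq> Offset 9 j \<Longrightarrow> run (write_item it) s = s\<lparr>outp := outp s @ [item_val s it]\<rparr>"
  by (cases it) (auto simp: set_reg_def fun_upd_idem)

lemma run_emit:
  assumes "regs s 9 = 0" "\<forall>j. Offset 9 j \<notin> set its"
  shows "run (emit its) s = s\<lparr>outp := outp s @ map (item_val s) its\<rparr>"
  using assms
proof (induction its arbitrary: s)
  case Nil
  then show ?case by (simp add: emit_def)
next
  case (Cons it its)
  have "item_val (s\<lparr>outp := out\<rparr>) it' = item_val s it'" for out it' by (cases it') auto
  then have "item_val (s\<lparr>outp := out\<rparr>) = item_val s" for out by (intro ext)
  moreover have "run (write_item it) s = s\<lparr>outp := outp s @ [item_val s it]\<rparr>"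
    using Cons.prems by (intro run_write_item) auto
  ultimately show ?case using Cons by (simp add: emit_def)
  qed

section \<open>Rules as templates of output words\<close>

fun shape :: "'p prule \<Rightarrow> ('p \<times> var list) \<times> ('p \<times> var list) list" where
  "shape (Step h None b) = ((h, [0]), [(b, [0])])"
| "shape (Step h (Some (d, R)) b) = ((h, [0]), [(R, orient d), (b, [1])])"
| "shape (Conj h b c) = ((h, [0]), [(b, [0]), (c, [0])])"
| "shape (Dom h (d, R)) = ((h, [0]), [(R, orient d)])"
| "shape (Start h) = ((h, []), [])"
| "shape (Chain h c b) = ((h, []), [(c, []), (b, [0])])"
| "shape (End h c) = ((h, []), [(c, []), (c, [])])"

definition atom_words :: "(nat \<Rightarrow> 'p) \<Rightarrow> 'p \<times> var list \<Rightarrow> 'p list" where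
  "atom_words f A = fst A # map f (enc_list (\<lambda>x. [x]) (snd A))"

text \<open>\<open>f\<close> embeds plain words. The leading 1 is the marker of the rule list; 1 and
  0 before a body atom are the list marker and the tag of a positive literal.\<close>

definition prule_words :: "(nat \<Rightarrow> 'p) \<Rightarrow> 'p prule \<Rightarrow> 'p list" where
  "prule_words f p = f 1 # atom_words f (fst (shape p)) @
     concat (map (\<lambda>A. f 1 # f 0 # atom_words f A) (snd (shape p))) @ [f 0]"

lemma prule_words_rule_of: "prule_words id p = 1 # enc_rule (rule_of p)"
  by (cases p rule: rule_of.cases) (simp_all add: prule_words_def atom_words_def)

lemma shape_map: "shape (map_prule g p) =
    (map_prod g id (fst (shape p)), map (map_prod g id) (snd (shape p)))"
  by (cases p rule: shape.cases) simp_all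

text \<open>Naturality in the type of names: templates may be evaluated before or after the rule is
  spelled out.\<close>

lemma map_prule_words: "map g (prule_words f p) = prule_words (g \<circ> f) (map_prule g p)"
  by (simp add: prule_words_def atom_words_def shape_map map_concat comp_def)

lemma set_prule_words: "set (prule_words f p) \<subseteq> range f \<union> set_prule p"
  by (cases p rule: shape.cases) (auto simp: prule_words_def atom_words_def)

definition emit_prules :: "item prule list \<Rightarrow> cmd" where
  "emit_prules ps = emit (concat (map (prule_words Word) ps))"

definition rules_words :: "relsym prule list \<Rightarrow> nat list" where
  "rules_words ps = concat (map (\<lambda>p. 1 # enc_rule (rule_of p)) ps)"

lemma rules_words_append [simp]: "rules_words (ps @ qs) = rules_words ps @ rules_words qs"
  "rules_words [] = []"
  by (simp_all add: rules_words_def)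

lemma enc_rules: "enc_list enc_rule (map rule_of ps) = rules_words ps @ [0]"
  by (induction ps) (simp_all add: rules_words_def)

lemma loop_free_emit_prules [simp]: "loop_free (emit_prules ps)"
  by (simp add: emit_prules_def)

lemma run_emit_prules:
  assumes "regs s 9 = 0" "\<forall>p \<in> set ps. \<forall>j. Offset 9 j \<notin> set_prule p"
  shows "run (emit_prules ps) s =
    s\<lparr>outp := outp s @ rules_words (map (map_prule (item_val s)) ps)\<rparr>"
proof -
  have "\<forall>j. Offset 9 j \<notin> set (concat (map (prule_words Word) ps))"
    using assms(2) set_prule_words[of Word] by fastforce
  moreover have "item_val s \<circ> Word = id" by auto
  ultimately show ?thesis unfolding emit_prules_def rules_words_def
    by (simp add: run_emit[OF assms(1)] map_concat map_prule_words prule_words_rule_of comp_def)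
qed

section \<open>The machine\<close>

text \<open>
  Register 0: input length; 1: input position (or a loop counter); 2: 8 times the index of
  that position; 3: stack height; 4, 5: end states of the regular expression to be read;
  6: current word; 7: previous occurrence of the current variable; 8: previous port;
  10: relation symbol. Array 0: input; 1, 2: stack of pairs of states; 3: last port of a
  variable, 0 if there is none; 4: flags of the ports that are the last ones so far.
  All states and ports are stored as 8 times their index.
\<close>

definition advance :: cmd where
  "advance = seqs [Inc 1, incs 2 8]"

definition push :: "nat \<Rightarrow> nat \<Rightarrow> cmd" where
  "push r q = seqs [Store 1 (Reg 3) (Reg r), Store 2 (Reg 3) (Reg q), Inc 3]"

definition read_word :: "nat \<Rightarrow> cmd" where
  "read_word r = Load r 0 (Reg 1)"

text \<open>The recursion of \<open>edges\<close> with an explicit stack of end states. The second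
  operand is pushed first, as the first one is read next. Register 2 names the position of the
  operator, which is the new state of \<open>Times\<close> and \<open>Star\<close>.\<close>

definition expand_body :: cmd where
  "expand_body = seqs [Dec 3, Load 4 1 (Reg 3), Load 5 2 (Reg 3), read_word 6,
     Cond (Equal (Reg 6) (Lit 0)) Skip
     (Cond (Equal (Reg 6) (Lit 1)) (emit_prules (edge_prules Offset (4, None, 5)))
     (Cond (Equal (Reg 6) (Lit 2))
        (seqs [advance, read_word 6, advance, read_word 10,
           Cond (Equal (Reg 6) (Lit 0))
             (emit_prules (edge_prules Offset (4, Some (True, Offset 10 0), 5)))
             (emit_prules (edge_prules Offset (4, Some (False, Offset 10 0), 5)))])
     (Cond (Equal (Reg 6) (Lit 3)) (seqs [push 4 5, push 4 5])
     (Cond (Equal (Reg 6) (Lit 4)) (seqs [push 2 5, push 4 2])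
        (seqs [emit_prules (edge_prules Offset (4, None, 2) @ edge_prules Offset (2, None, 5)),
           push 2 2]))))),
     advance]"

definition expand :: cmd where
  "expand = While (Less (Lit 0) (Reg 3)) expand_body"

text \<open>Ports are positive, so 0 in array 3 safely means no earlier occurrence and is replaced
  by the initial index. Clearing the flag of that index is harmless: the final pass starts one index
  later.\<close>

definition port_code :: "nat \<Rightarrow> nat \<Rightarrow> cmd" where
  "port_code z i = seqs [read_word 6, Load 7 3 (Reg 6),
     Cond (Equal (Reg 7) (Lit 0)) (Assign 7 (Lit (8 * (z + 1)))) Skip,
     emit_prules (port_prules Offset 7 8 2 i),
     Assign 8 (Reg 2), Store 3 (Reg 6) (Reg 2), Store 4 (Reg 7) (Lit 0), Store 4 (Reg 2) (Lit 1)]"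

definition atom_head :: "nat \<Rightarrow> cmd" where
  "atom_head z = seqs [advance, port_code z 0, Assign 4 (Reg 2), advance, port_code z 1,
     Assign 5 (Reg 2), advance, Assign 3 (Lit 0), push 4 5]"

definition atoms_loop :: "nat \<Rightarrow> cmd" where
  "atoms_loop z = While (Equal (Reg 6) (Lit 1)) (Seq (atom_head z) (Seq expand (read_word 6)))"

definition decls_body :: cmd where
  "decls_body = seqs [emit (concat (map (\<lambda>j. [Word 1, Offset 2 j, Word (if j = 7 then 0 else 1)]) [0..<8])),
     incs 2 8, Dec 1]"

definition decls_loop :: cmd where
  "decls_loop = While (Less (Lit 0) (Reg 1)) decls_body"

definition last_body :: "nat \<Rightarrow> cmd" where
  "last_body z = seqs [Load 6 4 (Reg 2),
     Cond (Equal (Reg 6) (Lit 1))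
       (emit_prules [Step (Offset 2 3) None (Word (pd (z + 1) 4))]) Skip,
     incs 2 8, Dec 1]"

definition last_loop :: "nat \<Rightarrow> cmd" where
  "last_loop z = While (Less (Lit 0) (Reg 1)) (last_body z)"

text \<open>The counter is the input length plus one: each word of the input has an index, and the
  initial index has its own declarations.\<close>

definition prologue :: "nat \<Rightarrow> cmd" where
  "prologue z = seqs [emit (map Word [pd z 1, 1, pd z 0, 2, 1, pd z 1, 0]), Assign 1 (Reg 0), Inc 1,
     Assign 2 (Lit (8 * (z + 1)))]"

definition middle :: "nat \<Rightarrow> relsym list \<Rightarrow> cmd" where
  "middle z Rs = seqs [emit [Word 0],
     emit_prules (map (map_prule Word) (dom_prules z Rs @ [Start (pd (z + 1) 7)])),
     Assign 1 (Lit 0), Assign 2 (Lit (8 * (z + 2))), Assign 8 (Lit (8 * (z + 1))), read_word 6]"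

definition epilogue :: "nat \<Rightarrow> cmd" where
  "epilogue z = seqs [emit_prules [End (Word (pd z 1)) (Offset 8 7)],
     Assign 1 (Reg 0), Assign 2 (Lit (8 * (z + 2)))]"

definition machine :: "nat \<Rightarrow> relsym list \<Rightarrow> cmd" where
  "machine z Rs = Seq (prologue z) (Seq decls_loop (Seq (middle z Rs)
     (Seq (atoms_loop z) (Seq (epilogue z) (Seq (last_loop z) (Write (Lit 0)))))))"

primrec reads :: "nat list \<Rightarrow> nat \<Rightarrow> nat list \<Rightarrow> bool" where
  "reads ws i [] \<longleftrightarrow> True"
| "reads ws i (x # xs) \<longleftrightarrow> i < length ws \<and> ws ! i = x \<and> reads ws (i + 1) xs"

lemma reads_append: "reads ws i (xs @ ys) \<longleftrightarrow> reads ws i xs \<and> reads ws (i + length xs) ys"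
  by (induction xs arbitrary: i) auto

lemma reads_self: "reads ws 0 ws"
proof -
  have "reads (us @ xs) (length us) xs" for us xs :: "nat list"
  proof (induction xs arbitrary: us)
    case (Cons x xs)
    then show ?case using Cons[of "us @ [x]"] by simp
  qed simp
  from this[of "[]"] show ?thesis by simp
qed

section \<open>Machine invariants\<close>

definition frame :: "nat \<Rightarrow> nat list \<Rightarrow> nat \<Rightarrow> nat \<Rightarrow> (nat \<Rightarrow> nat) \<Rightarrow> (nat \<Rightarrow> nat) \<Rightarrow> nat list \<Rightarrow>
    state \<Rightarrow> bool" where
  "frame z ws i c A3 A4 out s \<longleftrightarrow>
     regs s 0 = length ws \<and> regs s 1 = i \<and> regs s 2 = 8 * (z + 2 + i) \<and> regs s 8 = 8 * c \<and>
     regs s 9 = 0 \<and> arrs s 0 = (\<lambda>i. if i < length ws then ws ! i else 0) \<and>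
     arrs s 3 = A3 \<and> arrs s 4 = A4 \<and> outp s = out"

text \<open>The head of the list is the top of the stack, in the highest occupied cell; writing
  above it changes nothing.\<close>

primrec cells :: "(nat \<Rightarrow> nat) \<Rightarrow> (nat \<Rightarrow> nat) \<Rightarrow> (nat \<times> nat) list \<Rightarrow> bool" where
  "cells A B [] \<longleftrightarrow> True"
| "cells A B (e # es) \<longleftrightarrow>
     A (length es) = 8 * fst e \<and> B (length es) = 8 * snd e \<and> cells A B es"

lemma cells_update [simp]:
  "length es \<le> n \<Longrightarrow> cells (A(n := x)) B es \<longleftrightarrow> cells A B es"
  "length es \<le> n \<Longrightarrow> cells A (B(n := x)) es \<longleftrightarrow> cells A B es"
  by (induction es) auto

definition stack :: "(nat \<times> nat) list \<Rightarrow> state \<Rightarrow> bool" where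
  "stack es s \<longleftrightarrow> regs s 3 = length es \<and> cells (arrs s 1) (arrs s 2) es"

lemma run_code [simp]:
  "run advance s = s\<lparr>regs := (regs s)(1 := regs s 1 + 1, 2 := regs s 2 + 8)\<rparr>"
  "run (read_word r) s = s\<lparr>regs := (regs s)(r := arrs s 0 (regs s 1))\<rparr>"
  "loop_free advance" "loop_free (read_word r)" "loop_free (push r q)"
  by (auto simp: advance_def read_word_def push_def set_reg_def)

lemma run_push: "run (push r q) s = s\<lparr>regs := (regs s)(3 := regs s 3 + 1),
    arrs := (arrs s)(1 := (arrs s 1)(regs s 3 := regs s r), 2 := (arrs s 2)(regs s 3 := regs s q))\<rparr>"
  by (simp add: push_def set_reg_def)

section \<open>Reading a regular expression\<close>

lemma loop_free_expand_body: "loop_free expand_body"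
  by (simp add: expand_body_def)

context
  fixes z ws i c A3 A4 out s u v stk
  assumes fr: "frame z ws i c A3 A4 out s" and st: "stack ((u, v) # stk) s"
begin

lemmas expand_simps = frame_def stack_def expand_body_def run_push run_emit_prules set_reg_def
  pd_def flip_def

lemma expand_Zero:
  assumes "reads ws i (enc_rexp Zero)"
  shows "frame z ws (i + 1) c A3 A4 out (run expand_body s) \<and> stack stk (run expand_body s)"
  using assms fr st by (simp add: expand_simps)

lemma expand_One:
  assumes "reads ws i (enc_rexp One)"
  shows "frame z ws (i + 1) c A3 A4 (out @ rules_words (edge_prules pd (u, None, v))) (run expand_body s) \<and>
    stack stk (run expand_body s)"
  using assms fr st by (simp add: expand_simps)

lemma expand_Sym:
  assumes "reads ws i (enc_rexp (Sym l))"
  shows "frame z ws (i + 3) c A3 A4 (out @ rules_words (edge_prules pd (u, label l, v)))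
      (run expand_body s) \<and> stack stk (run expand_body s)"
  using assms fr st by (cases l) (simp_all add: expand_simps)

lemma expand_Plus:
  assumes "reads ws i [3]"
  shows "frame z ws (i + 1) c A3 A4 out (run expand_body s) \<and>
    stack ((u, v) # (u, v) # stk) (run expand_body s)"
  using assms fr st by (simp add: expand_simps)

lemma expand_Times:
  assumes "reads ws i [4]"
  shows "frame z ws (i + 1) c A3 A4 out (run expand_body s) \<and>
    stack ((u, z + 2 + i) # (z + 2 + i, v) # stk) (run expand_body s)"
  using assms fr st by (simp add: expand_simps)

lemma expand_Star:
  assumes "reads ws i [5]"
  shows "frame z ws (i + 1) c A3 A4 (out @ rules_words
      (edge_prules pd (u, None, z + 2 + i) @ edge_prules pd (z + 2 + i, None, v))) (run expand_body s) \<and>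
    stack ((z + 2 + i, z + 2 + i) # stk) (run expand_body s)"
  using assms fr st by (simp add: expand_simps)

end

lemma expand_step:
  assumes "stack (e # stk) s" "halts expand (run expand_body s) T s'"
  shows "halts expand s ((size expand_body + 2) + T) s'"
proof -
  have "passes s (Less (Lit 0) (Reg 3))" using assms(1) by (simp add: stack_def)
  from halts_While[OF this halts_run[OF loop_free_expand_body] assms(2)[unfolded expand_def]]
  show ?thesis by (simp add: expand_def)
qed

definition edges_words :: "(nat \<times> relsym label \<times> nat) list \<Rightarrow> nat list" where
  "edges_words es = rules_words (concat (map (edge_prules pd) es))"

lemma edges_words_append: "edges_words (es @ es') = edges_words es @ edges_words es'"
  by (simp add: edges_words_def)

text \<open>The loop does not stop after \<open>r\<close> while the stack is nonempty. Its time is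
  therefore stated with a continuation: any halting run from \<open>s'\<close> extends backwards to
  \<open>s\<close>, at the price of at most one round per word.\<close>

lemma halts_expand:
  assumes "frame z ws i c A3 A4 out s" "stack ((u, v) # stk) s" "reads ws i (enc_rexp r)"
  shows "\<exists>s'. frame z ws (i + rlen r) c A3 A4 (out @ edges_words (edges r (z + 2 + i) u v)) s' \<and>
    stack stk s' \<and>
    (\<forall>T s''. halts expand s' T s'' \<longrightarrow> halts expand s ((size expand_body + 2) * rlen r + T) s'')"
  using assms
proof (induction r arbitrary: i out s u v stk)
  case Zero
  then show ?case using expand_Zero[OF Zero.prems] expand_step[OF Zero.prems(2)]
    by (intro exI[of _ "run expand_body s"]) (simp add: edges_words_def)
next
  case One
  then show ?case using expand_One[OF One.prems] expand_step[OF One.prems(2)]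
    by (intro exI[of _ "run expand_body s"]) (simp add: edges_words_def)
next
  case (Sym l)
  have len: "length (enc_letter l) = 2" by (cases l) auto
  have "halts expand s ((size expand_body + 2) * rlen (Sym l) + T) s''"
    if "halts expand (run expand_body s) T s''" for T s''
    by (rule halts_mono[OF expand_step[OF Sym.prems(2) that]]) (simp add: len)
  then show ?case using expand_Sym[OF Sym.prems]
    by (intro exI[of _ "run expand_body s"]) (simp add: len edges_words_def del: edge_prules.simps)
next
  case (Plus r1 r2)
  let ?K = "size expand_body + 2"
  have reads: "reads ws i [3]" "reads ws (i + 1) (enc_rexp r1)"
    "reads ws (i + 1 + rlen r1) (enc_rexp r2)"
    using Plus.prems(3) by (auto simp: reads_append)
  note first = expand_Plus[OF Plus.prems(1,2) reads(1)]
  obtain s1 where s1: "frame z ws (i + 1 + rlen r1) c A3 A4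
      (out @ edges_words (edges r1 (z + 2 + (i + 1)) u v)) s1" "stack ((u, v) # stk) s1"
    "\<And>T s''. halts expand s1 T s'' \<Longrightarrow> halts expand (run expand_body s) (?K * rlen r1 + T) s''"
    using Plus.IH(1)[OF conjunct1[OF first] conjunct2[OF first] reads(2)] by blast
  obtain s2 where s2: "frame z ws (i + 1 + rlen r1 + rlen r2) c A3 A4
      ((out @ edges_words (edges r1 (z + 2 + (i + 1)) u v)) @
       edges_words (edges r2 (z + 2 + (i + 1 + rlen r1)) u v)) s2" "stack stk s2"
    "\<And>T s''. halts expand s2 T s'' \<Longrightarrow> halts expand s1 (?K * rlen r2 + T) s''"
    using Plus.IH(2)[OF s1(1,2) reads(3)] by blast
  have "halts expand s (?K * rlen (Plus r1 r2) + T) s''" if "halts expand s2 T s''" for T s''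
    using expand_step[OF Plus.prems(2) s1(3)[OF s2(3)[OF that]]] by (simp add: algebra_simps)
  moreover have "frame z ws (i + rlen (Plus r1 r2)) c A3 A4
      (out @ edges_words (edges (Plus r1 r2) (z + 2 + i) u v)) s2"
    using s2(1) by (simp add: edges_words_append algebra_simps)
  ultimately show ?case using s2(2) by blast
next
  case (Times r1 r2)
  let ?K = "size expand_body + 2"
  let ?m = "z + 2 + i"
  have reads: "reads ws i [4]" "reads ws (i + 1) (enc_rexp r1)"
    "reads ws (i + 1 + rlen r1) (enc_rexp r2)"
    using Times.prems(3) by (auto simp: reads_append)
  note first = expand_Times[OF Times.prems(1,2) reads(1)]
  obtain s1 where s1: "frame z ws (i + 1 + rlen r1) c A3 A4
      (out @ edges_words (edges r1 (z + 2 + (i + 1)) u ?m)) s1" "stack ((?m, v) # stk) s1"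
    "\<And>T s''. halts expand s1 T s'' \<Longrightarrow> halts expand (run expand_body s) (?K * rlen r1 + T) s''"
    using Times.IH(1)[OF conjunct1[OF first] conjunct2[OF first] reads(2)] by blast
  obtain s2 where s2: "frame z ws (i + 1 + rlen r1 + rlen r2) c A3 A4
      ((out @ edges_words (edges r1 (z + 2 + (i + 1)) u ?m)) @
       edges_words (edges r2 (z + 2 + (i + 1 + rlen r1)) ?m v)) s2" "stack stk s2"
    "\<And>T s''. halts expand s2 T s'' \<Longrightarrow> halts expand s1 (?K * rlen r2 + T) s''"
    using Times.IH(2)[OF s1(1,2) reads(3)] by blast
  have "halts expand s (?K * rlen (Times r1 r2) + T) s''" if "halts expand s2 T s''" for T s''
    using expand_step[OF Times.prems(2) s1(3)[OF s2(3)[OF that]]] by (simp add: algebra_simps)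
  moreover have "frame z ws (i + rlen (Times r1 r2)) c A3 A4
      (out @ edges_words (edges (Times r1 r2) (z + 2 + i) u v)) s2"
    using s2(1) by (simp add: edges_words_append algebra_simps)
  ultimately show ?case using s2(2) by blast
next
  case (Star r)
  let ?K = "size expand_body + 2"
  let ?m = "z + 2 + i"
  have reads: "reads ws i [5]" "reads ws (i + 1) (enc_rexp r)"
    using Star.prems(3) by auto
  note first = expand_Star[OF Star.prems(1,2) reads(1)]
  obtain s1 where s1: "frame z ws (i + 1 + rlen r) c A3 A4
      ((out @ rules_words (edge_prules pd (u, None, ?m) @ edge_prules pd (?m, None, v))) @
       edges_words (edges r (z + 2 + (i + 1)) ?m ?m)) s1" "stack stk s1"
    "\<And>T s''. halts expand s1 T s'' \<Longrightarrow> halts expand (run expand_body s) (?K * rlen r + T) s''"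
    using Star.IH[OF conjunct1[OF first] conjunct2[OF first] reads(2)] by blast
  have "halts expand s (?K * rlen (Star r) + T) s''" if "halts expand s1 T s''" for T s''
    using expand_step[OF Star.prems(2) s1(3)[OF that]] by (simp add: algebra_simps)
  moreover have "frame z ws (i + rlen (Star r)) c A3 A4
      (out @ edges_words (edges (Star r) (z + 2 + i) u v)) s1"
    using s1(1) by (simp add: edges_words_def algebra_simps del: edge_prules.simps)
  ultimately show ?case using s1(2) by blast
qed

context query_ports
begin

section \<open>Reading the ports and atoms\<close>

definition last_before :: "nat \<Rightarrow> nat \<Rightarrow> bool" where
  "last_before m p \<longleftrightarrow> (\<exists>x. p \<in> ports_at H x \<and> p < m \<and> (\<forall>q \<in> ports_at H x. q < m \<longrightarrow> q \<le> p))"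

text \<open>The contents of arrays 3 and 4 after the ports below \<open>m\<close> have been read.\<close>

definition links :: "nat \<Rightarrow> (nat \<Rightarrow> nat) \<Rightarrow> bool" where
  "links m A \<longleftrightarrow> (\<forall>x. A x = (if prev_at x m = z + 1 then 0 else 8 * prev_at x m))"

definition flags :: "nat \<Rightarrow> (nat \<Rightarrow> nat) \<Rightarrow> bool" where
  "flags m A \<longleftrightarrow> (\<forall>p > z + 1. A (8 * p) = 1 \<longleftrightarrow> last_before m p)"

lemma previous_Suc:
  "previous z A (m + 1) = (if m \<in> A \<and> z + 1 < m then m else previous z A m)"
proof (cases "m \<in> A \<and> z + 1 < m")
  case True
  then have "previous z A (m + 1) = m" unfolding previous_def by (intro Max_eqI) auto
  then show ?thesis using True by simp
next
  case False
  have "insert (z + 1) {q \<in> A. q < m + 1} = insert (z + 1) {q \<in> A. q < m} \<or>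
      m \<in> A \<and> m < z + 1 \<and> {q \<in> A. q < m + 1} = insert m {q \<in> A. q < m}"
    using False by (auto simp: less_Suc_eq)
  then have "previous z A (m + 1) = previous z A m"
  proof (elim disjE conjE)
    assume "insert (z + 1) {q \<in> A. q < m + 1} = insert (z + 1) {q \<in> A. q < m}"
    then show ?thesis by (simp add: previous_def)
  next
    assume "m < z + 1"
    then have "previous z A k = z + 1" if "k \<le> m + 1" for k
      unfolding previous_def using that by (intro Max_eqI) auto
    then show ?thesis by simp
  qed
  then show ?thesis using False by auto
qed

lemma no_port_step:
  assumes "m \<notin> fst ` H"
  shows "prev_port (m + 1) = prev_port m"
    and "links (m + 1) A \<longleftrightarrow> links m A" and "flags (m + 1) A \<longleftrightarrow> flags m A"
proof -
  have m: "m \<notin> ports_at H x" for x using assms by (force simp: ports_at_def)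
  show "prev_port (m + 1) = prev_port m" unfolding previous_Suc using assms by simp
  show "links (m + 1) A \<longleftrightarrow> links m A" unfolding links_def previous_Suc using m by simp
  have "p < m + 1 \<longleftrightarrow> p < m" if "p \<in> ports_at H x" for p x using m that by (metis less_antisym Suc_eq_plus1 less_SucI)
  then have "last_before (m + 1) p \<longleftrightarrow> last_before m p" for p unfolding last_before_def by meson
  then show "flags (m + 1) A \<longleftrightarrow> flags m A" by (simp add: flags_def)
qed

text \<open>Only the variable of \<open>m\<close> is affected: \<open>m\<close> replaces its
  predecessor as the last port. If the predecessor is the initial index, the cleared cell lies
  outside the range of \<open>flags\<close>.\<close>

lemma port_step:
  assumes m: "(m, x, i) \<in> H" and "links m A" and "flags m B"
  shows "prev_port (m + 1) = m"
    and "links (m + 1) (A(x := 8 * m))"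
    and "flags (m + 1) (B(8 * prev_at x m := 0, 8 * m := 1))"
proof -
  have b: "z + 1 < m" using port_bounds[OF m] by simp
  have at: "m \<in> ports_at H y \<longleftrightarrow> y = x" for y
    using ports_same[OF m] by (auto simp: ports_at_iff)
  have "m \<in> fst ` H" using m by force
  then show "prev_port (m + 1) = m" unfolding previous_Suc using b by simp
  show "links (m + 1) (A(x := 8 * m))"
    using \<open>links m A\<close> b unfolding links_def previous_Suc at by simp
  have "last_before (m + 1) p \<longleftrightarrow> (p = m \<or> p \<noteq> prev_at x m \<and> last_before m p)"
    if p: "z + 1 < p" for p
  proof (cases "p = m")
    case True
    then show ?thesis unfolding last_before_def using at[of x] by force
  next
    case False
    show ?thesis
    proof (cases "p \<in> ports_at H x")
      case True
      have same: "p \<in> ports_at H y \<longleftrightarrow> y = x" for y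
        using True ports_same by (auto simp: ports_at_iff)
      have "\<not> last_before (m + 1) p"
        using at[of x] False unfolding last_before_def same by force
      moreover have "p = prev_at x m" if "last_before m p"
        using that unfolding last_before_def same previous_def
        by (intro Max_eqI[symmetric]) (use p True in auto)
      ultimately show ?thesis using False by blast
    next
      case other: False
      have "p \<noteq> prev_at x m"
      proof (rule previous_cases[of "ports_at H x" z m, OF ports_at_bounds(1)])
        assume "prev_at x m = z + 1"
        then show ?thesis using p by simp
      next
        assume "prev_at x m \<in> ports_at H x"
        then show ?thesis using other by metis
      qed
      moreover have "last_before (m + 1) p \<longleftrightarrow> last_before m p"
      proof -
        have "q < m + 1 \<longleftrightarrow> q < m" if "q \<in> ports_at H y" "p \<in> ports_at H y" for q y
        proof -
          have "q \<noteq> m" using that at other by metis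
          then show ?thesis by auto
        qed
        then show ?thesis unfolding last_before_def by meson
      qed
      ultimately show ?thesis using False by blast
    qed
  qed
  then show "flags (m + 1) (B(8 * prev_at x m := 0, 8 * m := 1))"
    using \<open>flags m B\<close> by (auto simp: flags_def)
qed

text \<open>Register 4 is tracked because it holds the left end state while the right port is
  processed.\<close>

lemma run_port_code:
  assumes fr: "frame z ws i c A B out s" and "i < length ws" "ws ! i = x"
    and "(z + 2 + i, x, j) \<in> H" and "links (z + 2 + i) A" "flags (z + 2 + i) B"
    and c: "c = prev_port (z + 2 + i)"
  shows "\<exists>A' B'. frame z ws i (z + 2 + i) A' B'
      (out @ rules_words (port_prules pd (prev_at x (z + 2 + i)) c (z + 2 + i) j)) (run (port_code z j) s) \<and>
    links (z + 2 + i + 1) A' \<and> flags (z + 2 + i + 1) B' \<and>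
    regs (run (port_code z j) s) 4 = regs s 4"
proof -
  let ?m = "z + 2 + i"
  let ?p = "prev_at x ?m"
  have A: "A x = (if ?p = z + 1 then 0 else 8 * ?p)" using \<open>links ?m A\<close> by (simp add: links_def)
  have p: "z + 1 \<le> ?p"
    using previous_range[of "ports_at H x" ?m] port_bounds[OF assms(4)]
    by (force simp: ports_at_def)
  have j: "j \<le> 1" using port_bounds[OF assms(4)] by simp
  have "frame z ws i ?m (A(x := 8 * ?m)) (B(8 * ?p := 0, 8 * ?m := 1))
      (out @ rules_words (port_prules pd ?p c ?m j)) (run (port_code z j) s) \<and>
      regs (run (port_code z j) s) 4 = regs s 4"
    using fr assms(2,3) A p
    by (auto simp: frame_def port_code_def set_reg_def run_emit_prules port_prules_def pd_def)
  then show ?thesis using port_step[OF assms(4-6)] by blast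
qed


lemma no_port_steps:
  assumes "\<And>m'. m \<le> m' \<Longrightarrow> m' < m + d \<Longrightarrow> m' \<notin> fst ` H"
  shows "prev_port (m + d) = prev_port m \<and> (links (m + d) A \<longleftrightarrow> links m A) \<and>
    (flags (m + d) B \<longleftrightarrow> flags m B)"
  using assms
proof (induction d)
  case (Suc d)
  then show ?case using no_port_step(1)[of "m + d"] no_port_step(2)[of "m + d" A]
      no_port_step(3)[of "m + d" B] by simp
qed simp

lemma not_port:
  assumes "(k, x, r, y) \<in> set es" "m \<in> {k..<k + 3 + rlen r}" "m \<noteq> k + 1" "m \<noteq> k + 2"
  shows "m \<notin> fst ` H"
  using port_owner[OF assms(1) _ assms(2)] assms(3,4) by fastforce

lemma run_atom_head:
  fixes i s
  defines "k \<equiv> z + 2 + i" and "s' \<equiv> run (atom_head z) s"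
  assumes e: "(k, x, r, y) \<in> set es" and reads: "reads ws i (1 # x # y # enc_rexp r)"
    and fr: "frame z ws i (prev_port k) A B out s" and A: "links k A" and B: "flags k B"
  shows "\<exists>A' B'. frame z ws (i + 3) (prev_port (k + 3)) A' B' (out @ rules_words
      (port_prules pd (prev_at x (k + 1)) (prev_port (k + 1)) (k + 1) 0 @
       port_prules pd (prev_at y (k + 2)) (prev_port (k + 2)) (k + 2) 1)) s' \<and>
    stack [(k + 1, k + 2)] s' \<and> links (k + 3) A' \<and> flags (k + 3) B'"
proof -
  note ports = port_intros[OF e]
  have "k \<notin> fst ` H" by (rule not_port[OF e]) auto
  note skip = no_port_step[OF this]
  define s0 where "s0 = run advance s"
  have fr0: "frame z ws (i + 1) (prev_port (k + 1)) A B out s0"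
    using fr skip(1) by (simp add: frame_def s0_def)
  define s1 where "s1 = run (port_code z 0) s0"
  have "\<exists>A1 B1. frame z ws (i + 1) (k + 1) A1 B1
      (out @ rules_words (port_prules pd (prev_at x (k + 1)) (prev_port (k + 1)) (k + 1) 0)) s1 \<and>
      links (k + 2) A1 \<and> flags (k + 2) B1"
    using run_port_code[OF fr0, of x 0] reads ports(1) A B skip by (simp add: k_def s1_def) blast
  then obtain A1 B1 where fr1: "frame z ws (i + 1) (k + 1) A1 B1
      (out @ rules_words (port_prules pd (prev_at x (k + 1)) (prev_port (k + 1)) (k + 1) 0)) s1"
    and 1: "links (k + 2) A1" "flags (k + 2) B1" by blast
  have prev2: "prev_port (k + 2) = k + 1"
    using port_step(1)[OF ports(1)] skip(2,3) A B by simp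
  define s2 where "s2 = run advance (run (Assign 4 (Reg 2)) s1)"
  have fr2: "frame z ws (i + 2) (prev_port (k + 2)) A1 B1
      (out @ rules_words (port_prules pd (prev_at x (k + 1)) (prev_port (k + 1)) (k + 1) 0)) s2"
    and r4: "regs s2 4 = 8 * (k + 1)"
    using fr1 unfolding prev2 by (simp_all add: frame_def s2_def set_reg_def k_def)
  define s3 where "s3 = run (port_code z 1) s2"
  have "\<exists>A2 B2. frame z ws (i + 2) (k + 2) A2 B2 (out @ rules_words
      (port_prules pd (prev_at x (k + 1)) (prev_port (k + 1)) (k + 1) 0 @
       port_prules pd (prev_at y (k + 2)) (prev_port (k + 2)) (k + 2) 1)) s3 \<and>
      links (k + 3) A2 \<and> flags (k + 3) B2 \<and> regs s3 4 = 8 * (k + 1)"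
    using run_port_code[OF fr2, of y 1] reads ports(2) 1 r4
    by (simp add: k_def s3_def numeral_3_eq_3)
  then obtain A2 B2 where fr3: "frame z ws (i + 2) (k + 2) A2 B2 (out @ rules_words
      (port_prules pd (prev_at x (k + 1)) (prev_port (k + 1)) (k + 1) 0 @
       port_prules pd (prev_at y (k + 2)) (prev_port (k + 2)) (k + 2) 1)) s3"
    and 2: "links (k + 3) A2" "flags (k + 3) B2" "regs s3 4 = 8 * (k + 1)" by blast
  have prev3: "prev_port (k + 3) = k + 2"
    using port_step(1)[OF ports(2), of A1 B1] 1 by (simp add: numeral_3_eq_3)
  have s': "s' = run (push 4 5) (run (Assign 3 (Lit 0)) (run advance (run (Assign 5 (Reg 2)) s3)))"
    by (simp add: s'_def atom_head_def s3_def s2_def s1_def s0_def)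
  have "frame z ws (i + 3) (prev_port (k + 3)) A2 B2 (out @ rules_words
      (port_prules pd (prev_at x (k + 1)) (prev_port (k + 1)) (k + 1) 0 @
       port_prules pd (prev_at y (k + 2)) (prev_port (k + 2)) (k + 2) 1)) s' \<and>
    stack [(k + 1, k + 2)] s'"
    using fr3 2(3) unfolding prev3 s'
    by (simp add: frame_def stack_def run_push set_reg_def k_def)
  then show ?thesis using 2 by blast
qed

lemma loop_free_atom_head: "loop_free (atom_head z)"
  by (simp add: atom_head_def port_code_def)

text \<open>A charge per input word: the fixed code of an atom is paid by its marker, each round of
  \<open>expand\<close> by a word of the expression.\<close>

definition atom_cost :: nat where
  "atom_cost = size (atom_head z) + size expand_body + size (read_word 6) + 5"

text \<open>The induction is over the unread atoms \<open>Q'\<close>, while ports and links refer to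
  the whole query. The loop stops on the closing word, at position \<open>j\<close>.\<close>

lemma halts_atoms_loop:
  assumes "set (positions (z + 2 + i) Q') \<subseteq> set es" and "reads ws i (enc_query Q')"
    and "frame z ws i (prev_port (z + 2 + i)) A B out s" and "regs s 6 = ws ! i"
    and "links (z + 2 + i) A" and "flags (z + 2 + i) B"
  shows "\<exists>s' A' B' j. i + length (enc_query Q') = j + 1 \<and>
    frame z ws j (prev_port (z + 2 + j)) A' B'
      (out @ rules_words (concat (map (atom_prules z H) (positions (z + 2 + i) Q')))) s' \<and>
    flags (z + 2 + j) B' \<and> halts (atoms_loop z) s (atom_cost * length (enc_query Q')) s'"
  using assms
proof (induction Q' arbitrary: i A B out s)
  case Nil
  then have "\<not> passes s (Equal (Reg 6) (Lit 1))" by (simp add: enc_query_def)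
  then have "halts (atoms_loop z) s atom_cost s"
    unfolding atoms_loop_def by (intro halts_mono[OF halts_While_end]) (simp_all add: atom_cost_def)
  then show ?case using Nil.prems by (auto simp: enc_query_def)
next
  case (Cons q Q')
  obtain x r y where q: "q = (x, r, y)" by (cases q)
  let ?k = "z + 2 + i"
  let ?K = "size expand_body + 2"
  define i' where "i' = i + 3 + rlen r"
  have words: "enc_query (q # Q') = (1 # x # y # enc_rexp r) @ enc_query Q'"
    by (simp add: enc_query_def q)
  have pos: "i + length (1 # x # y # enc_rexp r) = i'" by (simp add: i'_def)
  have reads: "reads ws i (1 # x # y # enc_rexp r)" "reads ws i' (enc_query Q')"
    using Cons.prems(2)[unfolded words reads_append pos] by blast+
  have e: "(?k, x, r, y) \<in> set es" using Cons.prems(1) q by simp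
  let ?s1 = "run (atom_head z) s"
  let ?out1 = "out @ rules_words
      (port_prules pd (prev_at x (?k + 1)) (prev_port (?k + 1)) (?k + 1) 0 @
       port_prules pd (prev_at y (?k + 2)) (prev_port (?k + 2)) (?k + 2) 1)"
  obtain A1 B1 where s1: "frame z ws (i + 3) (prev_port (?k + 3)) A1 B1 ?out1 ?s1"
    "stack [(?k + 1, ?k + 2)] ?s1" "links (?k + 3) A1" "flags (?k + 3) B1"
    using run_atom_head[OF e reads(1) Cons.prems(3,5,6)] by blast
  have "reads ws (i + 3) (enc_rexp r)" using reads(1) by (simp add: numeral_3_eq_3)
  from halts_expand[OF s1(1,2) this] obtain s2 where
    s2: "frame z ws i' (prev_port (?k + 3)) A1 B1
      (?out1 @ edges_words (edges r (z + 2 + (i + 3)) (?k + 1) (?k + 2))) s2" "stack [] s2"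
    "\<And>T s''. halts expand s2 T s'' \<Longrightarrow> halts expand ?s1 (?K * rlen r + T) s''"
    unfolding i'_def by blast
  have "halts expand s2 1 s2"
    unfolding expand_def by (rule halts_While_end) (use s2(2) in \<open>simp add: stack_def\<close>)
  from s2(3)[OF this] have h12: "halts expand ?s1 (?K * rlen r + 1) s2" .
  let ?s3 = "run (read_word 6) s2"
  have eq: "z + 2 + i' = ?k + 3 + rlen r" by (simp add: i'_def)
  have "prev_port (?k + 3 + rlen r) = prev_port (?k + 3) \<and>
      (links (?k + 3 + rlen r) A1 \<longleftrightarrow> links (?k + 3) A1) \<and>
      (flags (?k + 3 + rlen r) B1 \<longleftrightarrow> flags (?k + 3) B1)"
    by (rule no_port_steps, rule not_port[OF e]) auto
  then have skip: "prev_port (z + 2 + i') = prev_port (?k + 3)"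
    "links (z + 2 + i') A1" "flags (z + 2 + i') B1" using s1(3,4) unfolding eq by blast+
  have i': "i' < length ws" using reads(2) by (cases Q') (auto simp: enc_query_def)
  let ?out = "?out1 @ edges_words (edges r (z + 2 + (i + 3)) (?k + 1) (?k + 2))"
  have fr3: "frame z ws i' (prev_port (z + 2 + i')) A1 B1 ?out ?s3" and r6: "regs ?s3 6 = ws ! i'"
    using s2(1) i' unfolding skip(1) by (simp_all add: frame_def)
  have sub: "set (positions (z + 2 + i') Q') \<subseteq> set es"
    using Cons.prems(1) q by (simp add: i'_def add.assoc)
  from Cons.IH[OF sub reads(2) fr3 r6 skip(2,3)] obtain s' A' B' j where
    j: "i' + length (enc_query Q') = j + 1"
    "frame z ws j (prev_port (z + 2 + j)) A' B'
      (?out @ rules_words (concat (map (atom_prules z H) (positions (z + 2 + i') Q')))) s'"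
    "flags (z + 2 + j) B'"
    "halts (atoms_loop z) ?s3 (atom_cost * length (enc_query Q')) s'" by blast
  have "halts (Seq (atom_head z) (Seq expand (read_word 6))) s
      ((size (atom_head z) + 1) + ((?K * rlen r + 1) + (size (read_word 6) + 1))) ?s3"
    by (intro halts_Seq[OF halts_run] halts_Seq[OF h12] halts_run)
      (simp_all add: loop_free_atom_head)
  moreover have "passes s (Equal (Reg 6) (Lit 1))" using Cons.prems(4) reads(1) by simp
  ultimately have "halts (atoms_loop z) s
      (1 + ((size (atom_head z) + 1) + ((?K * rlen r + 1) + (size (read_word 6) + 1))) +
       atom_cost * length (enc_query Q')) s'"
    using j(4) unfolding atoms_loop_def by (intro halts_While)
  moreover have "1 + ((size (atom_head z) + 1) + ((?K * rlen r + 1) + (size (read_word 6) + 1))) +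
       atom_cost * length (enc_query Q') \<le> atom_cost * length (enc_query (q # Q'))"
    by (simp add: words atom_cost_def algebra_simps)
  ultimately have "halts (atoms_loop z) s (atom_cost * length (enc_query (q # Q'))) s'"
    by (rule halts_mono)
  moreover have "i + length (enc_query (q # Q')) = j + 1"
    using j(1) by (simp add: words i'_def)
  moreover have "out @ rules_words (concat (map (atom_prules z H) (positions ?k (q # Q')))) =
      ?out @ rules_words (concat (map (atom_prules z H) (positions (z + 2 + i') Q')))"
    by (simp add: q i'_def edges_words_def add.assoc)
  ultimately show ?case using j(2,3) by metis
qed

lemma halts_last_loop:
  assumes "regs s 1 = t" "regs s 2 = 8 * k" "regs s 9 = 0" "z + 1 < k"
    and "\<And>p. k \<le> p \<Longrightarrow> arrs s 4 (8 * p) = 1 \<longleftrightarrow> is_last H p"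
  shows "\<exists>s'. halts (last_loop z) s ((size (last_body z) + 2) * t + 1) s' \<and>
    outp s' = outp s @ rules_words (concat (map (last_prules z H) [k..<k + t]))"
  using assms
proof (induction t arbitrary: s k)
  case 0
  then have "halts (last_loop z) s 1 s" unfolding last_loop_def by (intro halts_While_end) simp
  then show ?case by auto
next
  case (Suc t)
  let ?s = "run (last_body z) s"
  have s: "regs ?s 1 = t" "regs ?s 2 = 8 * (k + 1)" "regs ?s 9 = 0" "arrs ?s = arrs s"
    "outp ?s = outp s @ rules_words (last_prules z H k)"
    using Suc.prems(1-3) Suc.prems(5)[of k]
    by (simp_all add: last_body_def set_reg_def run_emit_prules last_prules_def pd_def)
  have "\<exists>s'. halts (last_loop z) ?s ((size (last_body z) + 2) * t + 1) s' \<and>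
    outp s' = outp ?s @ rules_words (concat (map (last_prules z H) [k + 1..<k + 1 + t]))"
    by (rule Suc.IH) (use s Suc.prems(4,5) in auto)
  then obtain s' where s': "halts (last_loop z) ?s ((size (last_body z) + 2) * t + 1) s'"
    "outp s' = outp ?s @ rules_words (concat (map (last_prules z H) [k + 1..<k + 1 + t]))" by blast
  have "passes s (Less (Lit 0) (Reg 1))" using Suc.prems(1) by simp
  moreover have "loop_free (last_body z)" by (simp add: last_body_def)
  ultimately have "halts (last_loop z) s
      (1 + (size (last_body z) + 1) + ((size (last_body z) + 2) * t + 1)) s'"
    using s'(1) halts_While[OF _ halts_run] unfolding last_loop_def by blast
  moreover have "[k..<k + Suc t] = k # [k + 1..<k + 1 + t]" by (simp add: upt_conv_Cons)
  ultimately show ?case using s'(2) s(5)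
    by (intro exI[of _ s']) (auto simp: algebra_simps elim: halts_mono)
qed

end

section \<open>Declarations and the complete run\<close>

definition decls_words :: "nat list \<Rightarrow> nat list" where
  "decls_words ps = concat (map (\<lambda>p. [1, p, if p mod 8 = 7 then 0 else 1]) ps)"

lemma enc_decls: "enc_list (\<lambda>(R, k). [R, k]) (map (\<lambda>p. (p, if p mod 8 = 7 then 0 else 1)) ps) =
    decls_words ps @ [0]"
  by (induction ps) (simp_all add: decls_words_def)

lemma halts_decls_loop:
  assumes "regs s 1 = t" "regs s 2 = 8 * k" "regs s 9 = 0"
  shows "halts decls_loop s ((size decls_body + 2) * t + 1)
    (s\<lparr>regs := (regs s)(1 := 0, 2 := 8 * (k + t)), outp := outp s @ decls_words [8 * k..<8 * (k + t)]\<rparr>)"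
  using assms
proof (induction t arbitrary: s k)
  case 0
  then have "s\<lparr>regs := (regs s)(1 := 0, 2 := 8 * (k + 0)),
      outp := outp s @ decls_words [8 * k..<8 * (k + 0)]\<rparr> = s"
    by (simp add: fun_upd_idem decls_words_def)
  moreover have "halts decls_loop s 1 s"
    using 0 unfolding decls_loop_def by (intro halts_While_end) simp
  ultimately show ?case by (simp only: mult_0_right add_0_left)
next
  case (Suc t)
  let ?s = "run decls_body s"
  have "[8 * k..<8 * (k + 1)] = map (\<lambda>j. 8 * k + j) [0..<8]"
    using map_add_upt[of "8 * k" 8] by (simp add: add.commute)
  then have out: "decls_words [8 * k..<8 * (k + 1)] =
      concat (map (\<lambda>j. [1, 8 * k + j, if j = 7 then 0 else 1]) [0..<8])"
    unfolding decls_words_def by (simp only: map_map) (intro arg_cong[of _ _ concat] map_cong, auto)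
  have s: "?s = s\<lparr>regs := (regs s)(1 := t, 2 := 8 * (k + 1)),
      outp := outp s @ decls_words [8 * k..<8 * (k + 1)]\<rparr>"
    unfolding out using Suc.prems
    by (simp add: decls_body_def set_reg_def run_emit upt_rec fun_upd_twist add.commute[of _ 8])
  have split: "[8 * k..<8 * (k + Suc t)] = [8 * k..<8 * (k + 1)] @ [8 * (k + 1)..<8 * (k + 1 + t)]"
    using upt_add_eq_append[of "8 * k" "8 * (k + 1)" "8 * t"] by (simp add: algebra_simps)
  have "halts decls_loop ?s ((size decls_body + 2) * t + 1)
    (?s\<lparr>regs := (regs ?s)(1 := 0, 2 := 8 * (k + 1 + t)),
        outp := outp ?s @ decls_words [8 * (k + 1)..<8 * (k + 1 + t)]\<rparr>)"
    by (rule Suc.IH) (use s Suc.prems in simp_all)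
  moreover have "passes s (Less (Lit 0) (Reg 1))" using Suc.prems(1) by simp
  moreover have "loop_free decls_body" by (simp add: decls_body_def)
  ultimately have "halts decls_loop s (1 + (size decls_body + 1) + ((size decls_body + 2) * t + 1))
    (?s\<lparr>regs := (regs ?s)(1 := 0, 2 := 8 * (k + 1 + t)),
        outp := outp ?s @ decls_words [8 * (k + 1)..<8 * (k + 1 + t)]\<rparr>)"
    using halts_While[OF _ halts_run] unfolding decls_loop_def by blast
  moreover have "?s\<lparr>regs := (regs ?s)(1 := 0, 2 := 8 * (k + 1 + t)),
        outp := outp ?s @ decls_words [8 * (k + 1)..<8 * (k + 1 + t)]\<rparr> =
      s\<lparr>regs := (regs s)(1 := 0, 2 := 8 * (k + Suc t)),
        outp := outp s @ decls_words [8 * k..<8 * (k + Suc t)]\<rparr>"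
    unfolding s split by (simp add: decls_words_def fun_upd_twist)
  ultimately have "halts decls_loop s (1 + (size decls_body + 1) + ((size decls_body + 2) * t + 1))
    (s\<lparr>regs := (regs s)(1 := 0, 2 := 8 * (k + Suc t)),
        outp := outp s @ decls_words [8 * k..<8 * (k + Suc t)]\<rparr>)"
    by (simp only:)
  then show ?case by (rule halts_mono) simp
qed

lemma run_emit_words:
  assumes "regs s 9 = 0"
  shows "run (emit_prules (map (map_prule Word) ps)) s = s\<lparr>outp := outp s @ rules_words ps\<rparr>"
proof -
  have "item_val s \<circ> Word = id" by auto
  then have "map (map_prule (item_val s)) (map (map_prule Word) ps) = ps"
    by (simp add: prule.map_comp comp_def prule.map_id0)
  then show ?thesis
    using run_emit_prules[OF assms, of "map (map_prule Word) ps"] by (force simp: prule.set_map)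
qed

text \<open>The declaration loop makes \<open>n + 1 \<le> 2 * n\<close> rounds, whence the factor 2.
  An encoding is never empty, so its first word can pay for all fixed parts.\<close>

definition cost :: "nat \<Rightarrow> relsym list \<Rightarrow> nat" where
  "cost z Rs = size (prologue z) + 2 * (size decls_body + 2) + size (middle z Rs) +
     query_ports.atom_cost z + size (epilogue z) + (size (last_body z) + 2) + 10"

lemma machine_computes:
  "computes_within (machine z Rs) (enc_query Q) (enc_program (program_of z Rs Q))
     (cost z Rs * query_size Q)"
proof -
  interpret query_ports z Q .
  define ws where "ws = enc_query Q"
  define n where "n = length ws"
  have n: "n = length (enc_query Q)" "0 < n" by (cases Q; simp add: n_def ws_def enc_query_def)+
  define s0 where "s0 = init_state ws"
  define s1 where "s1 = run (prologue z) s0"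
  have h1: "halts (prologue z) s0 (size (prologue z) + 1) s1"
    unfolding s1_def by (rule halts_run) (simp add: prologue_def)
  have s1: "regs s1 = (\<lambda>_. 0)(0 := n, 1 := n + 1, 2 := 8 * (z + 1))" "arrs s1 = arrs s0"
    "outp s1 = [pd z 1, 1, pd z 0, 2, 1, pd z 1, 0]"
    by (auto simp: s1_def s0_def prologue_def run_emit init_state_def set_reg_def n_def)
  define s2 where "s2 = s1\<lparr>regs := (regs s1)(1 := 0, 2 := 8 * (z + 1 + (n + 1))),
    outp := outp s1 @ decls_words [8 * (z + 1)..<8 * (z + 1 + (n + 1))]\<rparr>"
  have h2: "halts decls_loop s1 ((size decls_body + 2) * (n + 1) + 1) s2"
    unfolding s2_def by (rule halts_decls_loop) (simp_all add: s1)
  define s3 where "s3 = run (middle z Rs) s2"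
  have h3: "halts (middle z Rs) s2 (size (middle z Rs) + 1) s3"
    unfolding s3_def by (rule halts_run) (simp add: middle_def)
  have arr0: "arrs s0 = (\<lambda>_ _. 0)(0 := (\<lambda>i. if i < length ws then ws ! i else 0))"
    by (simp add: s0_def init_state_def)
  let ?out3 = "pd z 1 # enc_list (\<lambda>(R, k). [R, k]) (query_decls z n) @
    rules_words (dom_prules z Rs @ [Start (pd (z + 1) 7)])"
  have decls: "pd z 1 # enc_list (\<lambda>(R, k). [R, k]) (query_decls z n) = outp s2 @ [0]"
    by (simp add: s2_def s1 query_decls_def enc_decls add.assoc)
  have first: "prev_port (z + 2) = z + 1"
    unfolding previous_def by (rule Max_eqI) (auto dest: port_bounds)
  have s3: "frame z ws 0 (prev_port (z + 2 + 0)) (\<lambda>_. 0) (\<lambda>_. 0) ?out3 s3" "regs s3 6 = ws ! 0"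
  proof -
    define pre where "pre = dom_prules z Rs @ [Start (pd (z + 1) 7)]"
    have "middle z Rs = seqs [emit [Word 0], emit_prules (map (map_prule Word) pre),
        Assign 1 (Lit 0), Assign 2 (Lit (8 * (z + 2))), Assign 8 (Lit (8 * (z + 1))), read_word 6]"
      by (simp only: middle_def pre_def)
    then have s3: "regs s3 = (regs s2)(1 := 0, 2 := 8 * (z + 2), 8 := 8 * (z + 1), 6 := arrs s2 0 0)"
      "arrs s3 = arrs s2" "outp s3 = (outp s2 @ [0]) @ rules_words pre"
      by (simp_all add: s3_def s2_def s1 run_emit run_emit_words set_reg_def)
    have "outp s3 = ?out3" unfolding s3(3) decls[symmetric] pre_def by simp
    then show "frame z ws 0 (prev_port (z + 2 + 0)) (\<lambda>_. 0) (\<lambda>_. 0) ?out3 s3"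
      using first by (simp add: frame_def s3(1,2) s2_def s1 arr0 n_def)
    show "regs s3 6 = ws ! 0" using n(2) by (simp add: s3 s2_def s1 arr0 n_def)
  qed
  have 0: "links (z + 2 + 0) (\<lambda>_. 0)" "flags (z + 2 + 0) (\<lambda>_. 0)"
  proof -
    have "prev_at x (z + 2) = z + 1" for x
      unfolding previous_def by (rule Max_eqI) (auto dest: ports_at_bounds)
    then show "links (z + 2 + 0) (\<lambda>_. 0)" by (simp add: links_def)
    show "flags (z + 2 + 0) (\<lambda>_. 0)"
      by (auto simp: flags_def last_before_def dest: ports_at_bounds)
  qed
  have "set (positions (z + 2 + 0) Q) \<subseteq> set es" "reads ws 0 (enc_query Q)"
    using reads_self by (simp_all add: es_def ws_def)
  from halts_atoms_loop[OF this s3 0] obtain s4 A B j where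
    j: "0 + length (enc_query Q) = j + 1" and
    s4: "frame z ws j (prev_port (z + 2 + j)) A B
      (?out3 @ rules_words (concat (map (atom_prules z H) (positions (z + 2 + 0) Q)))) s4"
    "flags (z + 2 + j) B" and
    h4: "halts (atoms_loop z) s3 (atom_cost * n) s4"
    unfolding n(1) by blast
  have N: "N = z + 2 + j + 1" using j by (simp add: N_def)
  \<comment> \<open>The closing word is no port, so the invariants move on to \<open>N\<close>, the
    bound used in the goal rule and in the final pass.\<close>
  have "z + 2 + j \<notin> fst ` H"
    using j by (auto simp: ports_iff dest!: es_range[unfolded N])
  note skip = no_port_step[OF this, folded N]
  define s5 where "s5 = run (epilogue z) s4"
  have h5: "halts (epilogue z) s4 (size (epilogue z) + 1) s5"
    unfolding s5_def by (rule halts_run) (simp add: epilogue_def)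
  let ?out5 = "(?out3 @ rules_words (concat (map (atom_prules z H) es))) @
    rules_words [End (pd z 1) (pd (prev_port N) 7)]"
  have s5: "outp s5 = ?out5" "regs s5 1 = n" "regs s5 2 = 8 * (z + 2)" "regs s5 9 = 0" "arrs s5 4 = B"
    using s4(1) by (simp_all add: s5_def frame_def epilogue_def run_emit_prules set_reg_def n_def
        skip(1) es_def) (simp_all add: pd_def)
  have last: "arrs s5 4 (8 * p) = 1 \<longleftrightarrow> is_last H p" if "z + 2 \<le> p" for p
  proof -
    have "q < N" if "q \<in> ports_at H x" for q x
      using that port_bounds by (auto simp: ports_at_iff)
    then have "last_before N p \<longleftrightarrow> is_last H p" unfolding last_before_def is_last_def by blast
    moreover have "flags N B" using s4(2) skip(3) by blast
    ultimately show ?thesis using that s5(5) by (simp add: flags_def)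
  qed
  obtain s6 where h6: "halts (last_loop z) s5 ((size (last_body z) + 2) * n + 1) s6"
    and s6: "outp s6 = outp s5 @ rules_words (concat (map (last_prules z H) [z + 2..<z + 2 + n]))"
    using halts_last_loop[OF s5(2-4) _ last] by auto
  have h7: "halts (Write (Lit 0)) s6 1 (s6\<lparr>outp := outp s6 @ [0]\<rparr>)"
    unfolding halts_def using exec.Write[of "Lit 0" s6] by auto
  have prules: "query_prules z Rs Q = dom_prules z Rs @ [Start (pd (z + 1) 7)] @
      concat (map (atom_prules z H) es) @ [End (pd z 1) (pd (prev_port N) 7)] @
      concat (map (last_prules z H) [z + 2..<z + 2 + n])"
    by (simp only: query_prules_def Let_def es_def H_def N_def n(1))
  have "outp (s6\<lparr>outp := outp s6 @ [0]\<rparr>) = outp s6 @ [0]" by simp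
  also have "\<dots> = enc_program (program_of z Rs Q)"
    unfolding s6 s5(1) program_of_def enc_program.simps enc_rules prules n(1)[symmetric]
      rules_words_append
    by (simp only: append_assoc append_Cons append_Nil)
  finally have out: "outp (s6\<lparr>outp := outp s6 @ [0]\<rparr>) = enc_program (program_of z Rs Q)" .
  let ?T = "(size (prologue z) + 1) + (((size decls_body + 2) * (n + 1) + 1) +
    ((size (middle z Rs) + 1) + (atom_cost * n + ((size (epilogue z) + 1) +
    (((size (last_body z) + 2) * n + 1) + 1)))))"
  have "halts (machine z Rs) s0 ?T (s6\<lparr>outp := outp s6 @ [0]\<rparr>)"
    unfolding machine_def by (intro halts_Seq[OF h1] halts_Seq[OF h2] halts_Seq[OF h3]
        halts_Seq[OF h4] halts_Seq[OF h5] halts_Seq[OF h6] h7)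
  moreover have "?T \<le> cost z Rs * n"
  proof -
    obtain m where "n = Suc m" using n(2) by (cases n) auto
    then show ?thesis by (simp add: cost_def algebra_simps)
  qed
  ultimately have "halts (machine z Rs) s0 (cost z Rs * n) (s6\<lparr>outp := outp s6 @ [0]\<rparr>)"
    by (rule halts_mono)
  then show ?thesis
    using out unfolding computes_within_def halts_def s0_def ws_def query_size_def n(1) by blast
qed

theorem proposition19:
  fixes \<sigma> :: signature
  assumes "finite (dom \<sigma>)" and "ran \<sigma> \<subseteq> {2}"
  shows "\<exists>M c. \<forall>Q. sac2rpq \<sigma> Q \<longrightarrow>
           (\<exists>P. computes_within M (enc_query Q) (enc_program P) (c * query_size Q) \<and>
                icg_datalog \<sigma> P \<and> body_size \<sigma> P = 4 \<and>
                (\<forall>I :: 'a fact set. is_instance \<sigma> I \<longrightarrow>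
                   (sat_c2rpq I Q \<longleftrightarrow> sat_program I P)))"
proof -
  obtain z where "\<forall>R \<in> dom \<sigma>. R < z" using assms(1) unfolding finite_nat_set_iff_bounded by blast
  \<comment> \<open>All intensional names are at least \<open>8 * z\<close>, so they avoid the
    signature.\<close>
  then have z: "R < 8 * z" if "R \<in> dom \<sigma>" for R
  proof -
    have "R < z" using that \<open>\<forall>R \<in> dom \<sigma>. R < z\<close> by blast
    then show ?thesis by simp
  qed
  \<comment> \<open>The signature is fixed in advance, so \<open>z\<close> and the list of its
    symbols may enter the machine text and the constant.\<close>
  obtain Rs where Rs: "set Rs = dom \<sigma>" using finite_list[OF assms(1)] by blast
  have "sat_c2rpq I Q \<longleftrightarrow> sat_program I (program_of z Rs Q)"
    if "sac2rpq \<sigma> Q" "is_instance \<sigma> I" for Q and I :: "'a fact set"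
  proof -
    interpret query_program z Q \<sigma> Rs I by unfold_locales (use that assms Rs in auto)
    show ?thesis
      using sat_iff_der0[OF that(1)]
        sat_program_iff_der0[OF that(2) assms(2), of "program_of z Rs Q" "query_prules z Rs Q"]
      by (simp add: program_of_def S_def)
  qed
  moreover have "icg_datalog \<sigma> (program_of z Rs Q) \<and> body_size \<sigma> (program_of z Rs Q) = 4"
    if "sac2rpq \<sigma> Q" for Q
    using program_of_icg[OF assms(2) Rs z] that by (simp add: sac2rpq_def)
  ultimately show ?thesis
    by (intro exI[of _ "machine z Rs"] exI[of _ "cost z Rs"]) (blast intro: machine_computes)
qed

end
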